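(* Let $R$ be a commutative ring and let $\mathbb G$ be a functor of monoids (on commutative $R$-algebras) whose functor of functions $\mathbb A_{\mathbb G}$ is reflexive. Then the closure of dual functors of algebras of $\mathbb G$ is $\mathbb A_{\mathbb G}^*$; that is, $$\operatorname{Hom}_{mon}(\mathbb G,\mathbb B)=\operatorname{Hom}_{\mathcal R\text{-alg}}(\mathcal R\mathbb G,\mathbb B)=\operatorname{Hom}_{\mathcal R\text{-alg}}(\mathbb A_{\mathbb G}^*,\mathbb B)$$ for every dual functor of $\mathcal R$-algebras $\mathbb B$, where the identifications are given by composition with the natural morphisms $\mathbb G\to\mathcal R\mathbb G\to\mathbb A_{\mathbb G}^*$.
   Context: All functors are covariant functors on the category of commutative (associative, unital) $R$-algebras. $\mathcal R(S)=S$. A functor of $\mathcal R$-modules is a functor $\mathbb M$ with functorial $S$-module structures on $\mathbb M(S)$; a functor of $\mathcal R$-algebras (associative, unital) is defined analogously, with $S$ central in $\mathbb B(S)$. $\mathbb{H}om_{\mathcal R}(\mathbb M,\mathbb M')(S):=\operatorname{Hom}_{\mathcal S}(\mathbb M_{|S},\mathbb M'_{|S})$ where $|S$ denotes restriction to commutative $S$-algebras, and $\mathbb M^*:=\mathbb{H}om_{\mathcal R}(\mathbb M,\mathcal R)$ (only functors for which these are sets are considered). A dual functor is one of the form $\mathbb N^*$; a dual functor of $\mathcal R$-algebras is a functor of $\mathcal R$-algebras whose underlying functor of $\mathcal R$-modules is a dual functor. $\mathbb M$ is reflexive if the canonical morphism $\mathbb M\to\mathbb M^{**}$ is an isomorphism.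 $\mathbb A_{\mathbb G}(S):=\operatorname{Hom}(\mathbb G_{|S},\mathcal R_{|S})$. $\mathcal R\mathbb G(S)$ is the monoid algebra $S[\mathbb G(S)]$ (formal finite $S$-linear combinations of elements of $\mathbb G(S)$), a functor of $\mathcal R$-algebras with $(\mathcal R\mathbb G)^*=\mathbb A_{\mathbb G}$. The natural morphism $\mathbb G\to\mathbb A_{\mathbb G}^*$ is $g\mapsto(f\mapsto f(g))$, and $\mathbb A_{\mathbb G}^*$ carries the unique structure of functor of $\mathcal R$-algebras making it a morphism of functors of monoids (explicitly $(w\cdot w')(f)=w\big(g\mapsto w'(h\mapsto f(gh))\big)$). $\operatorname{Hom}_{mon}(\mathbb G,\mathbb B)$ is the set of morphisms of functors of monoids, $\mathbb B$ being a monoid under multiplication. *)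

theory Defs
  imports "HOL-Algebra.Module"
begin

section \<open>Commutative algebras over a commutative ring\<close>

text \<open>
  A commutative \<open>R\<close>-algebra is a commutative ring together with a ring homomorphism from \<open>R\<close>.
  All rings have their carrier in one type \<^typ>\<open>'u\<close>, which serves as the universe.
  Structure maps and algebra homomorphisms are extensional, so that equality of functions is
  equality of morphisms and restriction of scalars is strictly functorial.
\<close>

record 'u alg = "'u ring" +
  structure_map :: "'u \<Rightarrow> 'u"

definition algebras :: "('u, 'z) ring_scheme \<Rightarrow> 'u alg set" where
  "algebras R = {S. cring S \<and> structure_map S \<in> ring_hom R S
                    \<and> structure_map S \<in> extensional (carrier R)}"

definition algebra_homs :: "('u, 'z) ring_scheme \<Rightarrow> 'u alg \<Rightarrow> 'u alg \<Rightarrow> ('u \<Rightarrow> 'u) set" where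
  "algebra_homs R S T = {f \<in> ring_hom S T. f \<in> extensional (carrier S)
                    \<and> (\<forall>r\<in>carrier R. f (structure_map S r) = structure_map T r)}"

definition restrict_scalars :: "('u, 'z) ring_scheme \<Rightarrow> ('u \<Rightarrow> 'u) \<Rightarrow> 'u alg \<Rightarrow> 'u alg" where
  "restrict_scalars R f T = T\<lparr>structure_map := compose (carrier R) (structure_map T) f\<rparr>"

text \<open>For \<open>S\<close> an \<open>R\<close>-algebra and \<open>T\<close> an \<open>S\<close>-algebra: \<open>T\<close> as an \<open>R\<close>-algebra.\<close>

abbreviation alg_restrict :: "('u, 'z) ring_scheme \<Rightarrow> 'u alg \<Rightarrow> 'u alg \<Rightarrow> 'u alg" where
  "alg_restrict R S T \<equiv> restrict_scalars R (structure_map S) T"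

text \<open>\<open>S\<close> as an algebra over itself.\<close>

definition self_alg :: "'u alg \<Rightarrow> 'u alg" where
  "self_alg S = S\<lparr>structure_map := (\<lambda>s\<in>carrier S. s)\<rparr>"


section \<open>Functors on commutative algebras\<close>

text \<open>
  The type \<^typ>\<open>'a\<close> contains the elements of the values, \<^typ>\<open>'x\<close> is the record type of the
  values (\<^typ>\<open>'a monoid\<close> for functors of monoids, \<^typ>\<open>('u, 'a) module\<close> for functors of
  modules and of algebras).
\<close>

record ('u, 'a, 'x) alg_functor =
  obj :: "'u alg \<Rightarrow> 'x"
  arr :: "'u alg \<Rightarrow> 'u alg \<Rightarrow> ('u \<Rightarrow> 'u) \<Rightarrow> 'a \<Rightarrow> 'a"

definition set_functor ::
  "('u, 'z) ring_scheme \<Rightarrow> ('u, 'a, ('a, 'y) partial_object_scheme) alg_functor \<Rightarrow> bool" where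
  "set_functor R F \<longleftrightarrow>
     (\<forall>S\<in>algebras R. \<forall>T\<in>algebras R. \<forall>f\<in>algebra_homs R S T.
        arr F S T f \<in> carrier (obj F S) \<rightarrow> carrier (obj F T)) \<and>
     (\<forall>S\<in>algebras R. \<forall>x\<in>carrier (obj F S). arr F S S (\<lambda>s\<in>carrier S. s) x = x) \<and>
     (\<forall>S\<in>algebras R. \<forall>T\<in>algebras R. \<forall>U\<in>algebras R.
        \<forall>f\<in>algebra_homs R S T. \<forall>g\<in>algebra_homs R T U. \<forall>x\<in>carrier (obj F S).
        arr F S U (compose (carrier S) g f) x = arr F T U g (arr F S T f x))"

definition monoid_functor ::
  "('u, 'z) ring_scheme \<Rightarrow> ('u, 'g, ('g, 'y) monoid_scheme) alg_functor \<Rightarrow> bool" where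
  "monoid_functor R G \<longleftrightarrow> set_functor R G \<and>
     (\<forall>S\<in>algebras R. monoid (obj G S)) \<and>
     (\<forall>S\<in>algebras R. \<forall>T\<in>algebras R. \<forall>f\<in>algebra_homs R S T.
        arr G S T f \<in> hom (obj G S) (obj G T) \<and>
        arr G S T f \<one>\<^bsub>obj G S\<^esub> = \<one>\<^bsub>obj G T\<^esub>)"

definition module_functor ::
  "('u, 'z) ring_scheme \<Rightarrow> ('u, 'm, ('u, 'm) module) alg_functor \<Rightarrow> bool" where
  "module_functor R M \<longleftrightarrow> set_functor R M \<and>
     (\<forall>S\<in>algebras R. module S (obj M S)) \<and>
     (\<forall>S\<in>algebras R. \<forall>T\<in>algebras R. \<forall>f\<in>algebra_homs R S T.
        (\<forall>x\<in>carrier (obj M S). \<forall>y\<in>carrier (obj M S).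
           arr M S T f (x \<oplus>\<^bsub>obj M S\<^esub> y) = arr M S T f x \<oplus>\<^bsub>obj M T\<^esub> arr M S T f y) \<and>
        (\<forall>s\<in>carrier S. \<forall>x\<in>carrier (obj M S).
           arr M S T f (s \<odot>\<^bsub>obj M S\<^esub> x) = f s \<odot>\<^bsub>obj M T\<^esub> arr M S T f x))"

definition algebra_functor ::
  "('u, 'z) ring_scheme \<Rightarrow> ('u, 'b, ('u, 'b) module) alg_functor \<Rightarrow> bool" where
  "algebra_functor R B \<longleftrightarrow> module_functor R B \<and>
     (\<forall>S\<in>algebras R. ring (obj B S) \<and>
        (\<forall>s\<in>carrier S. \<forall>x\<in>carrier (obj B S). \<forall>y\<in>carrier (obj B S).
           (s \<odot>\<^bsub>obj B S\<^esub> x) \<otimes>\<^bsub>obj B S\<^esub> y = s \<odot>\<^bsub>obj B S\<^esub> (x \<otimes>\<^bsub>obj B S\<^esub> y) \<and>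
           x \<otimes>\<^bsub>obj B S\<^esub> (s \<odot>\<^bsub>obj B S\<^esub> y) = s \<odot>\<^bsub>obj B S\<^esub> (x \<otimes>\<^bsub>obj B S\<^esub> y))) \<and>
     (\<forall>S\<in>algebras R. \<forall>T\<in>algebras R. \<forall>f\<in>algebra_homs R S T.
        arr B S T f \<in> ring_hom (obj B S) (obj B T))"

definition restrict_functor ::
  "('u, 'z) ring_scheme \<Rightarrow> 'u alg \<Rightarrow> ('u, 'a, 'x) alg_functor \<Rightarrow> ('u, 'a, 'x) alg_functor" where
  "restrict_functor R S F =
     \<lparr>obj = (\<lambda>T. obj F (alg_restrict R S T)),
      arr = (\<lambda>T U. arr F (alg_restrict R S T) (alg_restrict R S U))\<rparr>"

definition scalar_functor :: "('u, 'u, ('u, 'u) module) alg_functor" where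
  "scalar_functor =
     \<lparr>obj = (\<lambda>S. \<lparr>carrier = carrier S, monoid.mult = monoid.mult S, one = one S,
                  zero = zero S, add = add S, smult = monoid.mult S\<rparr>),
      arr = (\<lambda>S T f. f)\<rparr>"


section \<open>Morphisms\<close>

text \<open>Families are extensional, so that equality of families is equality of morphisms.\<close>

definition nat_trans ::
  "('u, 'z) ring_scheme \<Rightarrow> ('u, 'a, ('a, 'y) partial_object_scheme) alg_functor \<Rightarrow>
   ('u, 'b, ('b, 'x) partial_object_scheme) alg_functor \<Rightarrow> ('u alg \<Rightarrow> 'a \<Rightarrow> 'b) set" where
  "nat_trans R F H =
     {\<tau> \<in> (\<Pi>\<^sub>E S\<in>algebras R. carrier (obj F S) \<rightarrow>\<^sub>E carrier (obj H S)).
        \<forall>S\<in>algebras R. \<forall>T\<in>algebras R. \<forall>f\<in>algebra_homs R S T. \<forall>x\<in>carrier (obj F S).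
          \<tau> T (arr F S T f x) = arr H S T f (\<tau> S x)}"

definition monoid_morphisms ::
  "('u, 'z) ring_scheme \<Rightarrow> ('u, 'a, ('a, 'y) monoid_scheme) alg_functor \<Rightarrow>
   ('u, 'b, ('b, 'x) monoid_scheme) alg_functor \<Rightarrow> ('u alg \<Rightarrow> 'a \<Rightarrow> 'b) set" where
  "monoid_morphisms R F H =
     {\<tau> \<in> nat_trans R F H. \<forall>S\<in>algebras R.
        \<tau> S \<in> hom (obj F S) (obj H S) \<and> \<tau> S \<one>\<^bsub>obj F S\<^esub> = \<one>\<^bsub>obj H S\<^esub>}"

definition module_morphisms ::
  "('u, 'z) ring_scheme \<Rightarrow> ('u, 'a, ('u, 'a) module) alg_functor \<Rightarrow>
   ('u, 'b, ('u, 'b) module) alg_functor \<Rightarrow> ('u alg \<Rightarrow> 'a \<Rightarrow> 'b) set" where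
  "module_morphisms R M N =
     {\<tau> \<in> nat_trans R M N. \<forall>S\<in>algebras R.
        (\<forall>x\<in>carrier (obj M S). \<forall>y\<in>carrier (obj M S).
           \<tau> S (x \<oplus>\<^bsub>obj M S\<^esub> y) = \<tau> S x \<oplus>\<^bsub>obj N S\<^esub> \<tau> S y) \<and>
        (\<forall>s\<in>carrier S. \<forall>x\<in>carrier (obj M S).
           \<tau> S (s \<odot>\<^bsub>obj M S\<^esub> x) = s \<odot>\<^bsub>obj N S\<^esub> \<tau> S x)}"

definition algebra_morphisms ::
  "('u, 'z) ring_scheme \<Rightarrow> ('u, 'a, ('u, 'a) module) alg_functor \<Rightarrow>
   ('u, 'b, ('u, 'b) module) alg_functor \<Rightarrow> ('u alg \<Rightarrow> 'a \<Rightarrow> 'b) set" where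
  "algebra_morphisms R A B =
     {\<tau> \<in> module_morphisms R A B. \<forall>S\<in>algebras R. \<tau> S \<in> ring_hom (obj A S) (obj B S)}"

text \<open>The composite of \<open>\<tau>\<close> (with source \<open>F\<close>) followed by \<open>\<phi>\<close>.\<close>

definition comp_trans ::
  "('u, 'z) ring_scheme \<Rightarrow> ('u, 'a, ('a, 'y) partial_object_scheme) alg_functor \<Rightarrow>
   ('u alg \<Rightarrow> 'b \<Rightarrow> 'c) \<Rightarrow> ('u alg \<Rightarrow> 'a \<Rightarrow> 'b) \<Rightarrow> ('u alg \<Rightarrow> 'a \<Rightarrow> 'c)" where
  "comp_trans R F \<phi> \<tau> = (\<lambda>S\<in>algebras R. \<lambda>x\<in>carrier (obj F S). \<phi> S (\<tau> S x))"

definition module_isomorphism ::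
  "('u, 'z) ring_scheme \<Rightarrow> ('u, 'a, ('u, 'a) module) alg_functor \<Rightarrow>
   ('u, 'b, ('u, 'b) module) alg_functor \<Rightarrow> ('u alg \<Rightarrow> 'a \<Rightarrow> 'b) \<Rightarrow> bool" where
  "module_isomorphism R M N \<tau> \<longleftrightarrow> \<tau> \<in> module_morphisms R M N \<and>
     (\<exists>\<sigma>\<in>module_morphisms R N M. \<forall>S\<in>algebras R.
        (\<forall>x\<in>carrier (obj M S). \<sigma> S (\<tau> S x) = x) \<and>
        (\<forall>y\<in>carrier (obj N S). \<tau> S (\<sigma> S y) = y))"


section \<open>Functors of homomorphisms, duals, reflexivity\<close>

text \<open>
  Pointwise operations on a set \<open>X\<close> of families from \<open>F\<close> to \<open>H\<close>, as a structure over \<open>S\<close>.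
  The multiplicative part is meaningful only if \<open>H\<close> is multiplicative and \<open>X\<close> is closed under
  it, as for the functor of functions below; no use is made of it otherwise.
\<close>

definition pointwise ::
  "'u alg \<Rightarrow> ('u, 'a, ('a, 'y) partial_object_scheme) alg_functor \<Rightarrow>
   ('u, 'b, ('u, 'b) module) alg_functor \<Rightarrow> ('u alg \<Rightarrow> 'a \<Rightarrow> 'b) set \<Rightarrow>
   ('u, 'u alg \<Rightarrow> 'a \<Rightarrow> 'b) module" where
  "pointwise S F H X =
     \<lparr>carrier = X,
      monoid.mult = (\<lambda>\<tau> \<sigma>. \<lambda>T\<in>algebras S. \<lambda>x\<in>carrier (obj F T). \<tau> T x \<otimes>\<^bsub>obj H T\<^esub> \<sigma> T x),
      one = (\<lambda>T\<in>algebras S. \<lambda>x\<in>carrier (obj F T). \<one>\<^bsub>obj H T\<^esub>),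
      zero = (\<lambda>T\<in>algebras S. \<lambda>x\<in>carrier (obj F T). \<zero>\<^bsub>obj H T\<^esub>),
      add = (\<lambda>\<tau> \<sigma>. \<lambda>T\<in>algebras S. \<lambda>x\<in>carrier (obj F T). \<tau> T x \<oplus>\<^bsub>obj H T\<^esub> \<sigma> T x),
      smult = (\<lambda>s \<tau>. \<lambda>T\<in>algebras S. \<lambda>x\<in>carrier (obj F T).
                 structure_map T s \<odot>\<^bsub>obj H T\<^esub> \<tau> T x)\<rparr>"

definition hom_functor ::
  "('u, 'z) ring_scheme \<Rightarrow> ('u, 'm, ('u, 'm) module) alg_functor \<Rightarrow>
   ('u, 'n, ('u, 'n) module) alg_functor \<Rightarrow>
   ('u, 'u alg \<Rightarrow> 'm \<Rightarrow> 'n, ('u, 'u alg \<Rightarrow> 'm \<Rightarrow> 'n) module) alg_functor" where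
  "hom_functor R M N =
     \<lparr>obj = (\<lambda>S. pointwise S (restrict_functor R S M) (restrict_functor R S N)
               (module_morphisms S (restrict_functor R S M) (restrict_functor R S N))),
      arr = (\<lambda>S S' f \<tau>. \<lambda>T\<in>algebras S'. \<tau> (restrict_scalars S f T))\<rparr>"

definition dual ::
  "('u, 'z) ring_scheme \<Rightarrow> ('u, 'm, ('u, 'm) module) alg_functor \<Rightarrow>
   ('u, 'u alg \<Rightarrow> 'm \<Rightarrow> 'u, ('u, 'u alg \<Rightarrow> 'm \<Rightarrow> 'u) module) alg_functor" where
  "dual R M = hom_functor R M scalar_functor"

text \<open>
  For \<open>E\<close> a functor of functions on \<open>F\<close> (with or without linearity), the morphism from \<open>F\<close> to
  the dual of \<open>E\<close> sending \<open>x\<close> to evaluation at \<open>x\<close>. An element \<open>w\<close> of \<open>E(T)\<close> is a family indexed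
  by \<open>T\<close>-algebras; its value at an element of \<open>F(T)\<close> is taken at the \<open>T\<close>-algebra \<open>T\<close>.
\<close>

definition evaluation ::
  "('u, 'z) ring_scheme \<Rightarrow> ('u, 'a, ('a, 'y) partial_object_scheme) alg_functor \<Rightarrow>
   ('u, 'u alg \<Rightarrow> 'a \<Rightarrow> 'u, ('u, 'u alg \<Rightarrow> 'a \<Rightarrow> 'u) module) alg_functor \<Rightarrow>
   'u alg \<Rightarrow> 'a \<Rightarrow> ('u alg \<Rightarrow> ('u alg \<Rightarrow> 'a \<Rightarrow> 'u) \<Rightarrow> 'u)" where
  "evaluation R F E =
     (\<lambda>S\<in>algebras R. \<lambda>x\<in>carrier (obj F S).
        \<lambda>T\<in>algebras S. \<lambda>w\<in>carrier (obj E (alg_restrict R S T)).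
          w (self_alg (alg_restrict R S T)) (arr F S (alg_restrict R S T) (structure_map T) x))"

definition reflexive ::
  "('u, 'z) ring_scheme \<Rightarrow> ('u, 'm, ('u, 'm) module) alg_functor \<Rightarrow> bool" where
  "reflexive R M \<longleftrightarrow> module_isomorphism R M (dual R (dual R M)) (evaluation R M (dual R M))"

definition dual_algebra_functor ::
  "('u, 'z) ring_scheme \<Rightarrow> ('u, 'n, ('u, 'n) module) alg_functor \<Rightarrow>
   ('u, 'b, ('u, 'b) module) alg_functor \<Rightarrow> bool" where
  "dual_algebra_functor R N B \<longleftrightarrow> algebra_functor R B \<and> module_functor R N \<and>
     (\<exists>\<tau>. module_isomorphism R B (dual R N) \<tau>)"


section \<open>Functions, monoid algebra and distributions of a functor of monoids\<close>

definition function_functor ::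
  "('u, 'z) ring_scheme \<Rightarrow> ('u, 'g, ('g, 'y) partial_object_scheme) alg_functor \<Rightarrow>
   ('u, 'u alg \<Rightarrow> 'g \<Rightarrow> 'u, ('u, 'u alg \<Rightarrow> 'g \<Rightarrow> 'u) module) alg_functor" where
  "function_functor R G =
     \<lparr>obj = (\<lambda>S. pointwise S (restrict_functor R S G) (restrict_functor R S scalar_functor)
               (nat_trans S (restrict_functor R S G) (restrict_functor R S scalar_functor))),
      arr = (\<lambda>S S' f \<tau>. \<lambda>T\<in>algebras S'. \<tau> (restrict_scalars S f T))\<rparr>"

definition monoid_algebra ::
  "'u alg \<Rightarrow> ('g, 'y) monoid_scheme \<Rightarrow> ('u, 'g \<Rightarrow> 'u) module" where
  "monoid_algebra S H =
     \<lparr>carrier = {a. (\<forall>g\<in>carrier H. a g \<in> carrier S) \<and> (\<forall>g. g \<notin> carrier H \<longrightarrow> a g = \<zero>\<^bsub>S\<^esub>) \<and>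
                    finite {g. a g \<noteq> \<zero>\<^bsub>S\<^esub>}},
      monoid.mult = (\<lambda>a b g.
        \<Oplus>\<^bsub>S\<^esub>p\<in>{(h, k). a h \<noteq> \<zero>\<^bsub>S\<^esub> \<and> b k \<noteq> \<zero>\<^bsub>S\<^esub> \<and> h \<otimes>\<^bsub>H\<^esub> k = g}. a (fst p) \<otimes>\<^bsub>S\<^esub> b (snd p)),
      one = (\<lambda>g. if g = \<one>\<^bsub>H\<^esub> then \<one>\<^bsub>S\<^esub> else \<zero>\<^bsub>S\<^esub>),
      zero = (\<lambda>g. \<zero>\<^bsub>S\<^esub>),
      add = (\<lambda>a b g. a g \<oplus>\<^bsub>S\<^esub> b g),
      smult = (\<lambda>s a g. s \<otimes>\<^bsub>S\<^esub> a g)\<rparr>"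

definition monoid_algebra_functor ::
  "('u, 'g, ('g, 'y) monoid_scheme) alg_functor \<Rightarrow>
   ('u, 'g \<Rightarrow> 'u, ('u, 'g \<Rightarrow> 'u) module) alg_functor" where
  "monoid_algebra_functor G =
     \<lparr>obj = (\<lambda>S. monoid_algebra S (obj G S)),
      arr = (\<lambda>S T f a g'. \<Oplus>\<^bsub>T\<^esub>g\<in>{g. a g \<noteq> \<zero>\<^bsub>S\<^esub> \<and> arr G S T f g = g'}. f (a g))\<rparr>"

text \<open>For \<open>f \<in> A\<^sub>G(S)\<close> and \<open>g \<in> G(S)\<close>: the function \<open>h \<mapsto> f(gh)\<close>.\<close>

definition translate ::
  "('u, 'z) ring_scheme \<Rightarrow> ('u, 'g, ('g, 'y) monoid_scheme) alg_functor \<Rightarrow> 'u alg \<Rightarrow>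
   ('u alg \<Rightarrow> 'g \<Rightarrow> 'u) \<Rightarrow> 'g \<Rightarrow> ('u alg \<Rightarrow> 'g \<Rightarrow> 'u)" where
  "translate R G S f g =
     (\<lambda>T\<in>algebras S. \<lambda>h\<in>carrier (obj G (alg_restrict R S T)).
        f T (arr G S (alg_restrict R S T) (structure_map T) g \<otimes>\<^bsub>obj G (alg_restrict R S T)\<^esub> h))"

text \<open>For \<open>w \<in> A\<^sub>G\<^sup>*(S)\<close> and \<open>f \<in> A\<^sub>G(S)\<close>: the function \<open>g \<mapsto> w (h \<mapsto> f(gh))\<close>.\<close>

definition partial_apply ::
  "('u, 'z) ring_scheme \<Rightarrow> ('u, 'g, ('g, 'y) monoid_scheme) alg_functor \<Rightarrow> 'u alg \<Rightarrow>
   ('u alg \<Rightarrow> ('u alg \<Rightarrow> 'g \<Rightarrow> 'u) \<Rightarrow> 'u) \<Rightarrow> ('u alg \<Rightarrow> 'g \<Rightarrow> 'u) \<Rightarrow> ('u alg \<Rightarrow> 'g \<Rightarrow> 'u)" where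
  "partial_apply R G S w f =
     (\<lambda>T\<in>algebras S. \<lambda>g\<in>carrier (obj G (alg_restrict R S T)).
        w T (translate R G (alg_restrict R S T)
               (arr (function_functor R G) S (alg_restrict R S T) (structure_map T) f) g))"

text \<open>The dual \<open>A\<^sub>G\<^sup>*\<close> with the product \<open>(w w')(f) = w (g \<mapsto> w' (h \<mapsto> f(gh)))\<close>.\<close>

definition distribution_functor ::
  "('u, 'z) ring_scheme \<Rightarrow> ('u, 'g, ('g, 'y) monoid_scheme) alg_functor \<Rightarrow>
   ('u, 'u alg \<Rightarrow> ('u alg \<Rightarrow> 'g \<Rightarrow> 'u) \<Rightarrow> 'u,
    ('u, 'u alg \<Rightarrow> ('u alg \<Rightarrow> 'g \<Rightarrow> 'u) \<Rightarrow> 'u) module) alg_functor" where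
  "distribution_functor R G =
     (let A = function_functor R G; D = dual R A in
     \<lparr>obj = (\<lambda>S. (obj D S)
        \<lparr>monoid.mult := (\<lambda>w w'. \<lambda>T\<in>algebras S. \<lambda>f\<in>carrier (obj A (alg_restrict R S T)).
            w T (partial_apply R G (alg_restrict R S T)
                   (arr D S (alg_restrict R S T) (structure_map T) w') f)),
         one := evaluation R G A S \<one>\<^bsub>obj G S\<^esub>\<rparr>),
      arr = arr D\<rparr>)"

text \<open>The natural morphisms from \<open>G\<close> to \<open>RG\<close>, from \<open>G\<close> to \<open>A\<^sub>G\<^sup>*\<close> and from \<open>RG\<close> to \<open>A\<^sub>G\<^sup>*\<close>.\<close>

definition to_monoid_algebra ::
  "('u, 'z) ring_scheme \<Rightarrow> ('u, 'g, ('g, 'y) monoid_scheme) alg_functor \<Rightarrow>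
   'u alg \<Rightarrow> 'g \<Rightarrow> ('g \<Rightarrow> 'u)" where
  "to_monoid_algebra R G =
     (\<lambda>S\<in>algebras R. \<lambda>g\<in>carrier (obj G S). \<lambda>h. if h = g then \<one>\<^bsub>S\<^esub> else \<zero>\<^bsub>S\<^esub>)"

definition to_distributions ::
  "('u, 'z) ring_scheme \<Rightarrow> ('u, 'g, ('g, 'y) monoid_scheme) alg_functor \<Rightarrow>
   'u alg \<Rightarrow> 'g \<Rightarrow> ('u alg \<Rightarrow> ('u alg \<Rightarrow> 'g \<Rightarrow> 'u) \<Rightarrow> 'u)" where
  "to_distributions R G = evaluation R G (function_functor R G)"

definition monoid_algebra_to_distributions ::
  "('u, 'z) ring_scheme \<Rightarrow> ('u, 'g, ('g, 'y) monoid_scheme) alg_functor \<Rightarrow>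
   'u alg \<Rightarrow> ('g \<Rightarrow> 'u) \<Rightarrow> ('u alg \<Rightarrow> ('u alg \<Rightarrow> 'g \<Rightarrow> 'u) \<Rightarrow> 'u)" where
  "monoid_algebra_to_distributions R G =
     (\<lambda>S\<in>algebras R. \<lambda>a\<in>carrier (monoid_algebra S (obj G S)).
        \<Oplus>\<^bsub>obj (distribution_functor R G) S\<^esub>g\<in>{g. a g \<noteq> \<zero>\<^bsub>S\<^esub>}.
           a g \<odot>\<^bsub>obj (distribution_functor R G) S\<^esub> to_distributions R G S g)"

end

theory Submission
  imports Defs
begin

text \<open>
  Existence: if \<open>B\<close> is dual to \<open>N\<close>, then a morphism \<open>\<phi>\<close> from \<open>G\<close> to \<open>B\<close> extends to \<open>A\<^sub>G\<^sup>*\<close> by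
  \<open>w \<mapsto> (n \<mapsto> w (g \<mapsto> \<phi>(g)(n)))\<close>. Uniqueness: for a linear morphism \<open>\<psi>\<close>
  from \<open>A\<^sub>G\<^sup>*\<close> to \<open>B\<close> and \<open>n\<close> in \<open>N\<close>, the map \<open>w \<mapsto> \<psi>(w)(n)\<close> lies in the bidual of \<open>A\<^sub>G\<close>, so by
  reflexivity it is evaluation at a function \<open>f\<close>, and \<open>f(g) = \<psi>(g)(n)\<close> is determined by \<open>\<psi>\<close> on \<open>G\<close>.
  Multiplicativity of the extension follows from this uniqueness, used first for the linear maps
  \<open>v \<mapsto> \<phi>(g v)\<close> and \<open>v \<mapsto> \<phi>(g) \<phi>(v)\<close>, then with an arbitrary distribution on the right.
\<close>

section \<open>Families indexed by algebras\<close>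

text \<open>The formula for the extension does not mention products in \<open>B\<close>, which is
  why multiplicativity has to be obtained from uniqueness. The obstacle is that v \<mapsto> \<phi>(g
  v) depends on a point g over some \<open>S\<close>: it is a morphism of functors over
  \<open>S\<close>, not over \<open>R\<close>. Uniqueness is therefore needed after an arbitrary
  base change. Iterating restrictions of scalars would be unwieldy, so linear maps over
  \<open>S\<close>, like all elements of functors of homomorphisms, are treated as families indexed
  by an \<open>R\<close>-algebra \<open>T\<close> and a morphism \<open>h\<close> from
  \<open>S\<close> to \<open>T\<close>, and compared value by value. The form of \<open>B\<close> as
  a dual serves twice: an element of \<open>B\<close> can be prescribed by its values on
  \<open>N\<close>, and an equation in \<open>B\<close> can be tested on scalars. The bijection
  between morphisms from \<open>A\<^sub>G\<^sup>*\<close> and morphisms from \<open>RG\<close> is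
  not constructed separately; it follows from the other two because the natural morphisms form a
  commuting triangle.\<close>

lemma alg_update_simps [simp]:
  "carrier (restrict_scalars R f T) = carrier T"
  "structure_map (restrict_scalars R f T) = compose (carrier R) (structure_map T) f"
  "carrier (self_alg T) = carrier T"
  "structure_map (self_alg T) = (\<lambda>s\<in>carrier T. s)"
  by (simp_all add: restrict_scalars_def self_alg_def)

lemma ring_hom_update [simp]:
  "ring_hom (T\<lparr>structure_map := h\<rparr>) U = ring_hom T U"
  "ring_hom S (U\<lparr>structure_map := h\<rparr>) = ring_hom S U"
  by (simp_all add: ring_hom_def)

text \<open>The ring axioms read only the ring fields of the record, so everything is unfolded down
  to these fields.\<close>

lemma cring_update [simp]: "cring (T\<lparr>structure_map := h\<rparr>) \<longleftrightarrow> cring T"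
  for T :: "'u alg"
  unfolding cring_def ring_def abelian_group_def abelian_group_axioms_def abelian_monoid_def
    comm_monoid_def comm_monoid_axioms_def monoid_def ring_axioms_def comm_group_def group_def group_axioms_def Units_def
  by simp

lemma algebra_homsD:
  assumes "h \<in> algebra_homs R S T"
  shows "h \<in> ring_hom S T" "h \<in> extensional (carrier S)" "h \<in> carrier S \<rightarrow> carrier T"
    "r \<in> carrier R \<Longrightarrow> h (structure_map S r) = structure_map T r"
  using assms by (auto simp: algebra_homs_def ring_hom_def)

lemma algebra_homs_closed: "h \<in> algebra_homs R S T \<Longrightarrow> s \<in> carrier S \<Longrightarrow> h s \<in> carrier T"
  by (auto simp: algebra_homs_def ring_hom_def)

lemma algebrasD:
  assumes "S \<in> algebras R"
  shows "cring S" "structure_map S \<in> ring_hom R S" "structure_map S \<in> extensional (carrier R)"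
    "structure_map S \<in> carrier R \<rightarrow> carrier S" "ring S"
  using assms by (auto simp: algebras_def ring_hom_def cring.axioms)

lemma ring_hom_compose:
  assumes "h \<in> ring_hom S T" "k \<in> ring_hom T U" "cring S"
  shows "compose (carrier S) k h \<in> ring_hom S U"
proof -
  interpret cring S by fact
  show ?thesis
    using assms(1,2) by (intro ring_hom_memI) (auto simp: compose_eq ring_hom_def Pi_def)
qed

lemma id_mem_algebra_homs: "S \<in> algebras R \<Longrightarrow> (\<lambda>s\<in>carrier S. s) \<in> algebra_homs R S S"
proof -
  assume S: "S \<in> algebras R"
  interpret cring S using S by (rule algebrasD)
  show ?thesis
    using algebrasD[OF S] by (auto simp: algebra_homs_def ring_hom_def Pi_def)
qed

lemma compose_mem_algebra_homs:
  assumes "S \<in> algebras R" "h \<in> algebra_homs R S T" "k \<in> algebra_homs R T U"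
  shows "compose (carrier S) k h \<in> algebra_homs R S U"
  using assms ring_hom_compose[of h S T k U] algebrasD[OF assms(1)]
    algebra_homsD[OF assms(2)] algebra_homsD[OF assms(3)]
  by (auto simp: algebra_homs_def compose_def)

text \<open>A family over \<open>S\<close> is indexed by \<open>S\<close>-algebras; its component at
  \<open>S\<close> over itself is the actual function on the values of the functor at
  \<open>S\<close>.\<close>

definition val :: "'u alg \<Rightarrow> ('u alg \<Rightarrow> 'a \<Rightarrow> 'b) \<Rightarrow> 'a \<Rightarrow> 'b" where
  "val S w = w (self_alg S)"

text \<open>This reindexing is the action on arrows of the functors of functions, of duals and of
  distributions alike, so one set of lemmas about \<open>res\<close> serves all three.\<close>

definition res :: "'u alg \<Rightarrow> 'u alg \<Rightarrow> ('u \<Rightarrow> 'u) \<Rightarrow> ('u alg \<Rightarrow> 'b) \<Rightarrow> 'u alg \<Rightarrow> 'b" where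
  "res S T h w = (\<lambda>U\<in>algebras T. w (restrict_scalars S h U))"

text \<open>
  An \<open>S\<close>-algebra is the same as an \<open>R\<close>-algebra \<open>T\<close> with a morphism \<open>h\<close> from \<open>S\<close> to \<open>T\<close>, so an
  element of a functor of homomorphisms is the same as a family \<open>\<phi> T h\<close>.
\<close>

definition family ::
  "('u, 'z) ring_scheme \<Rightarrow> ('u, 'a, ('a, 'y) partial_object_scheme) alg_functor \<Rightarrow> 'u alg \<Rightarrow>
   ('u alg \<Rightarrow> ('u \<Rightarrow> 'u) \<Rightarrow> 'a \<Rightarrow> 'b) \<Rightarrow> 'u alg \<Rightarrow> 'a \<Rightarrow> 'b" where
  "family R F S \<phi> = (\<lambda>T\<in>algebras S. \<lambda>x\<in>carrier (obj F (alg_restrict R S T)).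
     \<phi> (alg_restrict R S T) (structure_map T) x)"

section \<open>Algebras over \<open>S\<close> as \<open>R\<close>-algebras under
  \<open>S\<close>\<close>

locale base_ring =
  fixes R :: "('u, 'z) ring_scheme"
  assumes base: "cring R"
begin

lemma alg_restrict_mem:
  assumes "S \<in> algebras R" "T \<in> algebras S"
  shows "alg_restrict R S T \<in> algebras R" "structure_map T \<in> algebra_homs R S (alg_restrict R S T)"
proof -
  have "compose (carrier R) (structure_map T) (structure_map S) \<in> ring_hom R T"
    using algebrasD[OF assms(1)] algebrasD[OF assms(2)] base by (intro ring_hom_compose)
  then show "alg_restrict R S T \<in> algebras R"
    using algebrasD[OF assms(2)] by (simp add: algebras_def restrict_scalars_def)
  show "structure_map T \<in> algebra_homs R S (alg_restrict R S T)"
    using algebrasD[OF assms(2)] by (simp add: algebra_homs_def restrict_scalars_def compose_eq)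
qed

text \<open>Restriction in stages is an equality of records, not just an isomorphism: both composite
  structure maps are extensional on \<open>carrier R\<close> and agree there since \<open>h\<close>
  respects structure maps. Hence \<open>res\<close> needs no transport of values.\<close>

lemma restrict_scalars_mem:
  assumes "S \<in> algebras R" "S' \<in> algebras R" "h \<in> algebra_homs R S S'" "T \<in> algebras S'"
  shows "restrict_scalars S h T \<in> algebras S"
    "alg_restrict R S (restrict_scalars S h T) = alg_restrict R S' T"
proof -
  show "restrict_scalars S h T \<in> algebras S"
    using algebrasD[OF assms(4)] algebrasD[OF assms(1)] algebra_homsD[OF assms(3)]
    by (simp add: algebras_def restrict_scalars_def ring_hom_compose)
  have "compose (carrier R) (compose (carrier S) (structure_map T) h) (structure_map S)
      = compose (carrier R) (structure_map T) (structure_map S')"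
    using algebrasD(4)[OF assms(1)] algebra_homsD(4)[OF assms(3)]
    by (auto simp: compose_def fun_eq_iff restrict_def Pi_def)
  then show "alg_restrict R S (restrict_scalars S h T) = alg_restrict R S' T"
    by (simp add: restrict_scalars_def)
qed

lemma self_alg_mem:
  assumes "S \<in> algebras R"
  shows "self_alg S \<in> algebras S" "alg_restrict R S (self_alg S) = S"
proof -
  show "self_alg S \<in> algebras S"
    using id_mem_algebra_homs[OF assms] algebrasD[OF assms]
    by (simp add: algebras_def self_alg_def algebra_homs_def)
  have "compose (carrier R) (\<lambda>s\<in>carrier S. s) (structure_map S) = structure_map S"
    using algebrasD[OF assms] by (intro Id_compose)
  then show "alg_restrict R S (self_alg S) = S"
    by (simp add: self_alg_def restrict_scalars_def)
qed

lemma restrict_self_alg: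
  "h \<in> algebra_homs R S T \<Longrightarrow> restrict_scalars S h (self_alg T) = T\<lparr>structure_map := h\<rparr>"
  by (simp add: self_alg_def restrict_scalars_def Id_compose algebra_homsD)

lemma restrict_alg_restrict:
  assumes "S \<in> algebras R" "T \<in> algebras S"
  shows "restrict_scalars S (structure_map T) (self_alg (alg_restrict R S T)) = T"
  unfolding restrict_self_alg[OF alg_restrict_mem(2)[OF assms]] by (simp add: restrict_scalars_def)

lemma restrict_scalars_compose:
  assumes "h \<in> algebra_homs R S T" "k \<in> algebra_homs R T U"
  shows "restrict_scalars S h (restrict_scalars T k V) = restrict_scalars S (compose (carrier S) k h) V"
  using compose_assoc[of h "carrier S" "carrier T" "structure_map V" k] algebra_homsD(3)[OF assms(1)]
  by (simp add: restrict_scalars_def)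

text \<open>A morphism of \<open>S\<close>-algebras is a morphism of \<open>R\<close>-algebras that
  forms a commuting triangle under \<open>S\<close>; the next lemma is the converse.\<close>

lemma algebra_homs_alg_restrict:
  assumes "S \<in> algebras R" "T \<in> algebras S" "U \<in> algebras S" "k \<in> algebra_homs S T U"
  shows "k \<in> algebra_homs R (alg_restrict R S T) (alg_restrict R S U)"
    "structure_map U = compose (carrier S) k (structure_map T)"
proof -
  show "k \<in> algebra_homs R (alg_restrict R S T) (alg_restrict R S U)"
    using algebra_homsD[OF assms(4)] algebrasD[OF assms(1)]
    by (auto simp: algebra_homs_def restrict_scalars_def compose_eq)
  show "structure_map U = compose (carrier S) k (structure_map T)"
    using algebra_homsD(4)[OF assms(4)] algebrasD(3)[OF assms(3)]
    by (auto simp: compose_def fun_eq_iff restrict_def extensional_def)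
qed

lemma algebra_homs_base:
  assumes "S \<in> algebras R" "h \<in> algebra_homs R S T" "k \<in> algebra_homs R T U"
  shows "k \<in> algebra_homs S (T\<lparr>structure_map := h\<rparr>) (U\<lparr>structure_map := compose (carrier S) k h\<rparr>)"
  using algebra_homsD[OF assms(3)] by (auto simp: algebra_homs_def compose_eq)

text \<open>This turns a pair (\<open>T\<close>, \<open>h\<close>) into an \<open>S\<close>-algebra
  and is inverse to the passage in \<open>alg_restrict_mem\<close>: overwriting the structure map by
  \<open>h\<close> loses nothing, as \<open>h\<close> determines the structure over
  \<open>R\<close>.\<close>

lemma algebra_base:
  assumes "S \<in> algebras R" "T \<in> algebras R" "h \<in> algebra_homs R S T"
  shows "T\<lparr>structure_map := h\<rparr> \<in> algebras S" "alg_restrict R S (T\<lparr>structure_map := h\<rparr>) = T"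
  using restrict_scalars_mem[OF assms self_alg_mem(1)[OF assms(2)]] self_alg_mem(2)[OF assms(2)]
    restrict_self_alg[OF assms(3)] by simp_all

lemma family_cong:
  assumes "S \<in> algebras R"
    "\<And>T h x. T \<in> algebras R \<Longrightarrow> h \<in> algebra_homs R S T \<Longrightarrow> x \<in> carrier (obj F T) \<Longrightarrow> \<phi> T h x = \<psi> T h x"
  shows "family R F S \<phi> = family R F S \<psi>"
  unfolding family_def using alg_restrict_mem[OF assms(1)] assms(2)
  by (intro restrict_ext) auto

text \<open>From here on \<open>val T (res S T h w)\<close> is the standard form of the component of
  \<open>w\<close> at the pair (\<open>T\<close>, \<open>h\<close>), because \<open>res_res\<close>
  simplifies it under further base change.\<close>

lemma val_res:
  assumes "T \<in> algebras R" "h \<in> algebra_homs R S T"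
  shows "val T (res S T h w) = w (T\<lparr>structure_map := h\<rparr>)"
  using assms self_alg_mem(1)[OF assms(1)] by (simp add: val_def res_def restrict_self_alg)

lemma val_res_structure_map:
  assumes "S \<in> algebras R" "T \<in> algebras S"
  shows "val (alg_restrict R S T) (res S (alg_restrict R S T) (structure_map T) w) = w T"
  using restrict_alg_restrict[OF assms] self_alg_mem(1)[OF alg_restrict_mem(1)[OF assms]]
  by (simp add: val_def res_def)

lemma val_res_family:
  assumes "S \<in> algebras R" "T \<in> algebras R" "h \<in> algebra_homs R S T" "x \<in> carrier (obj F T)"
  shows "val T (res S T h (family R F S \<phi>)) x = \<phi> T h x"
  using assms algebra_base[OF assms(1-3)] by (simp add: val_res family_def)

lemma val_family:
  assumes "S \<in> algebras R" "x \<in> carrier (obj F S)"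
  shows "val S (family R F S \<phi>) x = \<phi> S (\<lambda>s\<in>carrier S. s) x"
  using assms self_alg_mem[OF assms(1)] by (simp add: val_def family_def)

lemma res_family:
  assumes "S \<in> algebras R" "T \<in> algebras R" "h \<in> algebra_homs R S T"
  shows "res S T h (family R F S \<phi>) = family R F T (\<lambda>U k. \<phi> U (compose (carrier S) k h))"
  unfolding res_def family_def using restrict_scalars_mem[OF assms]
  by (intro restrict_ext) simp

lemma res_res:
  assumes "S \<in> algebras R" "T \<in> algebras R" "U \<in> algebras R"
    "h \<in> algebra_homs R S T" "k \<in> algebra_homs R T U"
  shows "res T U k (res S T h w) = res S U (compose (carrier S) k h) w"
  unfolding res_def using restrict_scalars_mem[OF assms(2,3,5)] restrict_scalars_compose[OF assms(4,5)]
  by (intro restrict_ext) simp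

text \<open>\<open>res\<close> cuts its result down to \<open>algebras S\<close>, so the identity
  law is stated for extensional families.\<close>

lemma res_id:
  assumes "S \<in> algebras R" "w \<in> extensional (algebras S)"
  shows "res S S (\<lambda>s\<in>carrier S. s) w = w"
proof -
  have "restrict_scalars S (\<lambda>s\<in>carrier S. s) U = U" if "U \<in> algebras S" for U
    using compose_Id[of "structure_map U" "carrier S"] algebrasD[OF that]
    by (simp add: restrict_scalars_def)
  then show ?thesis using assms(2) by (auto simp: res_def fun_eq_iff restrict_def extensional_def)
qed

section \<open>Elements of a functor of functions\<close>

lemma set_functorD:
  assumes "set_functor R F" "S \<in> algebras R"
  shows "x \<in> carrier (obj F S) \<Longrightarrow> arr F S S (\<lambda>s\<in>carrier S. s) x = x"
    "T \<in> algebras R \<Longrightarrow> h \<in> algebra_homs R S T \<Longrightarrow> x \<in> carrier (obj F S) \<Longrightarrow>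
      arr F S T h x \<in> carrier (obj F T)"
    "T \<in> algebras R \<Longrightarrow> U \<in> algebras R \<Longrightarrow> h \<in> algebra_homs R S T \<Longrightarrow> k \<in> algebra_homs R T U \<Longrightarrow>
      x \<in> carrier (obj F S) \<Longrightarrow> arr F T U k (arr F S T h x) = arr F S U (compose (carrier S) k h) x"
  using assms unfolding set_functor_def by (auto simp: Pi_iff)

lemma function_functor_arr [simp]: "arr (function_functor R F) = res"
  by (simp add: function_functor_def res_def fun_eq_iff)

lemma function_functor_carrier:
  "carrier (obj (function_functor R F) S) =
     nat_trans S (restrict_functor R S F) (restrict_functor R S scalar_functor)"
  by (simp add: function_functor_def pointwise_def)

lemma function_ops:
  "w \<oplus>\<^bsub>obj (function_functor R F) S\<^esub> w' =
    (\<lambda>T\<in>algebras S. \<lambda>x\<in>carrier (obj F (alg_restrict R S T)). w T x \<oplus>\<^bsub>T\<^esub> w' T x)"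
  "s \<odot>\<^bsub>obj (function_functor R F) S\<^esub> w =
    (\<lambda>T\<in>algebras S. \<lambda>x\<in>carrier (obj F (alg_restrict R S T)). structure_map T s \<otimes>\<^bsub>T\<^esub> w T x)"
  "\<zero>\<^bsub>obj (function_functor R F) S\<^esub> = (\<lambda>T\<in>algebras S. \<lambda>x\<in>carrier (obj F (alg_restrict R S T)). \<zero>\<^bsub>T\<^esub>)"
  by (simp_all add: function_functor_def pointwise_def restrict_functor_def scalar_functor_def restrict_scalars_def)

text \<open>In this form operations are compared componentwise by \<open>family_cong\<close>, and
  closure under them reduces to \<open>family_mem_functions\<close>.\<close>

lemma function_ops_family:
  assumes "S \<in> algebras R"
  shows "w \<oplus>\<^bsub>obj (function_functor R F) S\<^esub> w' =
      family R F S (\<lambda>T h x. val T (res S T h w) x \<oplus>\<^bsub>T\<^esub> val T (res S T h w') x)"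
    "s \<odot>\<^bsub>obj (function_functor R F) S\<^esub> w = family R F S (\<lambda>T h x. h s \<otimes>\<^bsub>T\<^esub> val T (res S T h w) x)"
    "\<zero>\<^bsub>obj (function_functor R F) S\<^esub> = family R F S (\<lambda>T h x. \<zero>\<^bsub>T\<^esub>)"
  unfolding function_ops family_def
  by (auto intro!: restrict_ext simp: val_res_structure_map[OF assms]) (simp_all add: restrict_scalars_def)

context
  fixes F :: "('u, 'a, ('a, 'y) partial_object_scheme) alg_functor"
  assumes F: "set_functor R F"
begin

text \<open>The standard constructor of functions. Naturality over \<open>S\<close>-algebras takes
  the displayed form because a morphism \<open>k\<close> of \<open>S\<close>-algebras from
  (\<open>T\<close>, \<open>h\<close>) to \<open>U\<close> has target (\<open>U\<close>,
  \<open>compose (carrier S) k h\<close>).\<close>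

lemma family_mem_functions:
  assumes S: "S \<in> algebras R"
    and cl: "\<And>T h x. T \<in> algebras R \<Longrightarrow> h \<in> algebra_homs R S T \<Longrightarrow> x \<in> carrier (obj F T) \<Longrightarrow>
      \<phi> T h x \<in> carrier T"
    and nat: "\<And>T U h k x. T \<in> algebras R \<Longrightarrow> U \<in> algebras R \<Longrightarrow> h \<in> algebra_homs R S T \<Longrightarrow>
      k \<in> algebra_homs R T U \<Longrightarrow> x \<in> carrier (obj F T) \<Longrightarrow>
      \<phi> U (compose (carrier S) k h) (arr F T U k x) = k (\<phi> T h x)"
  shows "family R F S \<phi> \<in> carrier (obj (function_functor R F) S)"
proof -
  have "arr F (alg_restrict R S T) (alg_restrict R S U) k x \<in> carrier (obj F (alg_restrict R S U))"
    if "T \<in> algebras S" "U \<in> algebras S" "k \<in> algebra_homs S T U" "x \<in> carrier (obj F (alg_restrict R S T))" for T U k x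
    using that S by (intro set_functorD(2)[OF F]) (auto intro: alg_restrict_mem algebra_homs_alg_restrict)
  moreover have "\<phi> (alg_restrict R S U) (structure_map U) (arr F (alg_restrict R S T) (alg_restrict R S U) k x)
      = k (\<phi> (alg_restrict R S T) (structure_map T) x)"
    if "T \<in> algebras S" "U \<in> algebras S" "k \<in> algebra_homs S T U" "x \<in> carrier (obj F (alg_restrict R S T))" for T U k x
    unfolding algebra_homs_alg_restrict(2)[OF S that(1-3)]
    using that S by (intro nat) (auto intro: alg_restrict_mem algebra_homs_alg_restrict)
  moreover have "\<phi> (alg_restrict R S T) (structure_map T) x \<in> carrier T"
    if "T \<in> algebras S" "x \<in> carrier (obj F (alg_restrict R S T))" for T x
    using cl[OF alg_restrict_mem[OF S that(1)] that(2)] by simp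
  ultimately show ?thesis
    by (auto simp: function_functor_carrier nat_trans_def family_def restrict_functor_def scalar_functor_def)
qed

lemma functionsD:
  assumes "w \<in> carrier (obj (function_functor R F) S)"
  shows "w \<in> extensional (algebras S)"
    "T \<in> algebras S \<Longrightarrow> w T \<in> extensional (carrier (obj F (alg_restrict R S T)))"
    "T \<in> algebras S \<Longrightarrow> x \<in> carrier (obj F (alg_restrict R S T)) \<Longrightarrow> w T x \<in> carrier T"
    "T \<in> algebras S \<Longrightarrow> U \<in> algebras S \<Longrightarrow> k \<in> algebra_homs S T U \<Longrightarrow>
      x \<in> carrier (obj F (alg_restrict R S T)) \<Longrightarrow>
      w U (arr F (alg_restrict R S T) (alg_restrict R S U) k x) = k (w T x)"
  using assms by (fastforce simp: function_functor_carrier nat_trans_def restrict_functor_def scalar_functor_def PiE_def Pi_def)+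

lemma functions_closed:
  assumes "S \<in> algebras R" "w \<in> carrier (obj (function_functor R F) S)" "x \<in> carrier (obj F S)"
  shows "val S w x \<in> carrier S"
proof -
  show ?thesis
    using functionsD(3)[OF assms(2) self_alg_mem(1)[OF assms(1)]] assms(3)
    by (simp add: val_def self_alg_mem(2)[OF assms(1)])
qed

lemma functions_natural:
  assumes "S \<in> algebras R" "T \<in> algebras R" "h \<in> algebra_homs R S T"
    "w \<in> carrier (obj (function_functor R F) S)" "x \<in> carrier (obj F S)"
  shows "val T (res S T h w) (arr F S T h x) = h (val S w x)"
proof -
  let ?T = "T\<lparr>structure_map := h\<rparr>"
  \<comment> \<open>\<open>S\<close> over itself is initial among \<open>S\<close>-algebras, so
    \<open>h\<close> itself is the morphism at which naturality of \<open>w\<close> is used.\<close>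
  have "h \<in> algebra_homs S (self_alg S) ?T"
    using algebra_homs_base[OF assms(1) id_mem_algebra_homs[OF assms(1)] assms(3)]
      compose_Id[of h "carrier S"] algebra_homsD[OF assms(3)]
    by (simp add: self_alg_def)
  then have "w ?T (arr F S T h x) = h (w (self_alg S) x)"
    using functionsD(4)[OF assms(4), of "self_alg S" ?T h x] assms(5)
      self_alg_mem[OF assms(1)] algebra_base[OF assms(1-3)] by simp
  then show ?thesis using assms by (simp add: val_res) (simp add: val_def)
qed

lemma functions_eq_family:
  assumes "S \<in> algebras R" "w \<in> carrier (obj (function_functor R F) S)"
  shows "w = family R F S (\<lambda>T h. val T (res S T h w))"
proof (rule extensionalityI[of _ "algebras S"])
  show "w \<in> extensional (algebras S)" by (rule functionsD(1)[OF assms(2)])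
  show "w T = family R F S (\<lambda>T h. val T (res S T h w)) T" if "T \<in> algebras S" for T
    using that functionsD(2)[OF assms(2) that] unfolding family_def
    by (simp add: val_res_structure_map[OF assms(1)] extensional_restrict)
qed (simp add: family_def)

text \<open>An element over \<open>S\<close> is determined by its values over all \<open>T\<close>
  under \<open>S\<close>, not by those over \<open>S\<close> alone. Most later equalities of
  functions and of distributions are proved through this rule.\<close>

lemma functions_ext:
  assumes "S \<in> algebras R" "w \<in> carrier (obj (function_functor R F) S)"
    "w' \<in> carrier (obj (function_functor R F) S)"
    "\<And>T h x. T \<in> algebras R \<Longrightarrow> h \<in> algebra_homs R S T \<Longrightarrow> x \<in> carrier (obj F T) \<Longrightarrow>
      val T (res S T h w) x = val T (res S T h w') x"
  shows "w = w'"
  by (subst functions_eq_family[OF assms(1,2)], subst functions_eq_family[OF assms(1,3)])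
    (rule family_cong[OF assms(1,4)])

lemma res_mem_functions:
  assumes "S \<in> algebras R" "T \<in> algebras R" "h \<in> algebra_homs R S T"
    "w \<in> carrier (obj (function_functor R F) S)"
  shows "res S T h w \<in> carrier (obj (function_functor R F) T)"
proof -
  note S = assms(1)
  \<comment> \<open>Naturality of \<open>w\<close> rewritten for pairs: \<open>l\<close> is viewed
    as a morphism from (\<open>U\<close>, \<open>k\<close>) to (\<open>V\<close>, \<open>l\<close>
    after \<open>k\<close>).\<close>
  have *: "val V (res S V (compose (carrier S) l k) w) (arr F U V l x) = l (val U (res S U k w) x)"
    if "U \<in> algebras R" "V \<in> algebras R" "k \<in> algebra_homs R S U" "l \<in> algebra_homs R U V" "x \<in> carrier (obj F U)"
    for U V k l x
  proof -
    let ?U = "U\<lparr>structure_map := k\<rparr>" and ?V = "V\<lparr>structure_map := compose (carrier S) l k\<rparr>"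
    have c: "compose (carrier S) l k \<in> algebra_homs R S V" by (rule compose_mem_algebra_homs[OF S that(3,4)])
    have "w ?V (arr F U V l x) = l (w ?U x)"
      using functionsD(4)[OF assms(4), of ?U ?V l x] that(5)
        algebra_base[OF S that(1,3)] algebra_base[OF S that(2) c] algebra_homs_base[OF S that(3,4)] by simp
    then show ?thesis using that c by (simp add: val_res)
  qed
  have cl: "val U (res S U k w) x \<in> carrier U"
    if "U \<in> algebras R" "k \<in> algebra_homs R S U" "x \<in> carrier (obj F U)" for U k x
  proof -
    show ?thesis
      using functionsD(3)[OF assms(4), of "U\<lparr>structure_map := k\<rparr>" x] that algebra_base[OF S that(1,2)]
      by (simp add: val_res)
  qed
  have "family R F T (\<lambda>U k. val U (res S U (compose (carrier S) k h) w)) \<in> carrier (obj (function_functor R F) T)"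
  proof (rule family_mem_functions[OF assms(2)])
    fix U k x assume "U \<in> algebras R" "k \<in> algebra_homs R T U" "x \<in> carrier (obj F U)"
    then show "val U (res S U (compose (carrier S) k h) w) x \<in> carrier U"
      using compose_mem_algebra_homs[OF S assms(3)] by (intro cl)
  next
    fix U V k l x assume "U \<in> algebras R" "V \<in> algebras R" "k \<in> algebra_homs R T U" "l \<in> algebra_homs R U V" "x \<in> carrier (obj F U)"
    then show "val V (res S V (compose (carrier S) (compose (carrier T) l k) h) w) (arr F U V l x) =
       l (val U (res S U (compose (carrier S) k h) w) x)"
      using compose_mem_algebra_homs[OF S assms(3)] compose_assoc[of h "carrier S" "carrier T" l k]
        algebra_homsD(3)[OF assms(3)] by (simp flip: *)
  qed
  moreover have "res S T h w = family R F T (\<lambda>U k. val U (res S U (compose (carrier S) k h) w))"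
    by (subst functions_eq_family[OF S assms(4)]) (rule res_family[OF assms(1-3)])
  ultimately show ?thesis by simp
qed

lemma functions_val_res:
  assumes "S \<in> algebras R" "T \<in> algebras R" "h \<in> algebra_homs R S T"
    "w \<in> carrier (obj (function_functor R F) S)" "x \<in> carrier (obj F T)"
  shows "val T (res S T h w) x \<in> carrier T"
  using functions_closed[OF assms(2) res_mem_functions[OF assms(1-4)] assms(5)] .

lemma functions_val_res_natural:
  assumes "S \<in> algebras R" "T \<in> algebras R" "U \<in> algebras R" "h \<in> algebra_homs R S T" "k \<in> algebra_homs R T U"
    "w \<in> carrier (obj (function_functor R F) S)" "x \<in> carrier (obj F T)"
  shows "val U (res S U (compose (carrier S) k h) w) (arr F T U k x) = k (val T (res S T h w) x)"
  using functions_natural[OF assms(2,3,5) res_mem_functions[OF assms(1,2,4,6)] assms(7)]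
  by (simp add: res_res[OF assms(1-5)])

end

end

section \<open>Functions and duals are functors of modules\<close>

lemma algebra_homs_simps:
  assumes "S \<in> algebras R" "T \<in> algebras R" "h \<in> algebra_homs R S T"
  shows "h \<zero>\<^bsub>S\<^esub> = \<zero>\<^bsub>T\<^esub>" "h \<one>\<^bsub>S\<^esub> = \<one>\<^bsub>T\<^esub>"
    "s \<in> carrier S \<Longrightarrow> s' \<in> carrier S \<Longrightarrow> h (s \<oplus>\<^bsub>S\<^esub> s') = h s \<oplus>\<^bsub>T\<^esub> h s'"
    "s \<in> carrier S \<Longrightarrow> s' \<in> carrier S \<Longrightarrow> h (s \<otimes>\<^bsub>S\<^esub> s') = h s \<otimes>\<^bsub>T\<^esub> h s'"
  using ring_hom_zero[of h S T] algebrasD(5)[OF assms(1)] algebrasD(5)[OF assms(2)] algebra_homsD(1)[OF assms(3)]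
  by (auto simp: ring_hom_def)

context base_ring
begin

lemma val_res_ops:
  assumes "S \<in> algebras R" "T \<in> algebras R" "h \<in> algebra_homs R S T" "x \<in> carrier (obj F T)"
  shows "val T (res S T h (w \<oplus>\<^bsub>obj (function_functor R F) S\<^esub> w')) x =
      val T (res S T h w) x \<oplus>\<^bsub>T\<^esub> val T (res S T h w') x"
    "val T (res S T h (s \<odot>\<^bsub>obj (function_functor R F) S\<^esub> w)) x = h s \<otimes>\<^bsub>T\<^esub> val T (res S T h w) x"
    "val T (res S T h (\<zero>\<^bsub>obj (function_functor R F) S\<^esub>)) x = \<zero>\<^bsub>T\<^esub>"
  unfolding function_ops_family[OF assms(1)] val_res_family[OF assms] by simp_all

lemma res_ops:
  assumes "S \<in> algebras R" "T \<in> algebras R" "h \<in> algebra_homs R S T"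
  shows "res S T h (w \<oplus>\<^bsub>obj (function_functor R F) S\<^esub> w') =
      res S T h w \<oplus>\<^bsub>obj (function_functor R F) T\<^esub> res S T h w'"
    "s \<in> carrier S \<Longrightarrow> res S T h (s \<odot>\<^bsub>obj (function_functor R F) S\<^esub> w) =
      h s \<odot>\<^bsub>obj (function_functor R F) T\<^esub> res S T h w"
    "res S T h (\<zero>\<^bsub>obj (function_functor R F) S\<^esub>) = \<zero>\<^bsub>obj (function_functor R F) T\<^esub>"
  unfolding function_ops_family[OF assms(1)] function_ops_family[OF assms(2)] res_family[OF assms]
  by (rule family_cong[OF assms(2)]; simp add: res_res[OF assms(1,2) _ assms(3)] compose_eq)+

lemma val_add:
  assumes "S \<in> algebras R" "x \<in> carrier (obj F S)"
    "w \<in> extensional (algebras S)" "w' \<in> extensional (algebras S)"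
  shows "val S (w \<oplus>\<^bsub>obj (function_functor R F) S\<^esub> w') x = val S w x \<oplus>\<^bsub>S\<^esub> val S w' x"
  unfolding function_ops_family[OF assms(1)] val_family[OF assms(1,2)]
  by (simp add: res_id[OF assms(1,3)] res_id[OF assms(1,4)])

lemma val_smult:
  assumes "S \<in> algebras R" "x \<in> carrier (obj F S)" "w \<in> extensional (algebras S)" "s \<in> carrier S"
  shows "val S (s \<odot>\<^bsub>obj (function_functor R F) S\<^esub> w) x = s \<otimes>\<^bsub>S\<^esub> val S w x"
  unfolding function_ops_family[OF assms(1)] val_family[OF assms(1,2)]
  by (simp add: res_id[OF assms(1,3)] assms(4))

lemmas val_ops = val_add val_smult

context
  fixes F :: "('u, 'a, ('a, 'y) partial_object_scheme) alg_functor"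
  assumes F: "set_functor R F"
begin

lemma function_ops_closed:
  assumes "S \<in> algebras R"
  shows "w \<in> carrier (obj (function_functor R F) S) \<Longrightarrow> w' \<in> carrier (obj (function_functor R F) S) \<Longrightarrow>
      w \<oplus>\<^bsub>obj (function_functor R F) S\<^esub> w' \<in> carrier (obj (function_functor R F) S)"
    "s \<in> carrier S \<Longrightarrow> w \<in> carrier (obj (function_functor R F) S) \<Longrightarrow>
      s \<odot>\<^bsub>obj (function_functor R F) S\<^esub> w \<in> carrier (obj (function_functor R F) S)"
    "\<zero>\<^bsub>obj (function_functor R F) S\<^esub> \<in> carrier (obj (function_functor R F) S)"
proof -
  note simps = algebra_homs_simps functions_val_res_natural[OF F] functions_val_res[OF F]
    algebra_homs_closed compose_mem_algebra_homs[OF assms] compose_eq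
    cring.cring_simprules(1,5)[OF algebrasD(1)] cring.cring_simprules(2)[OF algebrasD(1)] assms
  show "w \<oplus>\<^bsub>obj (function_functor R F) S\<^esub> w' \<in> carrier (obj (function_functor R F) S)"
    if "w \<in> carrier (obj (function_functor R F) S)" "w' \<in> carrier (obj (function_functor R F) S)"
    unfolding function_ops_family[OF assms]
    by (rule family_mem_functions[OF F assms])
      (use that in \<open>simp_all only: simps\<close>)
  show "s \<odot>\<^bsub>obj (function_functor R F) S\<^esub> w \<in> carrier (obj (function_functor R F) S)"
    if "s \<in> carrier S" "w \<in> carrier (obj (function_functor R F) S)"
    unfolding function_ops_family[OF assms]
    by (rule family_mem_functions[OF F assms])
      (use that in \<open>simp_all only: simps\<close>)
  show "\<zero>\<^bsub>obj (function_functor R F) S\<^esub> \<in> carrier (obj (function_functor R F) S)"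
    unfolding function_ops_family[OF assms]
    by (rule family_mem_functions[OF F assms]) (simp_all only: simps)
qed

text \<open>Each axiom is an equality of functions and follows value by value from the ring axioms
  of every \<open>T\<close> under \<open>S\<close>.\<close>

lemma function_module:
  assumes S: "S \<in> algebras R"
  shows "module S (obj (function_functor R F) S)"
proof -
  note cl = function_ops_closed[OF S]
  note ext = functions_ext[OF F S]
  note simps = val_res_ops[OF S] functions_val_res[OF F S] algebra_homs_simps[OF S] algebra_homs_closed
    cring.cring_simprules[OF algebrasD(1)[OF S]]
  \<comment> \<open>The additive inverse of \<open>w\<close> will be its multiple by the negative of
    one in \<open>S\<close>, which is a function by closure under scalars; this is the check on a
    single value \<open>v\<close>.\<close>
  have neg: "h (\<ominus>\<^bsub>S\<^esub> \<one>\<^bsub>S\<^esub>) \<otimes>\<^bsub>T\<^esub> v \<oplus>\<^bsub>T\<^esub> v = \<zero>\<^bsub>T\<^esub>"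
    if T: "T \<in> algebras R" and h: "h \<in> algebra_homs R S T" and v: "v \<in> carrier T" for T h v
  proof -
    interpret S: cring S using S by (rule algebrasD)
    interpret T: cring T using T by (rule algebrasD)
    have "h (\<ominus>\<^bsub>S\<^esub> \<one>\<^bsub>S\<^esub>) \<otimes>\<^bsub>T\<^esub> v \<oplus>\<^bsub>T\<^esub> v = (h (\<ominus>\<^bsub>S\<^esub> \<one>\<^bsub>S\<^esub>) \<oplus>\<^bsub>T\<^esub> h \<one>\<^bsub>S\<^esub>) \<otimes>\<^bsub>T\<^esub> v"
      using v algebra_homs_closed[OF h] algebra_homs_simps(2)[OF S T h] by (simp add: T.l_distr)
    also have "\<dots> = h (\<ominus>\<^bsub>S\<^esub> \<one>\<^bsub>S\<^esub> \<oplus>\<^bsub>S\<^esub> \<one>\<^bsub>S\<^esub>) \<otimes>\<^bsub>T\<^esub> v"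
      using algebra_homs_simps(3)[OF S T h] by simp
    finally show ?thesis using v algebra_homs_simps(1)[OF S T h] by (simp add: S.l_neg)
  qed
  show ?thesis
  proof (rule moduleI[OF algebrasD(1)[OF S]], rule abelian_groupI)
    fix w assume w: "w \<in> carrier (obj (function_functor R F) S)"
    let ?M = "obj (function_functor R F) S"
    have n1: "\<ominus>\<^bsub>S\<^esub> \<one>\<^bsub>S\<^esub> \<in> carrier S" by (simp add: simps)
    have "(\<ominus>\<^bsub>S\<^esub> \<one>\<^bsub>S\<^esub>) \<odot>\<^bsub>?M\<^esub> w \<oplus>\<^bsub>?M\<^esub> w = \<zero>\<^bsub>?M\<^esub>"
      by (rule ext) (use w n1 in \<open>auto simp: cl neg simps\<close>)
    then show "\<exists>y\<in>carrier ?M. y \<oplus>\<^bsub>?M\<^esub> w = \<zero>\<^bsub>?M\<^esub>" using cl(2)[OF n1 w] by blast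
  qed ((rule cl; assumption) | rule ext, (simp only: cl simps; fail)+,
      frule algebrasD(1), simp add: simps cl cring.cring_simprules)+
qed

lemma set_functor_functions: "set_functor R (function_functor R F)"
  unfolding set_functor_def
proof (intro conjI ballI Pi_I)
  fix S T f x assume "S \<in> algebras R" "T \<in> algebras R" "f \<in> algebra_homs R S T"
    "x \<in> carrier (obj (function_functor R F) S)"
  then show "arr (function_functor R F) S T f x \<in> carrier (obj (function_functor R F) T)"
    using res_mem_functions[OF F] by simp
next
  fix S x assume "S \<in> algebras R" "x \<in> carrier (obj (function_functor R F) S)"
  then show "arr (function_functor R F) S S (\<lambda>s\<in>carrier S. s) x = x"
    by (simp add: res_id functionsD(1)[OF F])
qed (simp add: res_res)

lemma module_functor_functions: "module_functor R (function_functor R F)"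
  unfolding module_functor_def
  by (auto simp: set_functor_functions function_module res_ops)

end

section \<open>Duals as functors of linear functions\<close>

lemma dual_arr [simp]: "arr (dual R M) = res"
  by (simp add: dual_def hom_functor_def res_def fun_eq_iff)

text \<open>Only the carrier shrinks, from all functions to the linear ones, so the calculations for
  \<open>function_functor\<close> carry over to duals.\<close>

lemma dual_obj:
  "obj (dual R M) S = (obj (function_functor R M) S)
     \<lparr>carrier := module_morphisms S (restrict_functor R S M) (restrict_functor R S scalar_functor)\<rparr>"
  by (simp add: dual_def hom_functor_def function_functor_def pointwise_def)

text \<open>These rules rewrite towards \<open>function_functor\<close>, which is why sums and
  multiples in a dual, and later those of distributions, are written with its operations.\<close>

lemma dual_ops [simp]:
  "w \<oplus>\<^bsub>obj (dual R M) S\<^esub> w' = w \<oplus>\<^bsub>obj (function_functor R M) S\<^esub> w'"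
  "s \<odot>\<^bsub>obj (dual R M) S\<^esub> w = s \<odot>\<^bsub>obj (function_functor R M) S\<^esub> w"
  "\<zero>\<^bsub>obj (dual R M) S\<^esub> = \<zero>\<^bsub>obj (function_functor R M) S\<^esub>"
  by (simp_all add: dual_obj)

context
  fixes M :: "('u, 'm, ('u, 'm) module) alg_functor"
  assumes M: "module_functor R M"
begin

lemma module_set_functor: "set_functor R M"
  using M by (simp add: module_functor_def)

lemma module_closed:
  assumes "S \<in> algebras R"
  shows "x \<in> carrier (obj M S) \<Longrightarrow> y \<in> carrier (obj M S) \<Longrightarrow> x \<oplus>\<^bsub>obj M S\<^esub> y \<in> carrier (obj M S)"
    "s \<in> carrier S \<Longrightarrow> x \<in> carrier (obj M S) \<Longrightarrow> s \<odot>\<^bsub>obj M S\<^esub> x \<in> carrier (obj M S)"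
proof -
  interpret module S "obj M S" using M assms by (simp add: module_functor_def)
  show "x \<in> carrier (obj M S) \<Longrightarrow> y \<in> carrier (obj M S) \<Longrightarrow> x \<oplus>\<^bsub>obj M S\<^esub> y \<in> carrier (obj M S)"
    "s \<in> carrier S \<Longrightarrow> x \<in> carrier (obj M S) \<Longrightarrow> s \<odot>\<^bsub>obj M S\<^esub> x \<in> carrier (obj M S)"
    by simp_all
qed

text \<open>Linearity at every \<open>S\<close>-algebra is restated for pairs (\<open>T\<close>,
  \<open>h\<close>) through the correspondence of the two, so that it can be combined with
  \<open>res\<close>.\<close>

lemma dual_mem_iff:
  assumes S: "S \<in> algebras R"
  shows "w \<in> carrier (obj (dual R M) S) \<longleftrightarrow> w \<in> carrier (obj (function_functor R M) S) \<and>
    (\<forall>T\<in>algebras R. \<forall>h\<in>algebra_homs R S T.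
       (\<forall>x\<in>carrier (obj M T). \<forall>y\<in>carrier (obj M T).
          val T (res S T h w) (x \<oplus>\<^bsub>obj M T\<^esub> y) = val T (res S T h w) x \<oplus>\<^bsub>T\<^esub> val T (res S T h w) y) \<and>
       (\<forall>s\<in>carrier T. \<forall>x\<in>carrier (obj M T).
          val T (res S T h w) (s \<odot>\<^bsub>obj M T\<^esub> x) = s \<otimes>\<^bsub>T\<^esub> val T (res S T h w) x))"
    (is "_ \<longleftrightarrow> _ \<and> ?lin w")
proof -
  have "?lin w \<longleftrightarrow> (\<forall>T\<in>algebras S.
        (\<forall>x\<in>carrier (obj M (alg_restrict R S T)). \<forall>y\<in>carrier (obj M (alg_restrict R S T)).
           w T (x \<oplus>\<^bsub>obj M (alg_restrict R S T)\<^esub> y) = w T x \<oplus>\<^bsub>T\<^esub> w T y) \<and>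
        (\<forall>s\<in>carrier T. \<forall>x\<in>carrier (obj M (alg_restrict R S T)).
           w T (s \<odot>\<^bsub>obj M (alg_restrict R S T)\<^esub> x) = s \<otimes>\<^bsub>T\<^esub> w T x))" (is "_ = (\<forall>T\<in>_. ?P T)")
  proof (intro iffI ballI)
    fix T assume "?lin w" and T: "T \<in> algebras S"
    from bspec[OF bspec[OF this(1) alg_restrict_mem(1)[OF S T]] alg_restrict_mem(2)[OF S T]]
    show "?P T"
      unfolding val_res_structure_map[OF S T] alg_update_simps by (simp add: restrict_scalars_def)
  next
    fix T h assume *: "\<forall>T\<in>algebras S. ?P T" and T: "T \<in> algebras R" and h: "h \<in> algebra_homs R S T"
    from bspec[OF * algebra_base(1)[OF S T h]]
    show "(\<forall>x\<in>carrier (obj M T). \<forall>y\<in>carrier (obj M T).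
          val T (res S T h w) (x \<oplus>\<^bsub>obj M T\<^esub> y) = val T (res S T h w) x \<oplus>\<^bsub>T\<^esub> val T (res S T h w) y) \<and>
       (\<forall>s\<in>carrier T. \<forall>x\<in>carrier (obj M T).
          val T (res S T h w) (s \<odot>\<^bsub>obj M T\<^esub> x) = s \<otimes>\<^bsub>T\<^esub> val T (res S T h w) x)"
      unfolding algebra_base(2)[OF S T h] val_res[OF T h] by simp
  qed
  moreover have "add (obj scalar_functor (alg_restrict R S T)) = add T"
    "smult (obj scalar_functor (alg_restrict R S T)) = monoid.mult T" for T
    by (simp_all add: scalar_functor_def restrict_scalars_def)
  ultimately show ?thesis
    unfolding function_functor_carrier
    by (simp add: dual_obj module_morphisms_def restrict_functor_def)
qed

lemma dual_memD:
  assumes S: "S \<in> algebras R" and w: "w \<in> carrier (obj (dual R M) S)"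
  shows "w \<in> carrier (obj (function_functor R M) S)"
    "T \<in> algebras R \<Longrightarrow> h \<in> algebra_homs R S T \<Longrightarrow> x \<in> carrier (obj M T) \<Longrightarrow> y \<in> carrier (obj M T) \<Longrightarrow>
      val T (res S T h w) (x \<oplus>\<^bsub>obj M T\<^esub> y) = val T (res S T h w) x \<oplus>\<^bsub>T\<^esub> val T (res S T h w) y"
    "T \<in> algebras R \<Longrightarrow> h \<in> algebra_homs R S T \<Longrightarrow> s \<in> carrier T \<Longrightarrow> x \<in> carrier (obj M T) \<Longrightarrow>
      val T (res S T h w) (s \<odot>\<^bsub>obj M T\<^esub> x) = s \<otimes>\<^bsub>T\<^esub> val T (res S T h w) x"
  using w unfolding dual_mem_iff[OF S] by blast+

lemma val_dual_linear:
  assumes S: "S \<in> algebras R" and w: "w \<in> carrier (obj (dual R M) S)"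
  shows "x \<in> carrier (obj M S) \<Longrightarrow> y \<in> carrier (obj M S) \<Longrightarrow>
      val S w (x \<oplus>\<^bsub>obj M S\<^esub> y) = val S w x \<oplus>\<^bsub>S\<^esub> val S w y"
    "s \<in> carrier S \<Longrightarrow> x \<in> carrier (obj M S) \<Longrightarrow>
      val S w (s \<odot>\<^bsub>obj M S\<^esub> x) = s \<otimes>\<^bsub>S\<^esub> val S w x"
  using dual_memD(2,3)[OF S w S id_mem_algebra_homs[OF S]]
    res_id[OF S functionsD(1)[OF module_set_functor dual_memD(1)[OF S w]]]
  by simp_all

text \<open>The standard constructor of linear functions. It supplies products of distributions,
  point evaluations, the functionals on distributions behind uniqueness and the linear forms on
  \<open>N\<close> behind existence.\<close>

lemma family_mem_dual:
  assumes S: "S \<in> algebras R"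
    and "\<And>T h x. T \<in> algebras R \<Longrightarrow> h \<in> algebra_homs R S T \<Longrightarrow> x \<in> carrier (obj M T) \<Longrightarrow>
      \<phi> T h x \<in> carrier T"
    and "\<And>T U h k x. T \<in> algebras R \<Longrightarrow> U \<in> algebras R \<Longrightarrow> h \<in> algebra_homs R S T \<Longrightarrow>
      k \<in> algebra_homs R T U \<Longrightarrow> x \<in> carrier (obj M T) \<Longrightarrow>
      \<phi> U (compose (carrier S) k h) (arr M T U k x) = k (\<phi> T h x)"
    and "\<And>T h x y. T \<in> algebras R \<Longrightarrow> h \<in> algebra_homs R S T \<Longrightarrow> x \<in> carrier (obj M T) \<Longrightarrow>
      y \<in> carrier (obj M T) \<Longrightarrow> \<phi> T h (x \<oplus>\<^bsub>obj M T\<^esub> y) = \<phi> T h x \<oplus>\<^bsub>T\<^esub> \<phi> T h y"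
    and "\<And>T h s x. T \<in> algebras R \<Longrightarrow> h \<in> algebra_homs R S T \<Longrightarrow> s \<in> carrier T \<Longrightarrow>
      x \<in> carrier (obj M T) \<Longrightarrow> \<phi> T h (s \<odot>\<^bsub>obj M T\<^esub> x) = s \<otimes>\<^bsub>T\<^esub> \<phi> T h x"
  shows "family R M S \<phi> \<in> carrier (obj (dual R M) S)"
proof -
  show ?thesis
    unfolding dual_mem_iff[OF S]
  proof (intro conjI ballI)
    show "family R M S \<phi> \<in> carrier (obj (function_functor R M) S)"
      by (rule family_mem_functions[OF module_set_functor assms(1-3)])
    fix T h assume T: "T \<in> algebras R" and h: "h \<in> algebra_homs R S T"
    note fam = val_res_family[OF S T h]
    show "val T (res S T h (family R M S \<phi>)) (x \<oplus>\<^bsub>obj M T\<^esub> y) =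
        val T (res S T h (family R M S \<phi>)) x \<oplus>\<^bsub>T\<^esub> val T (res S T h (family R M S \<phi>)) y"
      if "x \<in> carrier (obj M T)" "y \<in> carrier (obj M T)" for x y
      using assms(4)[OF T h that] that by (simp only: fam module_closed[OF T])
    show "val T (res S T h (family R M S \<phi>)) (s \<odot>\<^bsub>obj M T\<^esub> x) =
        s \<otimes>\<^bsub>T\<^esub> val T (res S T h (family R M S \<phi>)) x"
      if "s \<in> carrier T" "x \<in> carrier (obj M T)" for s x
      using assms(5)[OF T h that] that by (simp only: fam module_closed[OF T])
  qed
qed

lemma res_mem_dual:
  assumes "S \<in> algebras R" "T \<in> algebras R" "h \<in> algebra_homs R S T" "w \<in> carrier (obj (dual R M) S)"
  shows "res S T h w \<in> carrier (obj (dual R M) T)"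
  using dual_memD[OF assms(1,4)] res_mem_functions[OF module_set_functor assms(1-3)]
    compose_mem_algebra_homs[OF assms(1,3)]
  unfolding dual_mem_iff[OF assms(2)] by (simp add: res_res[OF assms(1,2) _ assms(3)])

text \<open>The linear functions form a submodule of the module of all functions, so what has to be
  checked is closure.\<close>

lemma dual_module:
  assumes S: "S \<in> algebras R"
  shows "module S (obj (dual R M) S)"
proof -
  interpret A: module S "obj (function_functor R M) S"
    using function_module[OF module_set_functor S] .
  let ?A = "obj (function_functor R M) S"
  let ?D = "carrier (obj (dual R M) S)"
  note val = functions_val_res[OF module_set_functor S]
  have zero: "\<zero>\<^bsub>?A\<^esub> \<in> ?D"
    unfolding dual_mem_iff[OF S]
  proof (intro conjI ballI)
    fix T h assume T: "T \<in> algebras R" and h: "h \<in> algebra_homs R S T"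
    interpret T: cring T using T by (rule algebrasD)
    show "val T (res S T h \<zero>\<^bsub>?A\<^esub>) (x \<oplus>\<^bsub>obj M T\<^esub> y) =
        val T (res S T h \<zero>\<^bsub>?A\<^esub>) x \<oplus>\<^bsub>T\<^esub> val T (res S T h \<zero>\<^bsub>?A\<^esub>) y"
      if "x \<in> carrier (obj M T)" "y \<in> carrier (obj M T)" for x y
      using that by (simp add: val_res_ops[OF S T h] module_closed[OF T])
    show "val T (res S T h \<zero>\<^bsub>?A\<^esub>) (s \<odot>\<^bsub>obj M T\<^esub> x) = s \<otimes>\<^bsub>T\<^esub> val T (res S T h \<zero>\<^bsub>?A\<^esub>) x"
      if "s \<in> carrier T" "x \<in> carrier (obj M T)" for s x
      using that by (simp add: val_res_ops[OF S T h] module_closed[OF T])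
  qed (rule A.zero_closed)
  have add: "w \<oplus>\<^bsub>?A\<^esub> w' \<in> ?D" if w: "w \<in> ?D" "w' \<in> ?D" for w w'
    unfolding dual_mem_iff[OF S]
  proof (intro conjI ballI)
    fix T h assume T: "T \<in> algebras R" and h: "h \<in> algebra_homs R S T"
    interpret T: cring T using T by (rule algebrasD)
    note w' = val[OF T h dual_memD(1)[OF S w(1)]] val[OF T h dual_memD(1)[OF S w(2)]]
    show "val T (res S T h (w \<oplus>\<^bsub>?A\<^esub> w')) (x \<oplus>\<^bsub>obj M T\<^esub> y) =
        val T (res S T h (w \<oplus>\<^bsub>?A\<^esub> w')) x \<oplus>\<^bsub>T\<^esub> val T (res S T h (w \<oplus>\<^bsub>?A\<^esub> w')) y"
      if "x \<in> carrier (obj M T)" "y \<in> carrier (obj M T)" for x y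
      using that w' by (simp add: val_res_ops[OF S T h] module_closed[OF T] T.a_ac
        dual_memD(2)[OF S w(1) T h] dual_memD(2)[OF S w(2) T h])
    show "val T (res S T h (w \<oplus>\<^bsub>?A\<^esub> w')) (s \<odot>\<^bsub>obj M T\<^esub> x) = s \<otimes>\<^bsub>T\<^esub> val T (res S T h (w \<oplus>\<^bsub>?A\<^esub> w')) x"
      if "s \<in> carrier T" "x \<in> carrier (obj M T)" for s x
      using that w' by (simp add: val_res_ops[OF S T h] module_closed[OF T] T.r_distr
        dual_memD(3)[OF S w(1) T h] dual_memD(3)[OF S w(2) T h])
  qed (use dual_memD(1)[OF S w(1)] dual_memD(1)[OF S w(2)] in \<open>rule A.a_closed\<close>)
  \<comment> \<open>Here commutativity of \<open>T\<close> enters, through \<open>T.m_lcomm\<close>: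
    a multiple of a linear function is again homogeneous because scalars commute.\<close>
  have smult: "r \<odot>\<^bsub>?A\<^esub> w \<in> ?D" if r: "r \<in> carrier S" and w: "w \<in> ?D" for r w
    unfolding dual_mem_iff[OF S]
  proof (intro conjI ballI)
    fix T h assume T: "T \<in> algebras R" and h: "h \<in> algebra_homs R S T"
    interpret T: cring T using T by (rule algebrasD)
    note w' = val[OF T h dual_memD(1)[OF S w]] algebra_homs_closed[OF h r]
    show "val T (res S T h (r \<odot>\<^bsub>?A\<^esub> w)) (x \<oplus>\<^bsub>obj M T\<^esub> y) =
        val T (res S T h (r \<odot>\<^bsub>?A\<^esub> w)) x \<oplus>\<^bsub>T\<^esub> val T (res S T h (r \<odot>\<^bsub>?A\<^esub> w)) y"
      if "x \<in> carrier (obj M T)" "y \<in> carrier (obj M T)" for x y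
      using that w' by (simp add: val_res_ops[OF S T h] module_closed[OF T] T.r_distr
        dual_memD(2)[OF S w T h])
    show "val T (res S T h (r \<odot>\<^bsub>?A\<^esub> w)) (s \<odot>\<^bsub>obj M T\<^esub> x) = s \<otimes>\<^bsub>T\<^esub> val T (res S T h (r \<odot>\<^bsub>?A\<^esub> w)) x"
      if "s \<in> carrier T" "x \<in> carrier (obj M T)" for s x
      using that w' by (simp add: val_res_ops[OF S T h] module_closed[OF T] T.m_lcomm
        dual_memD(3)[OF S w T h])
  qed (use r dual_memD(1)[OF S w] in \<open>rule A.smult_closed\<close>)
  have "submodule ?D S ?A"
  proof (rule A.submoduleI)
    show "\<ominus>\<^bsub>?A\<^esub> w \<in> ?D" if "w \<in> ?D" for w
      using smult[OF _ that, of "\<ominus>\<^bsub>S\<^esub> \<one>\<^bsub>S\<^esub>"] dual_memD(1)[OF S that] by (simp add: A.smult_l_minus)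
  qed (use dual_memD(1)[OF S] zero add smult in auto)
  from submodule.submodule_is_module[OF this function_module[OF module_set_functor S]]
  show ?thesis by (simp add: dual_obj)
qed

text \<open>Thanks to this a bidual is again the dual of a functor of modules, and the lemmas above
  apply to it.\<close>

lemma module_functor_dual: "module_functor R (dual R M)"
proof -
  have "set_functor R (dual R M)"
    unfolding set_functor_def
  proof (intro conjI ballI Pi_I)
    fix S T f x assume "S \<in> algebras R" "T \<in> algebras R" "f \<in> algebra_homs R S T"
      "x \<in> carrier (obj (dual R M) S)"
    then show "arr (dual R M) S T f x \<in> carrier (obj (dual R M) T)"
      using res_mem_dual by simp
  next
    fix S x assume "S \<in> algebras R" "x \<in> carrier (obj (dual R M) S)"
    then show "arr (dual R M) S S (\<lambda>s\<in>carrier S. s) x = x"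
      by (simp add: res_id functionsD(1)[OF module_set_functor] dual_memD(1))
  qed (simp add: res_res)
  then show ?thesis
    unfolding module_functor_def by (auto simp: dual_module res_ops)
qed

end
end

section \<open>The algebra of distributions\<close>

locale monoid_functor_base = base_ring R
  for R :: "('u, 'z) ring_scheme" +
  fixes G :: "('u, 'g, 'g monoid) alg_functor"
  assumes G: "monoid_functor R G"
begin

abbreviation A where "A \<equiv> function_functor R G"
abbreviation D where "D \<equiv> dual R A"

lemma G_set: "set_functor R G"
  using G by (simp add: monoid_functor_def)

lemmas A_module = module_functor_functions[OF G_set]
lemmas A_set = set_functor_functions[OF G_set]

lemma G_simps:
  assumes S: "S \<in> algebras R"
  shows "g \<in> carrier (obj G S) \<Longrightarrow> g' \<in> carrier (obj G S) \<Longrightarrow> g \<otimes>\<^bsub>obj G S\<^esub> g' \<in> carrier (obj G S)"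
    "\<one>\<^bsub>obj G S\<^esub> \<in> carrier (obj G S)"
    "g \<in> carrier (obj G S) \<Longrightarrow> \<one>\<^bsub>obj G S\<^esub> \<otimes>\<^bsub>obj G S\<^esub> g = g"
    "g \<in> carrier (obj G S) \<Longrightarrow> g \<otimes>\<^bsub>obj G S\<^esub> \<one>\<^bsub>obj G S\<^esub> = g"
    "g \<in> carrier (obj G S) \<Longrightarrow> g' \<in> carrier (obj G S) \<Longrightarrow> g'' \<in> carrier (obj G S) \<Longrightarrow>
      (g \<otimes>\<^bsub>obj G S\<^esub> g') \<otimes>\<^bsub>obj G S\<^esub> g'' = g \<otimes>\<^bsub>obj G S\<^esub> (g' \<otimes>\<^bsub>obj G S\<^esub> g'')"
    "T \<in> algebras R \<Longrightarrow> h \<in> algebra_homs R S T \<Longrightarrow> g \<in> carrier (obj G S) \<Longrightarrow> arr G S T h g \<in> carrier (obj G T)"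
    "T \<in> algebras R \<Longrightarrow> h \<in> algebra_homs R S T \<Longrightarrow> g \<in> carrier (obj G S) \<Longrightarrow> g' \<in> carrier (obj G S) \<Longrightarrow>
      arr G S T h (g \<otimes>\<^bsub>obj G S\<^esub> g') = arr G S T h g \<otimes>\<^bsub>obj G T\<^esub> arr G S T h g'"
    "T \<in> algebras R \<Longrightarrow> h \<in> algebra_homs R S T \<Longrightarrow> arr G S T h \<one>\<^bsub>obj G S\<^esub> = \<one>\<^bsub>obj G T\<^esub>"
proof -
  interpret monoid "obj G S" using G S by (simp add: monoid_functor_def)
  show "g \<in> carrier (obj G S) \<Longrightarrow> g' \<in> carrier (obj G S) \<Longrightarrow> g \<otimes>\<^bsub>obj G S\<^esub> g' \<in> carrier (obj G S)"
    "\<one>\<^bsub>obj G S\<^esub> \<in> carrier (obj G S)"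
    "g \<in> carrier (obj G S) \<Longrightarrow> \<one>\<^bsub>obj G S\<^esub> \<otimes>\<^bsub>obj G S\<^esub> g = g"
    "g \<in> carrier (obj G S) \<Longrightarrow> g \<otimes>\<^bsub>obj G S\<^esub> \<one>\<^bsub>obj G S\<^esub> = g"
    "g \<in> carrier (obj G S) \<Longrightarrow> g' \<in> carrier (obj G S) \<Longrightarrow> g'' \<in> carrier (obj G S) \<Longrightarrow>
      (g \<otimes>\<^bsub>obj G S\<^esub> g') \<otimes>\<^bsub>obj G S\<^esub> g'' = g \<otimes>\<^bsub>obj G S\<^esub> (g' \<otimes>\<^bsub>obj G S\<^esub> g'')"
    by (simp_all add: m_assoc)
  show "T \<in> algebras R \<Longrightarrow> h \<in> algebra_homs R S T \<Longrightarrow> g \<in> carrier (obj G S) \<Longrightarrow> arr G S T h g \<in> carrier (obj G T)"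
    by (rule set_functorD(2)[OF G_set S])
  show "T \<in> algebras R \<Longrightarrow> h \<in> algebra_homs R S T \<Longrightarrow> g \<in> carrier (obj G S) \<Longrightarrow> g' \<in> carrier (obj G S) \<Longrightarrow>
      arr G S T h (g \<otimes>\<^bsub>obj G S\<^esub> g') = arr G S T h g \<otimes>\<^bsub>obj G T\<^esub> arr G S T h g'"
    "T \<in> algebras R \<Longrightarrow> h \<in> algebra_homs R S T \<Longrightarrow> arr G S T h \<one>\<^bsub>obj G S\<^esub> = \<one>\<^bsub>obj G T\<^esub>"
    using G S by (auto simp: monoid_functor_def hom_def)
qed

section \<open>Translation by points and the action of distributions on functions\<close>

lemma translate_family:
  assumes S: "S \<in> algebras R"
  shows "translate R G S f g =
    family R G S (\<lambda>T h x. val T (res S T h f) (arr G S T h g \<otimes>\<^bsub>obj G T\<^esub> x))"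
  unfolding translate_def family_def
  by (intro restrict_ext) (simp add: val_res_structure_map[OF S])

lemma partial_apply_family:
  assumes S: "S \<in> algebras R"
  shows "partial_apply R G S w f =
    family R G S (\<lambda>T h g. val T (res S T h w) (translate R G T (res S T h f) g))"
  unfolding partial_apply_def family_def
  by (intro restrict_ext) (simp add: val_res_structure_map[OF S])

lemma val_translate:
  assumes S: "S \<in> algebras R" and f: "f \<in> carrier (obj A S)" and g: "g \<in> carrier (obj G S)" and x: "x \<in> carrier (obj G S)"
  shows "val S (translate R G S f g) x = val S f (g \<otimes>\<^bsub>obj G S\<^esub> x)"
  unfolding translate_family[OF S] val_family[OF S x]
  by (simp add: res_id[OF S functionsD(1)[OF G_set f]] set_functorD(1)[OF G_set S g])

text \<open>Naturality of the translate rests on the transition maps of \<open>G\<close> being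
  multiplicative.\<close>

lemma translate_mem:
  assumes S: "S \<in> algebras R" and f: "f \<in> carrier (obj A S)" and g: "g \<in> carrier (obj G S)"
  shows "translate R G S f g \<in> carrier (obj A S)"
  unfolding translate_family[OF S]
proof (rule family_mem_functions[OF G_set S])
  fix T h x assume T: "T \<in> algebras R" and h: "h \<in> algebra_homs R S T" and x: "x \<in> carrier (obj G T)"
  show "val T (res S T h f) (arr G S T h g \<otimes>\<^bsub>obj G T\<^esub> x) \<in> carrier T"
    by (rule functions_val_res[OF G_set S T h f]) (rule G_simps[OF T] G_simps[OF S] T h g x)+
next
  fix T U h k x assume T: "T \<in> algebras R" and U: "U \<in> algebras R"
    and h: "h \<in> algebra_homs R S T" and k: "k \<in> algebra_homs R T U" and x: "x \<in> carrier (obj G T)"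
  have gT: "arr G S T h g \<in> carrier (obj G T)" by (rule G_simps(6)[OF S T h g])
  have "arr G S U (compose (carrier S) k h) g \<otimes>\<^bsub>obj G U\<^esub> arr G T U k x = arr G T U k (arr G S T h g \<otimes>\<^bsub>obj G T\<^esub> x)"
    by (simp add: G_simps(7)[OF T U k gT x] set_functorD(3)[OF G_set S T U h k g])
  then show "val U (res S U (compose (carrier S) k h) f)
        (arr G S U (compose (carrier S) k h) g \<otimes>\<^bsub>obj G U\<^esub> arr G T U k x)
      = k (val T (res S T h f) (arr G S T h g \<otimes>\<^bsub>obj G T\<^esub> x))"
    using functions_val_res_natural[OF G_set S T U h k f G_simps(1)[OF T gT x]] by simp
qed

lemma res_translate:
  assumes S: "S \<in> algebras R" and T: "T \<in> algebras R" and h: "h \<in> algebra_homs R S T"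
    and g: "g \<in> carrier (obj G S)"
  shows "res S T h (translate R G S f g) = translate R G T (res S T h f) (arr G S T h g)"
  unfolding translate_family[OF S] translate_family[OF T] res_family[OF S T h]
  by (rule family_cong[OF T]) (simp add: res_res[OF S T _ h] set_functorD(3)[OF G_set S T _ h _ g])

lemmas A_ops_closed = function_ops_closed[OF G_set]
lemmas res_A = res_mem_functions[OF G_set]
lemmas A_ext = functions_ext[OF G_set]
lemmas A_extensional = functionsD(1)[OF G_set]

text \<open>The last item is associativity of \<open>G(S)\<close>: it makes translation a right
  action of \<open>G(S)\<close> on functions.\<close>

lemma translate_ops:
  assumes S: "S \<in> algebras R" and g: "g \<in> carrier (obj G S)" and f: "f \<in> carrier (obj A S)"
  shows "f' \<in> carrier (obj A S) \<Longrightarrow>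
      translate R G S (f \<oplus>\<^bsub>obj A S\<^esub> f') g = translate R G S f g \<oplus>\<^bsub>obj A S\<^esub> translate R G S f' g"
    "s \<in> carrier S \<Longrightarrow> translate R G S (s \<odot>\<^bsub>obj A S\<^esub> f) g = s \<odot>\<^bsub>obj A S\<^esub> translate R G S f g"
    "g' \<in> carrier (obj G S) \<Longrightarrow>
      translate R G S (translate R G S f g) g' = translate R G S f (g \<otimes>\<^bsub>obj G S\<^esub> g')"
  by (rule A_ext[OF S];
      simp add: S f g A_ops_closed translate_mem G_simps res_translate[OF S] res_ops[OF S]
        val_translate res_A[OF S] val_ops A_extensional algebra_homs_closed)+

lemma translate_one:
  assumes S: "S \<in> algebras R" and f: "f \<in> carrier (obj A S)"
  shows "translate R G S f \<one>\<^bsub>obj G S\<^esub> = f"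
  by (rule A_ext[OF S]; simp add: S f translate_mem G_simps res_translate[OF S] val_translate res_A[OF S])

text \<open>The translates that enter at (\<open>T\<close>, \<open>h\<close>) are carried along
  \<open>k\<close> to those at \<open>U\<close> by \<open>res_translate\<close>; naturality of
  \<open>w\<close> does the rest.\<close>

lemma partial_apply_mem:
  assumes S: "S \<in> algebras R" and w: "w \<in> carrier (obj D S)" and f: "f \<in> carrier (obj A S)"
  shows "partial_apply R G S w f \<in> carrier (obj A S)"
  unfolding partial_apply_family[OF S]
proof (rule family_mem_functions[OF G_set S])
  note w' = dual_memD(1)[OF A_module S w]
  fix T h x assume T: "T \<in> algebras R" and h: "h \<in> algebra_homs R S T" and x: "x \<in> carrier (obj G T)"
  show "val T (res S T h w) (translate R G T (res S T h f) x) \<in> carrier T"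
    by (rule functions_val_res[OF A_set S T h w' translate_mem[OF T res_A[OF S T h f] x]])
next
  note w' = dual_memD(1)[OF A_module S w]
  fix T U h k x assume T: "T \<in> algebras R" and U: "U \<in> algebras R"
    and h: "h \<in> algebra_homs R S T" and k: "k \<in> algebra_homs R T U" and x: "x \<in> carrier (obj G T)"
  show "val U (res S U (compose (carrier S) k h) w)
        (translate R G U (res S U (compose (carrier S) k h) f) (arr G T U k x))
      = k (val T (res S T h w) (translate R G T (res S T h f) x))"
    using functions_val_res_natural[OF A_set S T U h k w' translate_mem[OF T res_A[OF S T h f] x]]
    by (simp add: res_translate[OF T U k x] res_res[OF S T U h k])
qed

lemma res_partial_apply:
  assumes S: "S \<in> algebras R" and T: "T \<in> algebras R" and h: "h \<in> algebra_homs R S T"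
  shows "res S T h (partial_apply R G S w f) = partial_apply R G T (res S T h w) (res S T h f)"
  unfolding partial_apply_family[OF S] partial_apply_family[OF T] res_family[OF S T h]
  by (rule family_cong[OF T]) (simp add: res_res[OF S T _ h])

lemma val_partial_apply:
  assumes S: "S \<in> algebras R" and w: "w \<in> carrier (obj D S)" and f: "f \<in> carrier (obj A S)"
    and g: "g \<in> carrier (obj G S)"
  shows "val S (partial_apply R G S w f) g = val S w (translate R G S f g)"
  unfolding partial_apply_family[OF S] val_family[OF S g]
  by (simp add: res_id[OF S functionsD(1)[OF G_set f]]
    res_id[OF S functionsD(1)[OF A_set dual_memD(1)[OF A_module S w]]])

lemmas res_D = res_mem_dual[OF A_module]

lemma D_extensional: "S \<in> algebras R \<Longrightarrow> w \<in> carrier (obj D S) \<Longrightarrow> w \<in> extensional (algebras S)"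
  by (rule functionsD(1)[OF A_set dual_memD(1)[OF A_module]])

lemma D_ext:
  assumes S: "S \<in> algebras R" and w: "w \<in> carrier (obj D S)" "w' \<in> carrier (obj D S)"
    and "\<And>T h f. T \<in> algebras R \<Longrightarrow> h \<in> algebra_homs R S T \<Longrightarrow> f \<in> carrier (obj A T) \<Longrightarrow>
      val T (res S T h w) f = val T (res S T h w') f"
  shows "w = w'"
  by (rule functions_ext[OF A_set S dual_memD(1)[OF A_module S w(1)] dual_memD(1)[OF A_module S w(2)] assms(4)])

lemma D_closed:
  assumes S: "S \<in> algebras R"
  shows "w \<in> carrier (obj D S) \<Longrightarrow> w' \<in> carrier (obj D S) \<Longrightarrow>
      w \<oplus>\<^bsub>obj (function_functor R A) S\<^esub> w' \<in> carrier (obj D S)"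
    "s \<in> carrier S \<Longrightarrow> w \<in> carrier (obj D S) \<Longrightarrow> s \<odot>\<^bsub>obj (function_functor R A) S\<^esub> w \<in> carrier (obj D S)"
  using module_closed[OF module_functor_dual[OF A_module] S] by simp_all

lemma val_D_closed:
  assumes S: "S \<in> algebras R" and w: "w \<in> carrier (obj D S)" and f: "f \<in> carrier (obj A S)"
  shows "val S w f \<in> carrier S"
  using functions_closed[OF A_set S dual_memD(1)[OF A_module S w] f] .

text \<open>The last item matters most: \<open>w\<close> acts on functions by an operator commuting
  with translations, because both sides send x to w (h \<mapsto> f(g x h)). This is what makes the
  product of distributions associative.\<close>

lemma partial_apply_ops:
  assumes S: "S \<in> algebras R" and w: "w \<in> carrier (obj D S)" and f: "f \<in> carrier (obj A S)"
  shows "f' \<in> carrier (obj A S) \<Longrightarrow>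
      partial_apply R G S w (f \<oplus>\<^bsub>obj A S\<^esub> f') = partial_apply R G S w f \<oplus>\<^bsub>obj A S\<^esub> partial_apply R G S w f'"
    "s \<in> carrier S \<Longrightarrow> partial_apply R G S w (s \<odot>\<^bsub>obj A S\<^esub> f) = s \<odot>\<^bsub>obj A S\<^esub> partial_apply R G S w f"
    "w' \<in> carrier (obj D S) \<Longrightarrow>
      partial_apply R G S (w \<oplus>\<^bsub>obj (function_functor R A) S\<^esub> w') f = partial_apply R G S w f \<oplus>\<^bsub>obj A S\<^esub> partial_apply R G S w' f"
    "s \<in> carrier S \<Longrightarrow>
      partial_apply R G S (s \<odot>\<^bsub>obj (function_functor R A) S\<^esub> w) f = s \<odot>\<^bsub>obj A S\<^esub> partial_apply R G S w f"
    "g \<in> carrier (obj G S) \<Longrightarrow>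
      partial_apply R G S w (translate R G S f g) = translate R G S (partial_apply R G S w f) g"
  by (rule A_ext[OF S];
      simp add: S f w A_ops_closed translate_mem partial_apply_mem G_simps res_translate[OF S] res_ops[OF S] D_closed
        val_translate res_A[OF S] res_D[OF S] val_ops A_extensional D_extensional algebra_homs_closed
        res_partial_apply[OF S] val_partial_apply translate_ops val_dual_linear[OF A_module])+

section \<open>The product of distributions\<close>

lemma distribution_simps [simp]:
  "arr (distribution_functor R G) = res"
  "carrier (obj (distribution_functor R G) S) = carrier (obj D S)"
  "w \<oplus>\<^bsub>obj (distribution_functor R G) S\<^esub> w' = w \<oplus>\<^bsub>obj (function_functor R A) S\<^esub> w'"
  "s \<odot>\<^bsub>obj (distribution_functor R G) S\<^esub> w = s \<odot>\<^bsub>obj (function_functor R A) S\<^esub> w"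
  "\<zero>\<^bsub>obj (distribution_functor R G) S\<^esub> = \<zero>\<^bsub>obj (function_functor R A) S\<^esub>"
  "\<one>\<^bsub>obj (distribution_functor R G) S\<^esub> = to_distributions R G S \<one>\<^bsub>obj G S\<^esub>"
  by (simp_all add: distribution_functor_def Let_def to_distributions_def flip: dual_ops)

lemma distribution_mult:
  assumes S: "S \<in> algebras R"
  shows "w \<otimes>\<^bsub>obj (distribution_functor R G) S\<^esub> w' =
    family R A S (\<lambda>T h f. val T (res S T h w) (partial_apply R G T (res S T h w') f))"
  unfolding distribution_functor_def Let_def family_def
  by simp (intro restrict_ext, simp add: val_res_structure_map[OF S])

abbreviation dmult where "dmult S w w' \<equiv> w \<otimes>\<^bsub>obj (distribution_functor R G) S\<^esub> w'"

lemma mult_mem: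
  assumes S: "S \<in> algebras R" and w: "w \<in> carrier (obj D S)" "w' \<in> carrier (obj D S)"
  shows "dmult S w w' \<in> carrier (obj D S)"
  unfolding distribution_mult[OF S]
  by (rule family_mem_dual[OF A_module S])
   (simp_all add: S w val_D_closed partial_apply_mem partial_apply_ops res_D[OF S] val_dual_linear[OF A_module]
      functions_natural[OF A_set, symmetric] dual_memD(1)[OF A_module] res_partial_apply res_res)

lemma res_mult:
  assumes S: "S \<in> algebras R" and T: "T \<in> algebras R" and h: "h \<in> algebra_homs R S T"
  shows "res S T h (dmult S w w') = dmult T (res S T h w) (res S T h w')"
  unfolding distribution_mult[OF S] distribution_mult[OF T] res_family[OF S T h]
  by (rule family_cong[OF T]) (simp add: res_res[OF S T _ h])

lemma val_mult:
  assumes S: "S \<in> algebras R" and w: "w \<in> carrier (obj D S)" "w' \<in> carrier (obj D S)" and f: "f \<in> carrier (obj A S)"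
  shows "val S (dmult S w w') f = val S w (partial_apply R G S w' f)"
  unfolding distribution_mult[OF S] val_family[OF S f]
  by (simp add: res_id[OF S D_extensional[OF S w(1)]] res_id[OF S D_extensional[OF S w(2)]])

text \<open>The action of distributions on functions turns the product into composition of
  operators: at a point, moving the translation past the operator of \<open>w'\<close> by
  \<open>partial_apply_ops(5)\<close> gives both sides the same value.\<close>

lemma partial_apply_mult:
  assumes S: "S \<in> algebras R" and w: "w \<in> carrier (obj D S)" "w' \<in> carrier (obj D S)" and f: "f \<in> carrier (obj A S)"
  shows "partial_apply R G S (dmult S w w') f = partial_apply R G S w (partial_apply R G S w' f)"
  by (rule A_ext[OF S])
    (simp_all add: S f w mult_mem translate_mem partial_apply_mem
        res_A[OF S] res_D[OF S] res_partial_apply[OF S] val_partial_apply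
        res_mult[OF S] val_mult partial_apply_ops(5))

section \<open>Point evaluations\<close>

lemma to_distributions_family:
  assumes S: "S \<in> algebras R" and g: "g \<in> carrier (obj G S)"
  shows "to_distributions R G S g = family R A S (\<lambda>T h f. val T f (arr G S T h g))"
  using S g by (simp add: to_distributions_def evaluation_def family_def val_def)

lemma to_distributions_mem:
  assumes S: "S \<in> algebras R" and g: "g \<in> carrier (obj G S)"
  shows "to_distributions R G S g \<in> carrier (obj D S)"
  unfolding to_distributions_family[OF S g]
  by (rule family_mem_dual[OF A_module S])
   (simp_all add: S g G_simps functions_closed[OF G_set] val_ops A_extensional functions_natural[OF G_set, symmetric]
     set_functorD(3)[OF G_set])

lemma res_to_distributions:
  assumes S: "S \<in> algebras R" and T: "T \<in> algebras R" and h: "h \<in> algebra_homs R S T" and g: "g \<in> carrier (obj G S)"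
  shows "res S T h (to_distributions R G S g) = to_distributions R G T (arr G S T h g)"
  unfolding to_distributions_family[OF S g] to_distributions_family[OF T G_simps(6)[OF S T h g]] res_family[OF S T h]
  by (rule family_cong[OF T]) (simp add: set_functorD(3)[OF G_set S T _ h _ g])

lemma val_to_distributions:
  assumes S: "S \<in> algebras R" and g: "g \<in> carrier (obj G S)" and f: "f \<in> carrier (obj A S)"
  shows "val S (to_distributions R G S g) f = val S f g"
  unfolding to_distributions_family[OF S g] val_family[OF S f]
  by (simp add: set_functorD(1)[OF G_set S g])

text \<open>Evaluation at the unit acts as the identity operator since f(g 1) = f(g). This becomes
  the right unit law, while \<open>translate_one\<close> becomes the left one.\<close>

lemma partial_apply_to_distributions:
  assumes S: "S \<in> algebras R" and f: "f \<in> carrier (obj A S)"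
  shows "partial_apply R G S (to_distributions R G S \<one>\<^bsub>obj G S\<^esub>) f = f"
  by (rule A_ext[OF S])
    (simp_all add: S f to_distributions_mem partial_apply_mem G_simps res_partial_apply[OF S]
      res_to_distributions[OF S] val_partial_apply res_A[OF S] val_to_distributions translate_mem val_translate)

text \<open>On \<open>f\<close> the product evaluates x \<mapsto> f(x g') at \<open>g\<close>, which
  gives f(g g').\<close>

lemma to_distributions_mult:
  assumes S: "S \<in> algebras R" and g: "g \<in> carrier (obj G S)" "g' \<in> carrier (obj G S)"
  shows "to_distributions R G S (g \<otimes>\<^bsub>obj G S\<^esub> g') = dmult S (to_distributions R G S g) (to_distributions R G S g')"
  by (rule D_ext[OF S])
    (simp_all add: S g to_distributions_mem mult_mem G_simps res_to_distributions[OF S] res_mult[OF S]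
      val_mult val_to_distributions partial_apply_mem val_partial_apply translate_mem val_translate)

section \<open>Distributions form a functor of algebras\<close>

lemma D_module: "S \<in> algebras R \<Longrightarrow> module S (obj D S)"
  by (rule dual_module[OF A_module])

text \<open>The record differs from that of \<open>D\<close> in product and unit, which the module
  axioms do not read, so the axioms are transferred one at a time.\<close>

lemma distribution_module:
  assumes S: "S \<in> algebras R"
  shows "module S (obj (distribution_functor R G) S)"
proof -
  interpret D: module S "obj D S" by (rule D_module[OF S])
  have "\<exists>y\<in>carrier (obj D S). y \<oplus>\<^bsub>obj D S\<^esub> x = \<zero>\<^bsub>obj D S\<^esub>" if "x \<in> carrier (obj D S)" for x
    using that D.l_neg D.a_inv_closed by blast
  then show ?thesis
    using D.a_closed D.zero_closed D.a_assoc D.a_comm D.l_zero D.smult_closed D.smult_l_distr D.smult_r_distr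
      D.smult_assoc1 D.smult_one
    by (intro moduleI abelian_groupI) (simp_all add: algebrasD[OF S])
qed

text \<open>A product is \<open>w\<close> applied to the result of the operator of
  \<open>w'\<close>. Hence associativity is \<open>partial_apply_mult\<close>, and distributivity in
  the right factor combines additivity of that operator in \<open>w'\<close> with linearity of
  \<open>w\<close>.\<close>

lemma distribution_ring:
  assumes S: "S \<in> algebras R"
  shows "ring (obj (distribution_functor R G) S)"
proof -
  interpret D: module S "obj (distribution_functor R G) S" by (rule distribution_module[OF S])
  show ?thesis
  proof (rule ringI)
    show "monoid (obj (distribution_functor R G) S)"
    proof (rule monoidI)
      show "\<one>\<^bsub>obj (distribution_functor R G) S\<^esub> \<in> carrier (obj (distribution_functor R G) S)"
        by (simp add: to_distributions_mem[OF S] G_simps[OF S])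
    qed ((simp add: mult_mem[OF S])?; rule D_ext[OF S];
      simp add: S mult_mem res_mult[OF S] val_mult res_D[OF S] partial_apply_mem partial_apply_mult
        to_distributions_mem G_simps res_to_distributions[OF S] val_to_distributions val_partial_apply
        translate_one partial_apply_to_distributions)+
  qed (rule D.abelian_group_axioms, (simp, rule D_ext[OF S];
      simp add: S mult_mem res_mult[OF S] val_mult res_D[OF S] partial_apply_mem partial_apply_mult
        D_closed res_ops[OF S] val_ops D_extensional partial_apply_ops val_dual_linear[OF A_module])+)
qed

text \<open>Besides being part of the claim, this allows the universal property of the monoid
  algebra to be applied with distributions as target, which yields the algebra morphism from
  \<open>RG\<close>.\<close>

lemma distribution_algebra_functor: "algebra_functor R (distribution_functor R G)"
proof -
  have "set_functor R (distribution_functor R G)"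
    using module_functor_dual[OF A_module] by (simp add: module_functor_def set_functor_def)
  moreover have "dmult S (s \<odot>\<^bsub>obj (function_functor R A) S\<^esub> w) w' = s \<odot>\<^bsub>obj (function_functor R A) S\<^esub> dmult S w w' \<and>
      dmult S w (s \<odot>\<^bsub>obj (function_functor R A) S\<^esub> w') = s \<odot>\<^bsub>obj (function_functor R A) S\<^esub> dmult S w w'"
    if S: "S \<in> algebras R" and s: "s \<in> carrier S" and w: "w \<in> carrier (obj D S)" "w' \<in> carrier (obj D S)" for S s w w'
    by (intro conjI; rule D_ext[OF S];
      simp add: S s w mult_mem res_mult[OF S] val_mult res_D[OF S] partial_apply_mem
        D_closed res_ops[OF S] val_ops D_extensional partial_apply_ops val_dual_linear[OF A_module] algebra_homs_closed)
  moreover have "res S T f \<in> ring_hom (obj (distribution_functor R G) S) (obj (distribution_functor R G) T)"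
    if S: "S \<in> algebras R" and T: "T \<in> algebras R" and f: "f \<in> algebra_homs R S T" for S T f
    by (rule ring_hom_memI)
      (simp_all add: res_D[OF S T f] res_mult[OF S T f] res_ops[OF S T f] res_to_distributions[OF S T f] G_simps S T f)
  ultimately show ?thesis
    unfolding algebra_functor_def module_functor_def
    by (auto simp: distribution_module distribution_ring res_ops)
qed

end

section \<open>The universal property of the monoid algebra\<close>

text \<open>A sum is regrouped along the fibres of \<open>f\<close>. The product and the transition
  maps of the monoid algebra both push coefficients forward along a map, so this one identity
  handles both.\<close>

lemma (in module) finsum_pushforward:
  assumes "finite X" "finite Y" "f ` X \<subseteq> Y" "c \<in> X \<rightarrow> carrier R" "\<phi> \<in> Y \<rightarrow> carrier M"
  shows "(\<Oplus>\<^bsub>M\<^esub>y\<in>Y. (\<Oplus>\<^bsub>R\<^esub>x\<in>{x\<in>X. f x = y}. c x) \<odot>\<^bsub>M\<^esub> \<phi> y) = (\<Oplus>\<^bsub>M\<^esub>x\<in>X. c x \<odot>\<^bsub>M\<^esub> \<phi> (f x))"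
  using assms
proof (induction X rule: finite_induct)
  case empty
  then show ?case by (simp add: M.add.finprod_one_eqI Pi_iff)
next
  case (insert x X)
  \<comment> \<open>The fibre sums before \<open>x\<close> is added; \<open>x\<close> then
    contributes to the fibre over \<open>f x\<close> alone.\<close>
  let ?s = "\<lambda>y. \<Oplus>\<^bsub>R\<^esub>z\<in>{z\<in>X. f z = y}. c z"
  have cl: "?s y \<in> carrier R" for y using insert.prems by (intro R.finsum_closed) auto
  have "(\<Oplus>\<^bsub>R\<^esub>z\<in>{z\<in>insert x X. f z = y}. c z) \<odot>\<^bsub>M\<^esub> \<phi> y =
      (if f x = y then c x \<odot>\<^bsub>M\<^esub> \<phi> y else \<zero>\<^bsub>M\<^esub>) \<oplus>\<^bsub>M\<^esub> ?s y \<odot>\<^bsub>M\<^esub> \<phi> y" if "y \<in> Y" for y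
  proof (cases "f x = y")
    case True
    then have "{z\<in>insert x X. f z = y} = insert x {z\<in>X. f z = y}" by auto
    moreover have "(\<Oplus>\<^bsub>R\<^esub>z\<in>insert x {z\<in>X. f z = y}. c z) = c x \<oplus>\<^bsub>R\<^esub> ?s y"
      using insert.hyps insert.prems by (intro R.finsum_insert) auto
    ultimately show ?thesis using True insert.prems that cl by (auto simp: smult_l_distr Pi_iff)
  next
    case False
    then have "{z\<in>insert x X. f z = y} = {z\<in>X. f z = y}" by auto
    then show ?thesis using False insert.prems that cl by (auto simp: Pi_iff)
  qed
  then have "(\<Oplus>\<^bsub>M\<^esub>y\<in>Y. (\<Oplus>\<^bsub>R\<^esub>z\<in>{z\<in>insert x X. f z = y}. c z) \<odot>\<^bsub>M\<^esub> \<phi> y) =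
      (\<Oplus>\<^bsub>M\<^esub>y\<in>Y. (if f x = y then c x \<odot>\<^bsub>M\<^esub> \<phi> y else \<zero>\<^bsub>M\<^esub>) \<oplus>\<^bsub>M\<^esub> ?s y \<odot>\<^bsub>M\<^esub> \<phi> y)"
    using insert.prems cl by (intro M.finsum_cong') (auto simp: Pi_iff)
  also have "\<dots> = (\<Oplus>\<^bsub>M\<^esub>y\<in>Y. if f x = y then c x \<odot>\<^bsub>M\<^esub> \<phi> y else \<zero>\<^bsub>M\<^esub>) \<oplus>\<^bsub>M\<^esub> (\<Oplus>\<^bsub>M\<^esub>y\<in>Y. ?s y \<odot>\<^bsub>M\<^esub> \<phi> y)"
    using insert.prems cl by (intro M.finsum_addf) (auto simp: Pi_iff)
  also have "(\<Oplus>\<^bsub>M\<^esub>y\<in>Y. if f x = y then c x \<odot>\<^bsub>M\<^esub> \<phi> y else \<zero>\<^bsub>M\<^esub>) = c x \<odot>\<^bsub>M\<^esub> \<phi> (f x)"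
    using insert.prems by (intro M.finsum_singleton) (auto simp: Pi_iff)
  also have "(\<Oplus>\<^bsub>M\<^esub>y\<in>Y. ?s y \<odot>\<^bsub>M\<^esub> \<phi> y) = (\<Oplus>\<^bsub>M\<^esub>z\<in>X. c z \<odot>\<^bsub>M\<^esub> \<phi> (f z))"
    using insert.prems by (intro insert.IH) auto
  also have "c x \<odot>\<^bsub>M\<^esub> \<phi> (f x) \<oplus>\<^bsub>M\<^esub> (\<Oplus>\<^bsub>M\<^esub>z\<in>X. c z \<odot>\<^bsub>M\<^esub> \<phi> (f z)) = (\<Oplus>\<^bsub>M\<^esub>z\<in>insert x X. c z \<odot>\<^bsub>M\<^esub> \<phi> (f z))"
    using insert.hyps insert.prems by (intro M.finsum_insert[symmetric]) (auto simp: Pi_iff)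
  finally show ?case .
qed

lemma (in module) finsum_support:
  assumes "finite Y" "{g. a g \<noteq> \<zero>} \<subseteq> Y" "a \<in> Y \<rightarrow> carrier R" "\<phi> \<in> Y \<rightarrow> carrier M"
  shows "(\<Oplus>\<^bsub>M\<^esub>g\<in>{g. a g \<noteq> \<zero>}. a g \<odot>\<^bsub>M\<^esub> \<phi> g) = (\<Oplus>\<^bsub>M\<^esub>g\<in>Y. a g \<odot>\<^bsub>M\<^esub> \<phi> g)"
  using assms by (intro M.add.finprod_mono_neutral_cong_left) (auto simp: Pi_iff)

text \<open>Induction on \<open>X\<close>: each step splits off the row over one \<open>x\<close>,
  which is reindexed along \<open>Pair x\<close>.\<close>

lemma (in ring) finsum_times_finsum:
  assumes "finite X" "finite Y" "u \<in> X \<rightarrow> carrier R" "v \<in> Y \<rightarrow> carrier R"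
  shows "(\<Oplus>x\<in>X. u x) \<otimes> (\<Oplus>y\<in>Y. v y) = (\<Oplus>p\<in>X \<times> Y. u (fst p) \<otimes> v (snd p))"
  using assms(1,3)
proof (induction X rule: finite_induct)
  case empty
  then show ?case using assms by simp
next
  case (insert x X)
  have "(\<Oplus>z\<in>insert x X. u z) \<otimes> (\<Oplus>y\<in>Y. v y) = u x \<otimes> (\<Oplus>y\<in>Y. v y) \<oplus> (\<Oplus>z\<in>X. u z) \<otimes> (\<Oplus>y\<in>Y. v y)"
    using insert assms by (subst finsum_insert) (auto simp: l_distr Pi_iff)
  also have "u x \<otimes> (\<Oplus>y\<in>Y. v y) = (\<Oplus>y\<in>Y. u x \<otimes> v y)"
    using insert.prems assms by (intro finsum_rdistr) auto
  also have "\<dots> = (\<Oplus>p\<in>Pair x ` Y. u (fst p) \<otimes> v (snd p))"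
    using insert.prems assms by (subst add.finprod_reindex) (auto simp: inj_on_def Pi_iff)
  also have "\<dots> \<oplus> (\<Oplus>z\<in>X. u z) \<otimes> (\<Oplus>y\<in>Y. v y) =
      (\<Oplus>p\<in>Pair x ` Y. u (fst p) \<otimes> v (snd p)) \<oplus> (\<Oplus>p\<in>X \<times> Y. u (fst p) \<otimes> v (snd p))"
    using insert by auto
  also have "\<dots> = (\<Oplus>p\<in>Pair x ` Y \<union> X \<times> Y. u (fst p) \<otimes> v (snd p))"
    using insert assms by (intro finsum_Un_disjoint[symmetric]) (auto simp: Pi_iff)
  also have "Pair x ` Y \<union> X \<times> Y = insert x X \<times> Y" by auto
  finally show ?case .
qed

text \<open>Infinite \<open>X\<close> are covered too: both sums are then zero by convention, and
  \<open>h\<close> preserves zero.\<close>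

lemma ring_hom_finsum:
  assumes "h \<in> ring_hom A B" "ring A" "ring B" "u \<in> X \<rightarrow> carrier A"
  shows "h (\<Oplus>\<^bsub>A\<^esub>x\<in>X. u x) = (\<Oplus>\<^bsub>B\<^esub>x\<in>X. h (u x))"
proof -
  interpret A: ring A by fact
  interpret B: ring B by fact
  note zero = ring_hom_zero[OF assms(1-3)]
  show ?thesis using assms(4)
  proof (induction X rule: infinite_finite_induct)
    case (insert x X)
    then show ?case
      using assms(1) by (auto simp: Pi_iff ring_hom_add ring_hom_closed)
  qed (simp_all add: zero)
qed

lemma pushforward_mem_monoid_algebra:
  assumes "cring S" "finite X" "f \<in> X \<rightarrow> carrier H" "c \<in> X \<rightarrow> carrier S"
  shows "(\<lambda>y. \<Oplus>\<^bsub>S\<^esub>x\<in>{x\<in>X. f x = y}. c x) \<in> carrier (monoid_algebra S H)"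
    "{y. (\<Oplus>\<^bsub>S\<^esub>x\<in>{x\<in>X. f x = y}. c x) \<noteq> \<zero>\<^bsub>S\<^esub>} \<subseteq> f ` X"
proof -
  interpret cring S by fact
  have z: "(\<Oplus>\<^bsub>S\<^esub>x\<in>{x\<in>X. f x = y}. c x) = \<zero>\<^bsub>S\<^esub>" if "y \<notin> f ` X" for y
  proof -
    have "{x\<in>X. f x = y} = {}" using that by auto
    then show ?thesis by (simp only: finsum_empty)
  qed
  then show *: "{y. (\<Oplus>\<^bsub>S\<^esub>x\<in>{x\<in>X. f x = y}. c x) \<noteq> \<zero>\<^bsub>S\<^esub>} \<subseteq> f ` X" by blast
  show "(\<lambda>y. \<Oplus>\<^bsub>S\<^esub>x\<in>{x\<in>X. f x = y}. c x) \<in> carrier (monoid_algebra S H)"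
    unfolding monoid_algebra_def using z assms(3,4) finite_subset[OF * finite_imageI[OF assms(2)]]
    by (auto intro!: finsum_closed z)
qed

text \<open>The product is the pushforward along multiplication of points from the product of the
  two supports; in this shape \<open>finsum_pushforward\<close> applies to it.\<close>

lemma monoid_algebra_mult_pushforward:
  "a \<otimes>\<^bsub>monoid_algebra S H\<^esub> b = (\<lambda>g. \<Oplus>\<^bsub>S\<^esub>p\<in>{p \<in> {h. a h \<noteq> \<zero>\<^bsub>S\<^esub>} \<times> {k. b k \<noteq> \<zero>\<^bsub>S\<^esub>}. fst p \<otimes>\<^bsub>H\<^esub> snd p = g}.
     a (fst p) \<otimes>\<^bsub>S\<^esub> b (snd p))"
proof -
  have "{(h, k). a h \<noteq> \<zero>\<^bsub>S\<^esub> \<and> b k \<noteq> \<zero>\<^bsub>S\<^esub> \<and> h \<otimes>\<^bsub>H\<^esub> k = g} =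
      {p \<in> {h. a h \<noteq> \<zero>\<^bsub>S\<^esub>} \<times> {k. b k \<noteq> \<zero>\<^bsub>S\<^esub>}. fst p \<otimes>\<^bsub>H\<^esub> snd p = g}" for g
    by auto
  then show ?thesis by (simp add: monoid_algebra_def)
qed

lemma monoid_algebraD:
  assumes "a \<in> carrier (monoid_algebra S H)"
  shows "finite {g. a g \<noteq> \<zero>\<^bsub>S\<^esub>}" "{g. a g \<noteq> \<zero>\<^bsub>S\<^esub>} \<subseteq> carrier H" "g \<in> carrier H \<Longrightarrow> a g \<in> carrier S"
    "g \<notin> carrier H \<Longrightarrow> a g = \<zero>\<^bsub>S\<^esub>"
  using assms by (auto simp: monoid_algebra_def)

lemma monoid_algebra_support:
  assumes "a \<in> carrier (monoid_algebra S H)" "a g \<noteq> \<zero>\<^bsub>S\<^esub>"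
  shows "g \<in> carrier H" "a g \<in> carrier S"
  using assms by (auto simp: monoid_algebra_def)

context base_ring
begin

context
  fixes B :: "('u, 'b, ('u, 'b) module) alg_functor"
  assumes B: "algebra_functor R B"
begin

lemma algebra_functor_module: "module_functor R B"
  using B by (simp add: algebra_functor_def)

lemma algebra_functorD:
  assumes "S \<in> algebras R"
  shows "module S (obj B S)" "ring (obj B S)"
    "s \<in> carrier S \<Longrightarrow> x \<in> carrier (obj B S) \<Longrightarrow> y \<in> carrier (obj B S) \<Longrightarrow>
      (s \<odot>\<^bsub>obj B S\<^esub> x) \<otimes>\<^bsub>obj B S\<^esub> y = s \<odot>\<^bsub>obj B S\<^esub> (x \<otimes>\<^bsub>obj B S\<^esub> y)"
    "s \<in> carrier S \<Longrightarrow> x \<in> carrier (obj B S) \<Longrightarrow> y \<in> carrier (obj B S) \<Longrightarrow>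
      x \<otimes>\<^bsub>obj B S\<^esub> (s \<odot>\<^bsub>obj B S\<^esub> y) = s \<odot>\<^bsub>obj B S\<^esub> (x \<otimes>\<^bsub>obj B S\<^esub> y)"
    "T \<in> algebras R \<Longrightarrow> h \<in> algebra_homs R S T \<Longrightarrow> arr B S T h \<in> ring_hom (obj B S) (obj B T)"
    "T \<in> algebras R \<Longrightarrow> h \<in> algebra_homs R S T \<Longrightarrow> s \<in> carrier S \<Longrightarrow> x \<in> carrier (obj B S) \<Longrightarrow>
      arr B S T h (s \<odot>\<^bsub>obj B S\<^esub> x) = h s \<odot>\<^bsub>obj B T\<^esub> arr B S T h x"
  using B assms by (simp_all add: algebra_functor_def module_functor_def)

end

end

section \<open>The monoid algebra and its canonical basis\<close>

context monoid_functor_base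
begin

abbreviation RG where "RG \<equiv> monoid_algebra_functor G"
abbreviation \<delta> where "\<delta> \<equiv> to_monoid_algebra R G"

lemma monoid_algebra_functor_simps [simp]: "obj RG S = monoid_algebra S (obj G S)"
  by (simp add: monoid_algebra_functor_def)

lemma monoid_algebra_ops [simp]:
  "a \<oplus>\<^bsub>monoid_algebra S H\<^esub> b = (\<lambda>g. a g \<oplus>\<^bsub>S\<^esub> b g)"
  "s \<odot>\<^bsub>monoid_algebra S H\<^esub> a = (\<lambda>g. s \<otimes>\<^bsub>S\<^esub> a g)"
  "\<one>\<^bsub>monoid_algebra S H\<^esub> = (\<lambda>g. if g = \<one>\<^bsub>H\<^esub> then \<one>\<^bsub>S\<^esub> else \<zero>\<^bsub>S\<^esub>)"
  by (simp_all add: monoid_algebra_def)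

lemma arr_monoid_algebra:
  "arr RG S T f a = (\<lambda>g'. \<Oplus>\<^bsub>T\<^esub>g\<in>{g \<in> {g. a g \<noteq> \<zero>\<^bsub>S\<^esub>}. arr G S T f g = g'}. f (a g))"
  by (simp add: monoid_algebra_functor_def)

lemma monoid_algebra_closed:
  assumes S: "S \<in> algebras R" and a: "a \<in> carrier (monoid_algebra S (obj G S))"
  shows "b \<in> carrier (monoid_algebra S (obj G S)) \<Longrightarrow> (\<lambda>g. a g \<oplus>\<^bsub>S\<^esub> b g) \<in> carrier (monoid_algebra S (obj G S))"
    "s \<in> carrier S \<Longrightarrow> (\<lambda>g. s \<otimes>\<^bsub>S\<^esub> a g) \<in> carrier (monoid_algebra S (obj G S))"
    "b \<in> carrier (monoid_algebra S (obj G S)) \<Longrightarrow>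
      a \<otimes>\<^bsub>monoid_algebra S (obj G S)\<^esub> b \<in> carrier (monoid_algebra S (obj G S))"
    "T \<in> algebras R \<Longrightarrow> h \<in> algebra_homs R S T \<Longrightarrow> arr RG S T h a \<in> carrier (monoid_algebra T (obj G T))"
proof -
  interpret cring S by (rule algebrasD[OF S])
  note a' = monoid_algebraD[OF a]
  show "(\<lambda>g. a g \<oplus>\<^bsub>S\<^esub> b g) \<in> carrier (monoid_algebra S (obj G S))"
    if "b \<in> carrier (monoid_algebra S (obj G S))"
  proof -
    note b' = monoid_algebraD[OF that]
    have "{g. a g \<oplus>\<^bsub>S\<^esub> b g \<noteq> \<zero>\<^bsub>S\<^esub>} \<subseteq> {g. a g \<noteq> \<zero>\<^bsub>S\<^esub>} \<union> {g. b g \<noteq> \<zero>\<^bsub>S\<^esub>}" by auto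
    then have "finite {g. a g \<oplus>\<^bsub>S\<^esub> b g \<noteq> \<zero>\<^bsub>S\<^esub>}"
      using a'(1) b'(1) by (meson finite_UnI finite_subset)
    then show ?thesis using a' b' by (simp add: monoid_algebra_def)
  qed
  show "(\<lambda>g. s \<otimes>\<^bsub>S\<^esub> a g) \<in> carrier (monoid_algebra S (obj G S))" if "s \<in> carrier S"
  proof -
    have "{g. s \<otimes>\<^bsub>S\<^esub> a g \<noteq> \<zero>\<^bsub>S\<^esub>} \<subseteq> {g. a g \<noteq> \<zero>\<^bsub>S\<^esub>}" using that by auto
    then have "finite {g. s \<otimes>\<^bsub>S\<^esub> a g \<noteq> \<zero>\<^bsub>S\<^esub>}" using a'(1) by (rule finite_subset)
    then show ?thesis using a' that by (simp add: monoid_algebra_def)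
  qed
  show "a \<otimes>\<^bsub>monoid_algebra S (obj G S)\<^esub> b \<in> carrier (monoid_algebra S (obj G S))"
    if "b \<in> carrier (monoid_algebra S (obj G S))"
    unfolding monoid_algebra_mult_pushforward
    by (rule pushforward_mem_monoid_algebra(1)[OF is_cring])
      (use a'(1) monoid_algebraD(1)[OF that] monoid_algebra_support[OF a] monoid_algebra_support[OF that] in \<open>auto intro!: G_simps(1)[OF S]\<close>)
  show "arr RG S T h a \<in> carrier (monoid_algebra T (obj G T))"
    if "T \<in> algebras R" "h \<in> algebra_homs R S T"
    unfolding arr_monoid_algebra
    by (rule pushforward_mem_monoid_algebra(1)[OF algebrasD(1)[OF that(1)] a'(1)])
      (use a' G_simps(6)[OF S that] algebra_homs_closed[OF that(2)] in auto)
qed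

lemma delta_eq:
  assumes "S \<in> algebras R" "g \<in> carrier (obj G S)"
  shows "\<delta> S g = (\<lambda>h. if h = g then \<one>\<^bsub>S\<^esub> else \<zero>\<^bsub>S\<^esub>)"
  using assms by (simp add: to_monoid_algebra_def)

lemma delta_mem:
  assumes S: "S \<in> algebras R" and g: "g \<in> carrier (obj G S)"
  shows "\<delta> S g \<in> carrier (monoid_algebra S (obj G S))"
proof -
  interpret cring S by (rule algebrasD[OF S])
  have "{h. (if h = g then \<one>\<^bsub>S\<^esub> else \<zero>\<^bsub>S\<^esub>) \<noteq> \<zero>\<^bsub>S\<^esub>} \<subseteq> {g}" by auto
  then have "finite {h. (if h = g then \<one>\<^bsub>S\<^esub> else \<zero>\<^bsub>S\<^esub>) \<noteq> \<zero>\<^bsub>S\<^esub>}" by (rule finite_subset) simp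
  then show ?thesis using g by (auto simp: delta_eq[OF S g] monoid_algebra_def)
qed

lemma delta_mult:
  assumes S: "S \<in> algebras R" and g: "g \<in> carrier (obj G S)" "g' \<in> carrier (obj G S)"
  shows "\<delta> S (g \<otimes>\<^bsub>obj G S\<^esub> g') = \<delta> S g \<otimes>\<^bsub>monoid_algebra S (obj G S)\<^esub> \<delta> S g'"
proof
  fix x
  interpret cring S by (rule algebrasD[OF S])
  let ?P = "{p \<in> {h. \<delta> S g h \<noteq> \<zero>\<^bsub>S\<^esub>} \<times> {k. \<delta> S g' k \<noteq> \<zero>\<^bsub>S\<^esub>}. fst p \<otimes>\<^bsub>obj G S\<^esub> snd p = x}"
  \<comment> \<open>In the zero ring the support of a basis element is empty. The sum is then empty
    as well, and the left side vanishes because one is zero.\<close>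
  have P: "?P = (if \<one>\<^bsub>S\<^esub> \<noteq> \<zero>\<^bsub>S\<^esub> \<and> g \<otimes>\<^bsub>obj G S\<^esub> g' = x then {(g, g')} else {})"
    by (auto simp: delta_eq[OF S] g split: if_splits)
  have "\<delta> S (g \<otimes>\<^bsub>obj G S\<^esub> g') x = (\<Oplus>\<^bsub>S\<^esub>p\<in>?P. \<delta> S g (fst p) \<otimes>\<^bsub>S\<^esub> \<delta> S g' (snd p))"
    unfolding P by (auto simp: delta_eq[OF S] g G_simps(1)[OF S])
  then show "\<delta> S (g \<otimes>\<^bsub>obj G S\<^esub> g') x = (\<delta> S g \<otimes>\<^bsub>monoid_algebra S (obj G S)\<^esub> \<delta> S g') x"
    unfolding monoid_algebra_mult_pushforward .
qed

lemma delta_natural: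
  assumes S: "S \<in> algebras R" and T: "T \<in> algebras R" and h: "h \<in> algebra_homs R S T" and g: "g \<in> carrier (obj G S)"
  shows "\<delta> T (arr G S T h g) = arr RG S T h (\<delta> S g)"
proof
  fix x
  interpret T: cring T by (rule algebrasD[OF T])
  note hs = algebra_homs_simps[OF S T h]
  let ?P = "{g' \<in> {g'. \<delta> S g g' \<noteq> \<zero>\<^bsub>S\<^esub>}. arr G S T h g' = x}"
  \<comment> \<open>If \<open>S\<close> is the zero ring the index set is empty; then
    \<open>T\<close> is the zero ring as well, so the empty sum is still correct.\<close>
  have P: "?P = (if \<one>\<^bsub>S\<^esub> \<noteq> \<zero>\<^bsub>S\<^esub> \<and> arr G S T h g = x then {g} else {})"
    by (auto simp: delta_eq[OF S] g split: if_splits)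
  have "\<one>\<^bsub>S\<^esub> = \<zero>\<^bsub>S\<^esub> \<Longrightarrow> \<one>\<^bsub>T\<^esub> = \<zero>\<^bsub>T\<^esub>" using hs(1,2) by metis
  then have "\<delta> T (arr G S T h g) x = (\<Oplus>\<^bsub>T\<^esub>g'\<in>?P. h (\<delta> S g g'))"
    unfolding P by (auto simp: delta_eq[OF S] delta_eq[OF T] g G_simps(6)[OF S T h] hs)
  then show "\<delta> T (arr G S T h g) x = arr RG S T h (\<delta> S g) x"
    unfolding arr_monoid_algebra .
qed

end

text \<open>Kept general in \<open>B\<close>: for distributions and point evaluations it is
  \<open>monoid_algebra_to_distributions\<close> itself.\<close>

definition linear_extension ::
  "('u, 'z) ring_scheme \<Rightarrow> ('u, 'g, ('g, 'y) monoid_scheme) alg_functor \<Rightarrow>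
   ('u, 'b, ('u, 'b) module) alg_functor \<Rightarrow> ('u alg \<Rightarrow> 'g \<Rightarrow> 'b) \<Rightarrow> 'u alg \<Rightarrow> ('g \<Rightarrow> 'u) \<Rightarrow> 'b" where
  "linear_extension R G B \<phi> =
     (\<lambda>S\<in>algebras R. \<lambda>a\<in>carrier (monoid_algebra S (obj G S)).
        \<Oplus>\<^bsub>obj B S\<^esub>g\<in>{g. a g \<noteq> \<zero>\<^bsub>S\<^esub>}. a g \<odot>\<^bsub>obj B S\<^esub> \<phi> S g)"

section \<open>Linear extension of a morphism of monoids\<close>

context monoid_functor_base
begin

context
  fixes B :: "('u, 'b, ('u, 'b) module) alg_functor" and \<phi>
  assumes B: "algebra_functor R B" and \<phi>: "\<phi> \<in> monoid_morphisms R G B"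
begin

lemma monoid_morphismD:
  assumes "S \<in> algebras R"
  shows "g \<in> carrier (obj G S) \<Longrightarrow> \<phi> S g \<in> carrier (obj B S)"
    "g \<in> carrier (obj G S) \<Longrightarrow> g' \<in> carrier (obj G S) \<Longrightarrow>
      \<phi> S (g \<otimes>\<^bsub>obj G S\<^esub> g') = \<phi> S g \<otimes>\<^bsub>obj B S\<^esub> \<phi> S g'"
    "\<phi> S \<one>\<^bsub>obj G S\<^esub> = \<one>\<^bsub>obj B S\<^esub>"
    "T \<in> algebras R \<Longrightarrow> h \<in> algebra_homs R S T \<Longrightarrow> g \<in> carrier (obj G S) \<Longrightarrow>
      \<phi> T (arr G S T h g) = arr B S T h (\<phi> S g)"
  using \<phi> assms by (auto simp: monoid_morphisms_def nat_trans_def hom_def)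

text \<open>The freedom in \<open>Y\<close> brings sums with different supports to a common index
  set, and it absorbs cancellation: addition, scaling and pushforward can all make supports smaller
  than expected.\<close>

lemma linear_extension_eq:
  assumes S: "S \<in> algebras R" and a: "a \<in> carrier (monoid_algebra S (obj G S))"
    and Y: "finite Y" "{g. a g \<noteq> \<zero>\<^bsub>S\<^esub>} \<subseteq> Y" "Y \<subseteq> carrier (obj G S)"
  shows "linear_extension R G B \<phi> S a = (\<Oplus>\<^bsub>obj B S\<^esub>g\<in>Y. a g \<odot>\<^bsub>obj B S\<^esub> \<phi> S g)"
proof -
  interpret module S "obj B S" by (rule algebra_functorD[OF B S])
  show ?thesis
    using S a Y monoid_algebraD[OF a] monoid_morphismD(1)[OF S]
    by (auto simp: linear_extension_def intro!: finsum_support)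
qed

lemma linear_extension_support:
  assumes S: "S \<in> algebras R" and a: "a \<in> carrier (monoid_algebra S (obj G S))"
  shows "linear_extension R G B \<phi> S a = (\<Oplus>\<^bsub>obj B S\<^esub>g\<in>{g. a g \<noteq> \<zero>\<^bsub>S\<^esub>}. a g \<odot>\<^bsub>obj B S\<^esub> \<phi> S g)"
  using S a by (simp add: linear_extension_def)

lemma linear_extension_pushforward:
  assumes S: "S \<in> algebras R" and X: "finite X" "f \<in> X \<rightarrow> carrier (obj G S)" "c \<in> X \<rightarrow> carrier S"
  shows "linear_extension R G B \<phi> S (\<lambda>y. \<Oplus>\<^bsub>S\<^esub>x\<in>{x\<in>X. f x = y}. c x) = (\<Oplus>\<^bsub>obj B S\<^esub>x\<in>X. c x \<odot>\<^bsub>obj B S\<^esub> \<phi> S (f x))"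
proof -
  interpret module S "obj B S" by (rule algebra_functorD[OF B S])
  note p = pushforward_mem_monoid_algebra[OF algebrasD(1)[OF S] X]
  have "linear_extension R G B \<phi> S (\<lambda>y. \<Oplus>\<^bsub>S\<^esub>x\<in>{x\<in>X. f x = y}. c x) =
      (\<Oplus>\<^bsub>obj B S\<^esub>y\<in>f ` X. (\<Oplus>\<^bsub>S\<^esub>x\<in>{x\<in>X. f x = y}. c x) \<odot>\<^bsub>obj B S\<^esub> \<phi> S y)"
    using X by (intro linear_extension_eq[OF S p(1) _ p(2)]) auto
  also have "\<dots> = (\<Oplus>\<^bsub>obj B S\<^esub>x\<in>X. c x \<odot>\<^bsub>obj B S\<^esub> \<phi> S (f x))"
    using X monoid_morphismD(1)[OF S] by (intro finsum_pushforward) auto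
  finally show ?thesis .
qed

lemma linear_extension_closed:
  assumes S: "S \<in> algebras R" and a: "a \<in> carrier (monoid_algebra S (obj G S))"
  shows "linear_extension R G B \<phi> S a \<in> carrier (obj B S)"
proof -
  interpret module S "obj B S" by (rule algebra_functorD[OF B S])
  show ?thesis
    unfolding linear_extension_support[OF S a]
    using monoid_algebraD[OF a] monoid_morphismD(1)[OF S] by (intro finsum_closed) auto
qed

lemma linear_extension_delta:
  assumes S: "S \<in> algebras R" and g: "g \<in> carrier (obj G S)"
  shows "linear_extension R G B \<phi> S (\<delta> S g) = \<phi> S g"
proof -
  interpret module S "obj B S" by (rule algebra_functorD[OF B S])
  \<comment> \<open>The sum runs over the singleton and not over the support, which is empty when
    \<open>S\<close> is the zero ring.\<close>
  have "linear_extension R G B \<phi> S (\<delta> S g) = (\<Oplus>\<^bsub>obj B S\<^esub>h\<in>{g}. \<delta> S g h \<odot>\<^bsub>obj B S\<^esub> \<phi> S h)"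
    by (rule linear_extension_eq[OF S delta_mem[OF S g]]) (auto simp: delta_eq[OF S g] g split: if_splits)
  then show ?thesis using monoid_morphismD(1)[OF S g] by (simp add: delta_eq[OF S g])
qed

text \<open>Each property is an identity of finite sums: arrows and products are pushforwards of
  coefficients, and additivity is checked over the union of the two supports.\<close>

lemma linear_extension_mem: "linear_extension R G B \<phi> \<in> algebra_morphisms R RG B"
proof -
  let ?E = "linear_extension R G B \<phi>"
  have "?E \<in> (\<Pi>\<^sub>E S\<in>algebras R. carrier (obj RG S) \<rightarrow>\<^sub>E carrier (obj B S))"
    using linear_extension_closed by (auto simp: linear_extension_def PiE_iff)
  moreover have "?E T (arr RG S T h a) = arr B S T h (?E S a)"
    if S: "S \<in> algebras R" and T: "T \<in> algebras R" and h: "h \<in> algebra_homs R S T"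
      and a: "a \<in> carrier (monoid_algebra S (obj G S))" for S T h a
  proof -
    note a' = monoid_algebraD[OF a]
    interpret S: module S "obj B S" by (rule algebra_functorD[OF B S])
    interpret T: module T "obj B T" by (rule algebra_functorD[OF B T])
    have "?E T (arr RG S T h a) = (\<Oplus>\<^bsub>obj B T\<^esub>g\<in>{g. a g \<noteq> \<zero>\<^bsub>S\<^esub>}. h (a g) \<odot>\<^bsub>obj B T\<^esub> \<phi> T (arr G S T h g))"
      unfolding arr_monoid_algebra
      by (rule linear_extension_pushforward[OF T a'(1)])
        (use a' algebra_homs_closed[OF h] G_simps(6)[OF S T h] in auto)
    also have "\<dots> = (\<Oplus>\<^bsub>obj B T\<^esub>g\<in>{g. a g \<noteq> \<zero>\<^bsub>S\<^esub>}. arr B S T h (a g \<odot>\<^bsub>obj B S\<^esub> \<phi> S g))"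
      using a' monoid_morphismD(1)[OF S] monoid_morphismD(1)[OF T] monoid_morphismD(4)[OF S T h]
        algebra_functorD(6)[OF B S T h] G_simps(6)[OF S T h] algebra_homs_closed[OF h]
        ring_hom_closed[OF algebra_functorD(5)[OF B S T h]]
      by (intro T.finsum_cong') auto
    also have "\<dots> = arr B S T h (?E S a)"
      unfolding linear_extension_support[OF S a] using a' monoid_morphismD(1)[OF S]
      by (intro ring_hom_finsum[symmetric] algebra_functorD[OF B] S T h) auto
    finally show ?thesis .
  qed
  moreover have "?E S (\<lambda>g. a g \<oplus>\<^bsub>S\<^esub> b g) = ?E S a \<oplus>\<^bsub>obj B S\<^esub> ?E S b"
    if S: "S \<in> algebras R" and a: "a \<in> carrier (monoid_algebra S (obj G S))"
      and b: "b \<in> carrier (monoid_algebra S (obj G S))" for S a b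
  proof -
    note a' = monoid_algebraD[OF a] and b' = monoid_algebraD[OF b]
    interpret S: module S "obj B S" by (rule algebra_functorD[OF B S])
    let ?Y = "{g. a g \<noteq> \<zero>\<^bsub>S\<^esub>} \<union> {g. b g \<noteq> \<zero>\<^bsub>S\<^esub>}"
    have Y: "finite ?Y" "?Y \<subseteq> carrier (obj G S)" using a' b' by auto
    have cl: "\<phi> S g \<in> carrier (obj B S)" "a g \<in> carrier S" "b g \<in> carrier S" if "g \<in> ?Y" for g
      using that Y a' b' monoid_morphismD(1)[OF S] by auto
    have "?E S (\<lambda>g. a g \<oplus>\<^bsub>S\<^esub> b g) = (\<Oplus>\<^bsub>obj B S\<^esub>g\<in>?Y. (a g \<oplus>\<^bsub>S\<^esub> b g) \<odot>\<^bsub>obj B S\<^esub> \<phi> S g)"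
      by (rule linear_extension_eq[OF S monoid_algebra_closed(1)[OF S a b] Y(1) _ Y(2)]) auto
    also have "\<dots> = (\<Oplus>\<^bsub>obj B S\<^esub>g\<in>?Y. a g \<odot>\<^bsub>obj B S\<^esub> \<phi> S g \<oplus>\<^bsub>obj B S\<^esub> b g \<odot>\<^bsub>obj B S\<^esub> \<phi> S g)"
      using cl by (intro S.finsum_cong') (auto intro!: S.smult_l_distr)
    also have "\<dots> = (\<Oplus>\<^bsub>obj B S\<^esub>g\<in>?Y. a g \<odot>\<^bsub>obj B S\<^esub> \<phi> S g) \<oplus>\<^bsub>obj B S\<^esub> (\<Oplus>\<^bsub>obj B S\<^esub>g\<in>?Y. b g \<odot>\<^bsub>obj B S\<^esub> \<phi> S g)"
      using cl by (intro S.finsum_addf) auto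
    also have "\<dots> = ?E S a \<oplus>\<^bsub>obj B S\<^esub> ?E S b"
      using linear_extension_eq[OF S a Y(1) _ Y(2)] linear_extension_eq[OF S b Y(1) _ Y(2)] by auto
    finally show ?thesis .
  qed
  moreover have "?E S (\<lambda>g. s \<otimes>\<^bsub>S\<^esub> a g) = s \<odot>\<^bsub>obj B S\<^esub> ?E S a"
    if S: "S \<in> algebras R" and s: "s \<in> carrier S" and a: "a \<in> carrier (monoid_algebra S (obj G S))" for S s a
  proof -
    note a' = monoid_algebraD[OF a]
    interpret S: module S "obj B S" by (rule algebra_functorD[OF B S])
    have "?E S (\<lambda>g. s \<otimes>\<^bsub>S\<^esub> a g) = (\<Oplus>\<^bsub>obj B S\<^esub>g\<in>{g. a g \<noteq> \<zero>\<^bsub>S\<^esub>}. (s \<otimes>\<^bsub>S\<^esub> a g) \<odot>\<^bsub>obj B S\<^esub> \<phi> S g)"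
      by (rule linear_extension_eq[OF S monoid_algebra_closed(2)[OF S a s] a'(1) _ a'(2)]) (use s in auto)
    also have "\<dots> = (\<Oplus>\<^bsub>obj B S\<^esub>g\<in>{g. a g \<noteq> \<zero>\<^bsub>S\<^esub>}. s \<odot>\<^bsub>obj B S\<^esub> (a g \<odot>\<^bsub>obj B S\<^esub> \<phi> S g))"
      using s a' monoid_morphismD(1)[OF S] by (intro S.finsum_cong') (auto intro!: S.smult_assoc1)
    also have "\<dots> = s \<odot>\<^bsub>obj B S\<^esub> ?E S a"
      unfolding linear_extension_support[OF S a]
      using s a' monoid_morphismD(1)[OF S] by (intro S.finsum_smult_ldistr[symmetric]) auto
    finally show ?thesis .
  qed
  moreover have "?E S (a \<otimes>\<^bsub>monoid_algebra S (obj G S)\<^esub> b) = ?E S a \<otimes>\<^bsub>obj B S\<^esub> ?E S b"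
    if S: "S \<in> algebras R" and a: "a \<in> carrier (monoid_algebra S (obj G S))"
      and b: "b \<in> carrier (monoid_algebra S (obj G S))" for S a b
  proof -
    note a' = monoid_algebraD[OF a] and b' = monoid_algebraD[OF b]
    interpret S: module S "obj B S" by (rule algebra_functorD[OF B S])
    interpret BS: ring "obj B S" by (rule algebra_functorD[OF B S])
    let ?X = "{g. a g \<noteq> \<zero>\<^bsub>S\<^esub>}" and ?Y = "{g. b g \<noteq> \<zero>\<^bsub>S\<^esub>}"
    have cl: "\<phi> S g \<in> carrier (obj B S)" "a g \<in> carrier S" "b g \<in> carrier S" if "g \<in> carrier (obj G S)" for g
      using that a' b' monoid_morphismD(1)[OF S] by auto
    have "?E S (a \<otimes>\<^bsub>monoid_algebra S (obj G S)\<^esub> b) =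
        (\<Oplus>\<^bsub>obj B S\<^esub>p\<in>?X \<times> ?Y. (a (fst p) \<otimes>\<^bsub>S\<^esub> b (snd p)) \<odot>\<^bsub>obj B S\<^esub> \<phi> S (fst p \<otimes>\<^bsub>obj G S\<^esub> snd p))"
      unfolding monoid_algebra_mult_pushforward
      by (rule linear_extension_pushforward[OF S]) (use a'(1) b'(1) monoid_algebra_support[OF a] monoid_algebra_support[OF b] in \<open>auto intro!: G_simps(1)[OF S] cring.cring_simprules(5)[OF algebrasD(1)[OF S]]\<close>)
    \<comment> \<open>Scalars are central in \<open>B(S)\<close>, so the two coefficients can be
      distributed over the two factors into which \<phi> splits the product of points.\<close>
    also have "\<dots> = (\<Oplus>\<^bsub>obj B S\<^esub>p\<in>?X \<times> ?Y.
        (a (fst p) \<odot>\<^bsub>obj B S\<^esub> \<phi> S (fst p)) \<otimes>\<^bsub>obj B S\<^esub> (b (snd p) \<odot>\<^bsub>obj B S\<^esub> \<phi> S (snd p)))"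
    proof (rule S.finsum_cong')
      fix p assume p: "p \<in> ?X \<times> ?Y"
      then have p': "fst p \<in> carrier (obj G S)" "snd p \<in> carrier (obj G S)" using a'(2) b'(2) by auto
      show "(a (fst p) \<otimes>\<^bsub>S\<^esub> b (snd p)) \<odot>\<^bsub>obj B S\<^esub> \<phi> S (fst p \<otimes>\<^bsub>obj G S\<^esub> snd p) =
        (a (fst p) \<odot>\<^bsub>obj B S\<^esub> \<phi> S (fst p)) \<otimes>\<^bsub>obj B S\<^esub> (b (snd p) \<odot>\<^bsub>obj B S\<^esub> \<phi> S (snd p))"
        using p' cl by (simp add: monoid_morphismD(2)[OF S] algebra_functorD(3,4)[OF B S] S.R.m_comm flip: S.smult_assoc1)
    qed (auto intro!: BS.m_closed S.smult_closed cl dest: monoid_algebra_support(1)[OF a] monoid_algebra_support(1)[OF b])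
    also have "\<dots> = ?E S a \<otimes>\<^bsub>obj B S\<^esub> ?E S b"
      unfolding linear_extension_support[OF S a] linear_extension_support[OF S b]
      using a' b' cl by (intro BS.finsum_times_finsum[symmetric]) auto
    finally show ?thesis .
  qed
  \<comment> \<open>The unit of the monoid algebra is the basis element at the unit of
    \<open>G(S)\<close>.\<close>
  moreover have "?E S (\<lambda>g. if g = \<one>\<^bsub>obj G S\<^esub> then \<one>\<^bsub>S\<^esub> else \<zero>\<^bsub>S\<^esub>) = \<one>\<^bsub>obj B S\<^esub>" if S: "S \<in> algebras R" for S
    using linear_extension_delta[OF S G_simps(2)[OF S]] monoid_morphismD(3)[OF S]
    by (simp add: delta_eq[OF S G_simps(2)[OF S]])
  ultimately show ?thesis
    unfolding algebra_morphisms_def module_morphisms_def nat_trans_def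
    by (simp add: ring_hom_memI linear_extension_closed)
qed

end

section \<open>Algebra morphisms and their restriction to points\<close>

lemma algebra_morphismD:
  assumes "\<psi> \<in> algebra_morphisms R F B" "S \<in> algebras R"
  shows "x \<in> carrier (obj F S) \<Longrightarrow> \<psi> S x \<in> carrier (obj B S)"
    "x \<in> carrier (obj F S) \<Longrightarrow> y \<in> carrier (obj F S) \<Longrightarrow> \<psi> S (x \<oplus>\<^bsub>obj F S\<^esub> y) = \<psi> S x \<oplus>\<^bsub>obj B S\<^esub> \<psi> S y"
    "x \<in> carrier (obj F S) \<Longrightarrow> y \<in> carrier (obj F S) \<Longrightarrow> \<psi> S (x \<otimes>\<^bsub>obj F S\<^esub> y) = \<psi> S x \<otimes>\<^bsub>obj B S\<^esub> \<psi> S y"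
    "s \<in> carrier S \<Longrightarrow> x \<in> carrier (obj F S) \<Longrightarrow> \<psi> S (s \<odot>\<^bsub>obj F S\<^esub> x) = s \<odot>\<^bsub>obj B S\<^esub> \<psi> S x"
    "\<psi> S \<one>\<^bsub>obj F S\<^esub> = \<one>\<^bsub>obj B S\<^esub>"
    "T \<in> algebras R \<Longrightarrow> h \<in> algebra_homs R S T \<Longrightarrow> x \<in> carrier (obj F S) \<Longrightarrow>
      \<psi> T (arr F S T h x) = arr B S T h (\<psi> S x)"
  using assms by (auto simp: algebra_morphisms_def module_morphisms_def nat_trans_def ring_hom_def)

lemma algebra_morphism_extensional:
  assumes "\<psi> \<in> algebra_morphisms R F B"
  shows "\<psi> \<in> extensional (algebras R)" "S \<in> algebras R \<Longrightarrow> \<psi> S \<in> extensional (carrier (obj F S))"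
  using assms by (auto simp: algebra_morphisms_def module_morphisms_def nat_trans_def PiE_iff)

lemma algebra_morphism_eqI:
  assumes "\<psi> \<in> algebra_morphisms R F B" "\<psi>' \<in> algebra_morphisms R F B"
    "\<And>S x. S \<in> algebras R \<Longrightarrow> x \<in> carrier (obj F S) \<Longrightarrow> \<psi> S x = \<psi>' S x"
  shows "\<psi> = \<psi>'"
  by (rule extensionalityI[of _ "algebras R"], rule algebra_morphism_extensional[OF assms(1)],
      rule algebra_morphism_extensional[OF assms(2)], rule extensionalityI,
      rule algebra_morphism_extensional(2)[OF assms(1)], assumption,
      rule algebra_morphism_extensional(2)[OF assms(2)], assumption, rule assms(3))

text \<open>Stated for any \<eta> with the properties of a morphism of functors of monoids, so that
  it serves both the map to the monoid algebra and the map to distributions.\<close>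

lemma comp_monoid_morphism:
  assumes F: "\<psi> \<in> algebra_morphisms R F B"
    and cl: "\<And>S g. S \<in> algebras R \<Longrightarrow> g \<in> carrier (obj G S) \<Longrightarrow> \<eta> S g \<in> carrier (obj F S)"
    and nat: "\<And>S T h g. S \<in> algebras R \<Longrightarrow> T \<in> algebras R \<Longrightarrow> h \<in> algebra_homs R S T \<Longrightarrow> g \<in> carrier (obj G S) \<Longrightarrow>
      \<eta> T (arr G S T h g) = arr F S T h (\<eta> S g)"
    and mult: "\<And>S g g'. S \<in> algebras R \<Longrightarrow> g \<in> carrier (obj G S) \<Longrightarrow> g' \<in> carrier (obj G S) \<Longrightarrow>
      \<eta> S (g \<otimes>\<^bsub>obj G S\<^esub> g') = \<eta> S g \<otimes>\<^bsub>obj F S\<^esub> \<eta> S g'"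
    and one: "\<And>S. S \<in> algebras R \<Longrightarrow> \<eta> S \<one>\<^bsub>obj G S\<^esub> = \<one>\<^bsub>obj F S\<^esub>"
  shows "comp_trans R G \<psi> \<eta> \<in> monoid_morphisms R G B"
proof -
  note D = algebra_morphismD[OF F]
  have "\<psi> T (\<eta> T (arr G S T h g)) = arr B S T h (\<psi> S (\<eta> S g))"
    if "S \<in> algebras R" "T \<in> algebras R" "h \<in> algebra_homs R S T" "g \<in> carrier (obj G S)" for S T h g
    using that by (simp add: nat D(6) cl)
  then show ?thesis
    unfolding monoid_morphisms_def nat_trans_def comp_trans_def hom_def
    by (auto simp: G_simps cl D(1) mult D(3) one D(5) intro!: PiE_I)
qed

text \<open>The monoid algebra is spanned by the points. Allowing \<open>X\<close> to exceed the
  support makes the induction go through: the step drops one point from \<open>X\<close> by setting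
  the coefficient there to zero, whether or not it was zero before.\<close>

lemma algebra_morphism_eq_sum:
  assumes B: "algebra_functor R B" and \<psi>: "\<psi> \<in> algebra_morphisms R RG B" and S: "S \<in> algebras R"
    and X: "finite X" "X \<subseteq> carrier (obj G S)"
    and a: "a \<in> carrier (monoid_algebra S (obj G S))" "{g. a g \<noteq> \<zero>\<^bsub>S\<^esub>} \<subseteq> X"
  shows "\<psi> S a = (\<Oplus>\<^bsub>obj B S\<^esub>g\<in>X. a g \<odot>\<^bsub>obj B S\<^esub> \<psi> S (\<delta> S g))"
  using X a
proof (induction X arbitrary: a rule: finite_induct)
  interpret S: module S "obj B S" by (rule algebra_functorD[OF B S])
  note D = algebra_morphismD[OF \<psi> S, simplified]
  {
    case empty
    \<comment> \<open>Here \<open>a\<close> is zero, written as a multiple by zero so that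
      compatibility with scalars gives \<psi>(a) = 0.\<close>
    then have a: "a = (\<lambda>g. \<zero>\<^bsub>S\<^esub> \<otimes>\<^bsub>S\<^esub> a g)" by auto
    have "\<psi> S a = \<zero>\<^bsub>S\<^esub> \<odot>\<^bsub>obj B S\<^esub> \<psi> S a"
      by (subst a) (rule D(4), use empty in auto)
    then show ?case using D(1)[OF empty(2)] by simp
  next
    case (insert x X)
    have x: "x \<in> carrier (obj G S)" using insert by auto
    note a' = monoid_algebraD[OF insert.prems(2)]
    have dx: "\<delta> S x \<in> carrier (monoid_algebra S (obj G S))" by (rule delta_mem[OF S x])
    have "{g. (a(x := \<zero>\<^bsub>S\<^esub>)) g \<noteq> \<zero>\<^bsub>S\<^esub>} \<subseteq> {g. a g \<noteq> \<zero>\<^bsub>S\<^esub>}" by auto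
    from finite_subset[OF this a'(1)] have b: "a(x := \<zero>\<^bsub>S\<^esub>) \<in> carrier (monoid_algebra S (obj G S))"
      using a' by (auto simp: monoid_algebra_def)
    have cl: "\<psi> S (\<delta> S g) \<in> carrier (obj B S)" "a g \<in> carrier S" if "g \<in> insert x X" for g
      using that insert.prems(1) D(1) delta_mem[OF S] a'(3) by auto
    have "a = (\<lambda>g. (a(x := \<zero>\<^bsub>S\<^esub>)) g \<oplus>\<^bsub>S\<^esub> a x \<otimes>\<^bsub>S\<^esub> \<delta> S x g)"
    proof
      fix g
      have "a g \<in> carrier S" using a'(3,4)[of g] by (cases "g \<in> carrier (obj G S)") auto
      then show "a g = (a(x := \<zero>\<^bsub>S\<^esub>)) g \<oplus>\<^bsub>S\<^esub> a x \<otimes>\<^bsub>S\<^esub> \<delta> S x g"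
        using a'(3)[OF x] by (simp add: delta_eq[OF S x])
    qed
    then have "\<psi> S a = \<psi> S (\<lambda>g. (a(x := \<zero>\<^bsub>S\<^esub>)) g \<oplus>\<^bsub>S\<^esub> a x \<otimes>\<^bsub>S\<^esub> \<delta> S x g)" by (rule arg_cong)
    also have "\<dots> = \<psi> S (a(x := \<zero>\<^bsub>S\<^esub>)) \<oplus>\<^bsub>obj B S\<^esub> a x \<odot>\<^bsub>obj B S\<^esub> \<psi> S (\<delta> S x)"
      unfolding D(2)[OF b monoid_algebra_closed(2)[OF S dx a'(3)[OF x]]] D(4)[OF a'(3)[OF x] dx] ..
    also have "\<psi> S (a(x := \<zero>\<^bsub>S\<^esub>)) = (\<Oplus>\<^bsub>obj B S\<^esub>g\<in>X. (a(x := \<zero>\<^bsub>S\<^esub>)) g \<odot>\<^bsub>obj B S\<^esub> \<psi> S (\<delta> S g))"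
      by (rule insert.IH[OF _ b]) (use insert.prems in auto)
    also have "\<dots> = (\<Oplus>\<^bsub>obj B S\<^esub>g\<in>X. a g \<odot>\<^bsub>obj B S\<^esub> \<psi> S (\<delta> S g))"
      using insert.hyps cl by (intro S.finsum_cong') auto
    also have "\<dots> \<oplus>\<^bsub>obj B S\<^esub> a x \<odot>\<^bsub>obj B S\<^esub> \<psi> S (\<delta> S x) = (\<Oplus>\<^bsub>obj B S\<^esub>g\<in>insert x X. a g \<odot>\<^bsub>obj B S\<^esub> \<psi> S (\<delta> S g))"
      using insert.hyps cl by (subst S.finsum_insert) (auto intro!: S.a_comm S.finsum_closed)
    finally show ?case .
  }
qed

text \<open>Linear extension is the inverse: it keeps the values on points, and these determine a
  morphism by \<open>algebra_morphism_eq_sum\<close>.\<close>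

lemma monoid_algebra_universal:
  assumes B: "algebra_functor R B"
  shows "bij_betw (\<lambda>\<psi>. comp_trans R G \<psi> \<delta>) (algebra_morphisms R RG B) (monoid_morphisms R G B)"
proof (rule bij_betw_byWitness[where f' = "linear_extension R G B"])
  have mem: "comp_trans R G \<psi> \<delta> \<in> monoid_morphisms R G B" if "\<psi> \<in> algebra_morphisms R RG B" for \<psi>
    by (rule comp_monoid_morphism[OF that])
      (simp_all add: delta_mem delta_natural delta_mult delta_eq[OF _ G_simps(2)])
  then show "(\<lambda>\<psi>. comp_trans R G \<psi> \<delta>) ` algebra_morphisms R RG B \<subseteq> monoid_morphisms R G B" by blast
  show "linear_extension R G B ` monoid_morphisms R G B \<subseteq> algebra_morphisms R RG B"
    using linear_extension_mem[OF B] by blast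
  show "\<forall>\<psi>\<in>algebra_morphisms R RG B. linear_extension R G B (comp_trans R G \<psi> \<delta>) = \<psi>"
  proof (intro ballI algebra_morphism_eqI[OF linear_extension_mem[OF B mem]])
    fix \<psi> S a assume \<psi>: "\<psi> \<in> algebra_morphisms R RG B" and S: "S \<in> algebras R" and "a \<in> carrier (obj RG S)"
    then have a: "a \<in> carrier (monoid_algebra S (obj G S))" by simp
    interpret S: module S "obj B S" by (rule algebra_functorD[OF B S])
    note a' = monoid_algebraD[OF a]
    show "linear_extension R G B (comp_trans R G \<psi> \<delta>) S a = \<psi> S a"
      unfolding linear_extension_support[OF B mem[OF \<psi>] S a] algebra_morphism_eq_sum[OF B \<psi> S a'(1,2) a subset_refl]
      using a' algebra_morphismD(1)[OF \<psi> S] delta_mem[OF S]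
      by (intro S.finsum_cong') (auto simp: comp_trans_def S)
  qed
  show "\<forall>\<phi>\<in>monoid_morphisms R G B. comp_trans R G (linear_extension R G B \<phi>) \<delta> = \<phi>"
  proof
    fix \<phi> assume \<phi>: "\<phi> \<in> monoid_morphisms R G B"
    then have e: "\<phi> \<in> extensional (algebras R)" "\<And>S. S \<in> algebras R \<Longrightarrow> \<phi> S \<in> extensional (carrier (obj G S))"
      by (auto simp: monoid_morphisms_def nat_trans_def PiE_iff)
    show "comp_trans R G (linear_extension R G B \<phi>) \<delta> = \<phi>"
      by (rule extensionalityI[OF _ e(1)]; (rule extensionalityI[OF _ e(2)])?)
        (simp_all add: comp_trans_def linear_extension_delta[OF B \<phi>])
  qed
qed

end

section \<open>The universal property of the algebra of distributions\<close>

context monoid_functor_base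
begin

lemma evaluation_family:
  assumes "S \<in> algebras R" "f \<in> carrier (obj A S)"
  shows "evaluation R A D S f = family R D S (\<lambda>T h w. val T w (res S T h f))"
  using assms by (simp add: evaluation_def family_def val_def)

text \<open>Points are dense among distributions, as far as functionals can see. Agreement is
  required over all \<open>T\<close> under \<open>S\<close>, since the functions that represent
  \<open>l\<close> and \<open>l'\<close> are separated by the points of \<open>G\<close> over all
  such \<open>T\<close> together.\<close>

lemma reflexive_eq_on_evaluations:
  assumes refl: "reflexive R A" and S: "S \<in> algebras R"
    and l: "l \<in> carrier (obj (dual R D) S)" "l' \<in> carrier (obj (dual R D) S)"
    and eq: "\<And>T h g. T \<in> algebras R \<Longrightarrow> h \<in> algebra_homs R S T \<Longrightarrow> g \<in> carrier (obj G T) \<Longrightarrow>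
      val T (res S T h l) (to_distributions R G T g) = val T (res S T h l') (to_distributions R G T g)"
  shows "l = l'"
proof -
  \<comment> \<open>Surjectivity of the map to the bidual: \<sigma> picks the function that
    represents a given functional.\<close>
  from refl obtain \<sigma> where \<sigma>: "\<sigma> \<in> module_morphisms R (dual R D) A"
    "\<And>y. y \<in> carrier (obj (dual R D) S) \<Longrightarrow> evaluation R A D S (\<sigma> S y) = y"
    using S unfolding reflexive_def module_isomorphism_def by blast
  have mem: "\<sigma> S y \<in> carrier (obj A S)" if "y \<in> carrier (obj (dual R D) S)" for y
    using \<sigma>(1) S that by (auto simp: module_morphisms_def nat_trans_def)
  have val_l: "val T (res S T h y) (to_distributions R G T g) = val T (res S T h (\<sigma> S y)) g"
    if y: "y \<in> carrier (obj (dual R D) S)" and T: "T \<in> algebras R" and h: "h \<in> algebra_homs R S T"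
      and g: "g \<in> carrier (obj G T)" for y T h g
  proof -
    have "val T (res S T h y) (to_distributions R G T g) =
        val T (res S T h (evaluation R A D S (\<sigma> S y))) (to_distributions R G T g)"
      by (simp only: \<sigma>(2)[OF y])
    also have "\<dots> = val T (to_distributions R G T g) (res S T h (\<sigma> S y))"
      unfolding evaluation_family[OF S mem[OF y]]
      by (rule val_res_family[OF S T h to_distributions_mem[OF T g]])
    also have "\<dots> = val T (res S T h (\<sigma> S y)) g"
      by (rule val_to_distributions[OF T g res_A[OF S T h mem[OF y]]])
    finally show ?thesis .
  qed
  have "\<sigma> S l = \<sigma> S l'"
    by (rule A_ext[OF S mem[OF l(1)] mem[OF l(2)]]) (simp add: eq flip: val_l[OF l(1)] val_l[OF l(2)])
  then show ?thesis using \<sigma>(2)[OF l(1)] \<sigma>(2)[OF l(2)] by metis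
qed

end

section \<open>The pairing that identifies \<open>B\<close> with the dual of
  \<open>N\<close>\<close>

locale dual_algebra_setting = monoid_functor_base R G
  for R :: "('u, 'z) ring_scheme" and G :: "('u, 'g, 'g monoid) alg_functor" +
  fixes N :: "('u, 'n, ('u, 'n) module) alg_functor"
    and B :: "('u, 'b, ('u, 'b) module) alg_functor"
    and \<tau> \<sigma>
  assumes refl: "reflexive R (function_functor R G)"
    and B: "algebra_functor R B" and N: "module_functor R N"
    and tau: "\<tau> \<in> module_morphisms R B (dual R N)"
    and sigma: "\<sigma> \<in> module_morphisms R (dual R N) B"
    and sigma_tau: "\<And>S b. S \<in> algebras R \<Longrightarrow> b \<in> carrier (obj B S) \<Longrightarrow> \<sigma> S (\<tau> S b) = b"
    and tau_sigma: "\<And>S w. S \<in> algebras R \<Longrightarrow> w \<in> carrier (obj (dual R N) S) \<Longrightarrow> \<tau> S (\<sigma> S w) = w"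
begin

lemma tauD:
  assumes S: "S \<in> algebras R"
  shows "b \<in> carrier (obj B S) \<Longrightarrow> \<tau> S b \<in> carrier (obj (dual R N) S)"
    "b \<in> carrier (obj B S) \<Longrightarrow> b' \<in> carrier (obj B S) \<Longrightarrow>
      \<tau> S (b \<oplus>\<^bsub>obj B S\<^esub> b') = \<tau> S b \<oplus>\<^bsub>obj (function_functor R N) S\<^esub> \<tau> S b'"
    "s \<in> carrier S \<Longrightarrow> b \<in> carrier (obj B S) \<Longrightarrow>
      \<tau> S (s \<odot>\<^bsub>obj B S\<^esub> b) = s \<odot>\<^bsub>obj (function_functor R N) S\<^esub> \<tau> S b"
    "T \<in> algebras R \<Longrightarrow> h \<in> algebra_homs R S T \<Longrightarrow> b \<in> carrier (obj B S) \<Longrightarrow>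
      \<tau> T (arr B S T h b) = res S T h (\<tau> S b)"
  using tau S by (auto simp: module_morphisms_def nat_trans_def)

lemma sigma_closed: "S \<in> algebras R \<Longrightarrow> w \<in> carrier (obj (dual R N) S) \<Longrightarrow> \<sigma> S w \<in> carrier (obj B S)"
  using sigma by (auto simp: module_morphisms_def nat_trans_def)

text \<open>Elements of \<open>B\<close> are treated as linear forms on \<open>N\<close>: this is
  the value b(n).\<close>

definition pairing :: "'u alg \<Rightarrow> 'b \<Rightarrow> 'n \<Rightarrow> 'u" where
  "pairing S b n = val S (\<tau> S b) n"

lemma N_set: "set_functor R N" by (rule module_set_functor[OF N])
lemma B_module: "module_functor R B" by (rule algebra_functor_module[OF B])
lemma B_set: "set_functor R B" by (rule module_set_functor[OF B_module])

lemma tau_functions: "S \<in> algebras R \<Longrightarrow> b \<in> carrier (obj B S) \<Longrightarrow> \<tau> S b \<in> carrier (obj (function_functor R N) S)"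
  by (rule dual_memD(1)[OF N _ tauD(1)])

lemma tau_extensional: "S \<in> algebras R \<Longrightarrow> b \<in> carrier (obj B S) \<Longrightarrow> \<tau> S b \<in> extensional (algebras S)"
  by (rule functionsD(1)[OF N_set tau_functions])

lemma pairing_simps:
  assumes S: "S \<in> algebras R" and b: "b \<in> carrier (obj B S)" and n: "n \<in> carrier (obj N S)"
  shows "pairing S b n \<in> carrier S"
    "b' \<in> carrier (obj B S) \<Longrightarrow> pairing S (b \<oplus>\<^bsub>obj B S\<^esub> b') n = pairing S b n \<oplus>\<^bsub>S\<^esub> pairing S b' n"
    "s \<in> carrier S \<Longrightarrow> pairing S (s \<odot>\<^bsub>obj B S\<^esub> b) n = s \<otimes>\<^bsub>S\<^esub> pairing S b n"
    "n' \<in> carrier (obj N S) \<Longrightarrow> pairing S b (n \<oplus>\<^bsub>obj N S\<^esub> n') = pairing S b n \<oplus>\<^bsub>S\<^esub> pairing S b n'"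
    "s \<in> carrier S \<Longrightarrow> pairing S b (s \<odot>\<^bsub>obj N S\<^esub> n) = s \<otimes>\<^bsub>S\<^esub> pairing S b n"
    "T \<in> algebras R \<Longrightarrow> h \<in> algebra_homs R S T \<Longrightarrow> pairing T (arr B S T h b) (arr N S T h n) = h (pairing S b n)"
  unfolding pairing_def
  using functions_closed[OF N_set S tau_functions[OF S b] n] tauD[OF S] b n S
    functions_natural[OF N_set S _ _ tau_functions[OF S b] n]
  by (simp_all add: val_ops tau_extensional val_dual_linear[OF N S])

text \<open>Injectivity of \<tau> combined with \<open>functions_ext\<close>: elements of
  \<open>B\<close> are separated by \<open>N\<close> once \<open>n\<close> ranges over all base
  changes. Equations in \<open>B\<close> thus become equations of scalars.\<close>

lemma pairing_ext:
  assumes S: "S \<in> algebras R" and b: "b \<in> carrier (obj B S)" "b' \<in> carrier (obj B S)"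
    and eq: "\<And>T h n. T \<in> algebras R \<Longrightarrow> h \<in> algebra_homs R S T \<Longrightarrow> n \<in> carrier (obj N T) \<Longrightarrow>
      pairing T (arr B S T h b) n = pairing T (arr B S T h b') n"
  shows "b = b'"
proof -
  have "\<tau> S b = \<tau> S b'"
    by (rule functions_ext[OF N_set S tau_functions[OF S b(1)] tau_functions[OF S b(2)]])
      (use eq tauD(4)[OF S] b in \<open>simp add: pairing_def\<close>)
  then show ?thesis using sigma_tau[OF S b(1)] sigma_tau[OF S b(2)] by metis
qed

text \<open>The uniqueness principle over a base \<open>S\<close>: \<beta> and \<gamma> are linear
  morphisms from distributions to \<open>B\<close>, both over \<open>S\<close>. Pairing with a fixed
  \<open>n\<close> turns each into a functional on distributions, to which density of the points
  applies. The argument \<open>h\<close> lets such a morphism be built from a point or a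
  distribution given over \<open>S\<close>; the quantifier over {\<beta>, \<gamma>} states the
  hypotheses for both at once.\<close>

lemma linear_families_eq:
  assumes S: "S \<in> algebras R"
    and cl: "\<And>\<alpha> T h w. \<alpha> \<in> {\<beta>, \<gamma>} \<Longrightarrow> T \<in> algebras R \<Longrightarrow> h \<in> algebra_homs R S T \<Longrightarrow> w \<in> carrier (obj D T) \<Longrightarrow>
      \<alpha> T h w \<in> carrier (obj B T)"
    and nat: "\<And>\<alpha> T U h k w. \<alpha> \<in> {\<beta>, \<gamma>} \<Longrightarrow> T \<in> algebras R \<Longrightarrow> U \<in> algebras R \<Longrightarrow> h \<in> algebra_homs R S T \<Longrightarrow>
      k \<in> algebra_homs R T U \<Longrightarrow> w \<in> carrier (obj D T) \<Longrightarrow>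
      \<alpha> U (compose (carrier S) k h) (res T U k w) = arr B T U k (\<alpha> T h w)"
    and add: "\<And>\<alpha> T h w w'. \<alpha> \<in> {\<beta>, \<gamma>} \<Longrightarrow> T \<in> algebras R \<Longrightarrow> h \<in> algebra_homs R S T \<Longrightarrow> w \<in> carrier (obj D T) \<Longrightarrow>
      w' \<in> carrier (obj D T) \<Longrightarrow> \<alpha> T h (w \<oplus>\<^bsub>obj (function_functor R A) T\<^esub> w') = \<alpha> T h w \<oplus>\<^bsub>obj B T\<^esub> \<alpha> T h w'"
    and smult: "\<And>\<alpha> T h s w. \<alpha> \<in> {\<beta>, \<gamma>} \<Longrightarrow> T \<in> algebras R \<Longrightarrow> h \<in> algebra_homs R S T \<Longrightarrow> s \<in> carrier T \<Longrightarrow>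
      w \<in> carrier (obj D T) \<Longrightarrow> \<alpha> T h (s \<odot>\<^bsub>obj (function_functor R A) T\<^esub> w) = s \<odot>\<^bsub>obj B T\<^esub> \<alpha> T h w"
    and eq: "\<And>T h g. T \<in> algebras R \<Longrightarrow> h \<in> algebra_homs R S T \<Longrightarrow> g \<in> carrier (obj G T) \<Longrightarrow>
      \<beta> T h (to_distributions R G T g) = \<gamma> T h (to_distributions R G T g)"
    and T: "T \<in> algebras R" and h: "h \<in> algebra_homs R S T" and w: "w \<in> carrier (obj D T)"
  shows "\<beta> T h w = \<gamma> T h w"
proof (rule pairing_ext[OF T])
  have DM: "module_functor R D" by (rule module_functor_dual[OF A_module])
  fix U k n assume U: "U \<in> algebras R" and k: "k \<in> algebra_homs R T U" and n: "n \<in> carrier (obj N U)"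
  have kh: "compose (carrier S) k h \<in> algebra_homs R S U" by (rule compose_mem_algebra_homs[OF S h k])
  \<comment> \<open>The functional w \<mapsto> \<alpha>(w)(n), taken over \<open>U\<close> because
    \<open>n\<close> lives there; \<open>S\<close> maps to \<open>U\<close> by \<open>k\<close>
    after \<open>h\<close>.\<close>
  let ?l = "\<lambda>\<alpha>. family R D U (\<lambda>V l w. pairing V (\<alpha> V (compose (carrier S) l (compose (carrier S) k h)) w) (arr N U V l n))"
  have mem: "?l \<alpha> \<in> carrier (obj (dual R D) U)" if \<alpha>: "\<alpha> \<in> {\<beta>, \<gamma>}" for \<alpha>
  proof (rule family_mem_dual[OF DM U])
    fix V l x y s assume V: "V \<in> algebras R" and l: "l \<in> algebra_homs R U V" and x: "x \<in> carrier (obj D V)"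
    have lkh: "compose (carrier S) l (compose (carrier S) k h) \<in> algebra_homs R S V"
      by (rule compose_mem_algebra_homs[OF S kh l])
    have nV: "arr N U V l n \<in> carrier (obj N V)" by (rule set_functorD(2)[OF N_set U V l n])
    show "pairing V (\<alpha> V (compose (carrier S) l (compose (carrier S) k h)) x) (arr N U V l n) \<in> carrier V"
      by (rule pairing_simps(1)[OF V cl[OF \<alpha> V lkh x] nV])
    show "pairing V (\<alpha> V (compose (carrier S) l (compose (carrier S) k h)) (s \<odot>\<^bsub>obj D V\<^esub> x)) (arr N U V l n) =
       s \<otimes>\<^bsub>V\<^esub> pairing V (\<alpha> V (compose (carrier S) l (compose (carrier S) k h)) x) (arr N U V l n)"
      if "s \<in> carrier V"
      using smult[OF \<alpha> V lkh that x] pairing_simps(3)[OF V cl[OF \<alpha> V lkh x] nV that] by simp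
    show "pairing V (\<alpha> V (compose (carrier S) l (compose (carrier S) k h)) (x \<oplus>\<^bsub>obj D V\<^esub> y)) (arr N U V l n) =
       pairing V (\<alpha> V (compose (carrier S) l (compose (carrier S) k h)) x) (arr N U V l n) \<oplus>\<^bsub>V\<^esub>
       pairing V (\<alpha> V (compose (carrier S) l (compose (carrier S) k h)) y) (arr N U V l n)"
      if y: "y \<in> carrier (obj D V)"
      using add[OF \<alpha> V lkh x y] pairing_simps(2)[OF V cl[OF \<alpha> V lkh x] nV cl[OF \<alpha> V lkh y]] by simp
    fix W m assume W: "W \<in> algebras R" and m: "m \<in> algebra_homs R V W"
    \<comment> \<open>Base change in stages along \<open>l\<close> and \<open>m\<close> is regrouped
      into the form to which \<open>nat\<close> applies.\<close>
    have c: "compose (carrier S) (compose (carrier U) m l) (compose (carrier S) k h) =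
        compose (carrier S) m (compose (carrier S) l (compose (carrier S) k h))"
      using compose_assoc[of "compose (carrier S) k h" "carrier S" "carrier U" m l] algebra_homsD(3)[OF kh] by simp
    show "pairing W (\<alpha> W (compose (carrier S) (compose (carrier U) m l) (compose (carrier S) k h)) (arr D V W m x))
          (arr N U W (compose (carrier U) m l) n) =
        m (pairing V (\<alpha> V (compose (carrier S) l (compose (carrier S) k h)) x) (arr N U V l n))"
      unfolding c dual_arr nat[OF \<alpha> V W lkh m x] set_functorD(3)[OF N_set U V W l m n, symmetric]
      by (rule pairing_simps(6)[OF V cl[OF \<alpha> V lkh x] nV W m])
  qed
  have "?l \<beta> = ?l \<gamma>"
  proof (rule reflexive_eq_on_evaluations[OF refl U mem mem])
    fix V l g assume V: "V \<in> algebras R" and l: "l \<in> algebra_homs R U V" and g: "g \<in> carrier (obj G V)"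
    show "val V (res U V l (?l \<beta>)) (to_distributions R G V g) = val V (res U V l (?l \<gamma>)) (to_distributions R G V g)"
      unfolding val_res_family[OF U V l to_distributions_mem[OF V g]]
      using eq[OF V compose_mem_algebra_homs[OF S kh l] g] by simp
  qed simp_all
  \<comment> \<open>At the base change of \<open>w\<close> the functional returns the pairing of
    \<open>n\<close> with the base change of \<alpha>(w), by naturality of \<alpha>.\<close>
  then have "val U (?l \<beta>) (res T U k w) = val U (?l \<gamma>) (res T U k w)" by simp
  moreover have "val U (?l \<alpha>) (res T U k w) = pairing U (arr B T U k (\<alpha> T h w)) n" if \<alpha>: "\<alpha> \<in> {\<beta>, \<gamma>}" for \<alpha>
    unfolding val_family[OF U res_D[OF T U k w]] set_functorD(1)[OF N_set U n]
      Id_compose[OF algebra_homsD(3,2)[OF kh]] nat[OF \<alpha> T U h k w] ..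
  ultimately show "pairing U (arr B T U k (\<beta> T h w)) n = pairing U (arr B T U k (\<gamma> T h w)) n" by simp
qed (use cl[of \<beta> T h w] cl[of \<gamma> T h w] T h w in simp_all)

section \<open>Extension of a morphism of monoids to distributions\<close>

context
  fixes \<phi> assumes phi: "\<phi> \<in> monoid_morphisms R G B"
begin

lemmas phiD = monoid_morphismD[OF B phi]

text \<open>These are the matrix coefficients of \<phi>, with \<phi>(g) viewed as a linear form on
  \<open>N\<close>.\<close>

definition coefficient :: "'u alg \<Rightarrow> 'n \<Rightarrow> 'u alg \<Rightarrow> 'g \<Rightarrow> 'u" where
  "coefficient S n = family R G S (\<lambda>T h g. pairing T (\<phi> T g) (arr N S T h n))"

lemma coefficient_mem:
  assumes S: "S \<in> algebras R" and n: "n \<in> carrier (obj N S)"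
  shows "coefficient S n \<in> carrier (obj A S)"
  unfolding coefficient_def
proof (rule family_mem_functions[OF G_set S])
  fix T h g assume T: "T \<in> algebras R" and h: "h \<in> algebra_homs R S T" and g: "g \<in> carrier (obj G T)"
  note nT = set_functorD(2)[OF N_set S T h n]
  show "pairing T (\<phi> T g) (arr N S T h n) \<in> carrier T"
    by (rule pairing_simps(1)[OF T phiD(1)[OF T g] nT])
  fix U k assume U: "U \<in> algebras R" and k: "k \<in> algebra_homs R T U"
  show "pairing U (\<phi> U (arr G T U k g)) (arr N S U (compose (carrier S) k h) n) =
      k (pairing T (\<phi> T g) (arr N S T h n))"
    by (simp only: phiD(4)[OF T U k g] pairing_simps(6)[OF T phiD(1)[OF T g] nT U k]
        flip: set_functorD(3)[OF N_set S T U h k n])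
qed

lemma res_coefficient:
  assumes S: "S \<in> algebras R" and T: "T \<in> algebras R" and h: "h \<in> algebra_homs R S T" and n: "n \<in> carrier (obj N S)"
  shows "res S T h (coefficient S n) = coefficient T (arr N S T h n)"
  unfolding coefficient_def res_family[OF S T h]
  by (rule family_cong[OF T]) (simp add: set_functorD(3)[OF N_set S T _ h _ n])

lemma val_coefficient:
  assumes S: "S \<in> algebras R" and n: "n \<in> carrier (obj N S)" and g: "g \<in> carrier (obj G S)"
  shows "val S (coefficient S n) g = pairing S (\<phi> S g) n"
  unfolding coefficient_def val_family[OF S g] by (simp add: set_functorD(1)[OF N_set S n])

lemma N_ops:
  assumes "S \<in> algebras R" "T \<in> algebras R" "h \<in> algebra_homs R S T" "n \<in> carrier (obj N S)"
  shows "n' \<in> carrier (obj N S) \<Longrightarrow> arr N S T h (n \<oplus>\<^bsub>obj N S\<^esub> n') = arr N S T h n \<oplus>\<^bsub>obj N T\<^esub> arr N S T h n'"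
    "s \<in> carrier S \<Longrightarrow> arr N S T h (s \<odot>\<^bsub>obj N S\<^esub> n) = h s \<odot>\<^bsub>obj N T\<^esub> arr N S T h n"
  using N assms by (simp_all add: module_functor_def)

text \<open>Linearity is inherited from the second argument of the pairing; together with
  \<open>res_coefficient\<close> it makes \<open>coefficient\<close> a morphism from
  \<open>N\<close> to \<open>A\<close>.\<close>

lemma coefficient_linear:
  assumes S: "S \<in> algebras R" and n: "n \<in> carrier (obj N S)"
  shows "n' \<in> carrier (obj N S) \<Longrightarrow>
      coefficient S (n \<oplus>\<^bsub>obj N S\<^esub> n') = coefficient S n \<oplus>\<^bsub>obj A S\<^esub> coefficient S n'"
    "s \<in> carrier S \<Longrightarrow> coefficient S (s \<odot>\<^bsub>obj N S\<^esub> n) = s \<odot>\<^bsub>obj A S\<^esub> coefficient S n"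
proof -
  note simps = res_coefficient[OF S] res_ops[OF S] val_ops A_extensional coefficient_mem val_coefficient
    set_functorD(2)[OF N_set S] algebra_homs_closed N_ops[OF S] module_closed[OF N] pairing_simps phiD(1)
  show "coefficient S (n \<oplus>\<^bsub>obj N S\<^esub> n') = coefficient S n \<oplus>\<^bsub>obj A S\<^esub> coefficient S n'"
    if "n' \<in> carrier (obj N S)"
    by (rule A_ext[OF S]) (use S n that in \<open>simp_all only: coefficient_mem module_closed[OF N] A_ops_closed simps\<close>)
  show "coefficient S (s \<odot>\<^bsub>obj N S\<^esub> n) = s \<odot>\<^bsub>obj A S\<^esub> coefficient S n" if "s \<in> carrier S"
    by (rule A_ext[OF S]) (use S n that in \<open>simp_all only: coefficient_mem module_closed[OF N] A_ops_closed simps\<close>)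
qed

text \<open>The transpose of \<open>coefficient\<close>, from the dual of \<open>A\<close> to the
  dual of \<open>N\<close>, followed by the identification \<sigma> of the latter with
  \<open>B\<close>.\<close>

definition dual_extension :: "'u alg \<Rightarrow> ('u alg \<Rightarrow> ('u alg \<Rightarrow> 'g \<Rightarrow> 'u) \<Rightarrow> 'u) \<Rightarrow> 'b" where
  "dual_extension = (\<lambda>S\<in>algebras R. \<lambda>w\<in>carrier (obj D S).
     \<sigma> S (family R N S (\<lambda>T h n. val T (res S T h w) (coefficient T n))))"

lemma dual_extension_family_mem:
  assumes S: "S \<in> algebras R" and w: "w \<in> carrier (obj D S)"
  shows "family R N S (\<lambda>T h n. val T (res S T h w) (coefficient T n)) \<in> carrier (obj (dual R N) S)"
proof (rule family_mem_dual[OF N S])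
  fix T h x y s assume T: "T \<in> algebras R" and h: "h \<in> algebra_homs R S T" and x: "x \<in> carrier (obj N T)"
  note wT = res_D[OF S T h w] and cx = coefficient_mem[OF T x]
  show "val T (res S T h w) (coefficient T x) \<in> carrier T"
    by (rule val_D_closed[OF T wT cx])
  show "val T (res S T h w) (coefficient T (s \<odot>\<^bsub>obj N T\<^esub> x)) = s \<otimes>\<^bsub>T\<^esub> val T (res S T h w) (coefficient T x)"
    if "s \<in> carrier T"
    unfolding coefficient_linear(2)[OF T x that] by (rule val_dual_linear(2)[OF A_module T wT that cx])
  show "val T (res S T h w) (coefficient T (x \<oplus>\<^bsub>obj N T\<^esub> y)) =
      val T (res S T h w) (coefficient T x) \<oplus>\<^bsub>T\<^esub> val T (res S T h w) (coefficient T y)"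
    if y: "y \<in> carrier (obj N T)"
    unfolding coefficient_linear(1)[OF T x y]
    by (rule val_dual_linear(1)[OF A_module T wT cx coefficient_mem[OF T y]])
  fix U k assume U: "U \<in> algebras R" and k: "k \<in> algebra_homs R T U"
  show "val U (res S U (compose (carrier S) k h) w) (coefficient U (arr N T U k x)) =
      k (val T (res S T h w) (coefficient T x))"
    using functions_natural[OF A_set T U k dual_memD(1)[OF A_module T wT] cx]
    by (simp only: function_functor_arr res_coefficient[OF T U k x] res_res[OF S T U h k])
qed

lemma dual_extension_closed:
  assumes S: "S \<in> algebras R" and w: "w \<in> carrier (obj D S)"
  shows "dual_extension S w \<in> carrier (obj B S)"
  using sigma_closed[OF S dual_extension_family_mem[OF S w]] S w by (simp add: dual_extension_def)

text \<open>Values on points and linearity of the extension are read off from this formula by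
  \<open>pairing_ext\<close>.\<close>

lemma pairing_dual_extension:
  assumes S: "S \<in> algebras R" and w: "w \<in> carrier (obj D S)" and n: "n \<in> carrier (obj N S)"
  shows "pairing S (dual_extension S w) n = val S w (coefficient S n)"
  using S w
  by (simp add: val_family[OF S n] pairing_def dual_extension_def tau_sigma[OF S dual_extension_family_mem[OF S w]]
     res_id[OF S D_extensional[OF S w]])

lemma dual_extension_natural:
  assumes S: "S \<in> algebras R" and T: "T \<in> algebras R" and h: "h \<in> algebra_homs R S T" and w: "w \<in> carrier (obj D S)"
  shows "dual_extension T (res S T h w) = arr B S T h (dual_extension S w)"
proof -
  \<comment> \<open>Both sides are compared after \<tau>, where they are explicit families;
    \<open>sigma_tau\<close> brings the equation back to \<open>B\<close>.\<close>
  have "\<tau> T (arr B S T h (dual_extension S w)) = res S T h (\<tau> S (dual_extension S w))"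
    by (rule tauD(4)[OF S T h dual_extension_closed[OF S w]])
  also have "\<dots> = family R N T (\<lambda>U k n. val U (res S U (compose (carrier S) k h) w) (coefficient U n))"
    using S w by (simp add: dual_extension_def tau_sigma[OF S dual_extension_family_mem[OF S w]] res_family[OF S T h])
  also have "\<dots> = family R N T (\<lambda>U k n. val U (res T U k (res S T h w)) (coefficient U n))"
    by (rule family_cong[OF T]) (simp add: res_res[OF S T _ h])
  also have "\<dots> = \<tau> T (dual_extension T (res S T h w))"
    using T res_D[OF S T h w] by (simp add: dual_extension_def tau_sigma[OF T dual_extension_family_mem[OF T]])
  finally show ?thesis
    using sigma_tau[OF T set_functorD(2)[OF B_set S T h dual_extension_closed[OF S w]]]
      sigma_tau[OF T dual_extension_closed[OF T res_D[OF S T h w]]] by metis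
qed

text \<open>Paired with \<open>n\<close>, the left side is the coefficient of \<open>n\<close>
  evaluated at \<open>g\<close>, which is \<phi>(g)(n).\<close>

lemma dual_extension_to_distributions:
  assumes S: "S \<in> algebras R" and g: "g \<in> carrier (obj G S)"
  shows "dual_extension S (to_distributions R G S g) = \<phi> S g"
proof (rule pairing_ext[OF S])
  fix T h n assume T: "T \<in> algebras R" and h: "h \<in> algebra_homs R S T" and n: "n \<in> carrier (obj N T)"
  have gT: "arr G S T h g \<in> carrier (obj G T)" by (rule G_simps(6)[OF S T h g])
  have "arr B S T h (dual_extension S (to_distributions R G S g)) =
      dual_extension T (to_distributions R G T (arr G S T h g))"
    by (simp only: res_to_distributions[OF S T h g] flip: dual_extension_natural[OF S T h to_distributions_mem[OF S g]])
  moreover have "pairing T (dual_extension T (to_distributions R G T (arr G S T h g))) n =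
      pairing T (\<phi> T (arr G S T h g)) n"
    by (simp only: pairing_dual_extension[OF T to_distributions_mem[OF T gT] n]
      val_to_distributions[OF T gT coefficient_mem[OF T n]] val_coefficient[OF T n gT])
  ultimately show "pairing T (arr B S T h (dual_extension S (to_distributions R G S g))) n =
      pairing T (arr B S T h (\<phi> S g)) n"
    by (simp only: phiD(4)[OF S T h g])
qed (simp_all add: S g dual_extension_closed to_distributions_mem phiD)

lemma dual_extension_linear:
  assumes S: "S \<in> algebras R" and w: "w \<in> carrier (obj D S)"
  shows "w' \<in> carrier (obj D S) \<Longrightarrow> dual_extension S (w \<oplus>\<^bsub>obj (function_functor R A) S\<^esub> w') =
      dual_extension S w \<oplus>\<^bsub>obj B S\<^esub> dual_extension S w'"
    "s \<in> carrier S \<Longrightarrow> dual_extension S (s \<odot>\<^bsub>obj (function_functor R A) S\<^esub> w) = s \<odot>\<^bsub>obj B S\<^esub> dual_extension S w"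
proof -
  show "dual_extension S (w \<oplus>\<^bsub>obj (function_functor R A) S\<^esub> w') =
      dual_extension S w \<oplus>\<^bsub>obj B S\<^esub> dual_extension S w'" if w': "w' \<in> carrier (obj D S)"
  proof (rule pairing_ext[OF S])
    fix T h n assume T: "T \<in> algebras R" and h: "h \<in> algebra_homs R S T" and n: "n \<in> carrier (obj N T)"
    note wT = res_D[OF S T h w] and wT' = res_D[OF S T h w'] and c = coefficient_mem[OF T n]
    have "pairing T (arr B S T h (dual_extension S (w \<oplus>\<^bsub>obj (function_functor R A) S\<^esub> w'))) n =
        val T (res S T h w \<oplus>\<^bsub>obj (function_functor R A) T\<^esub> res S T h w') (coefficient T n)"
      by (simp only: pairing_dual_extension[OF T D_closed(1)[OF T wT wT'] n] res_ops(1)[OF S T h]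
          flip: dual_extension_natural[OF S T h D_closed(1)[OF S w w']])
    also have "\<dots> = pairing T (dual_extension T (res S T h w)) n \<oplus>\<^bsub>T\<^esub> pairing T (dual_extension T (res S T h w')) n"
      by (simp only: val_add[OF T c D_extensional[OF T wT] D_extensional[OF T wT']]
          pairing_dual_extension[OF T wT n] pairing_dual_extension[OF T wT' n])
    also have "\<dots> = pairing T (arr B S T h (dual_extension S w \<oplus>\<^bsub>obj B S\<^esub> dual_extension S w')) n"
      by (simp only: pairing_simps(2)[OF T dual_extension_closed[OF T wT] n dual_extension_closed[OF T wT']]
          ring_hom_add[OF algebra_functorD(5)[OF B S T h] dual_extension_closed[OF S w] dual_extension_closed[OF S w']]
          flip: dual_extension_natural[OF S T h w] dual_extension_natural[OF S T h w'])
    finally show "pairing T (arr B S T h (dual_extension S (w \<oplus>\<^bsub>obj (function_functor R A) S\<^esub> w'))) n =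
        pairing T (arr B S T h (dual_extension S w \<oplus>\<^bsub>obj B S\<^esub> dual_extension S w')) n" .
  qed (simp_all add: S w w' dual_extension_closed D_closed module_closed[OF B_module])
  show "dual_extension S (s \<odot>\<^bsub>obj (function_functor R A) S\<^esub> w) = s \<odot>\<^bsub>obj B S\<^esub> dual_extension S w"
    if s: "s \<in> carrier S"
  proof (rule pairing_ext[OF S])
    fix T h n assume T: "T \<in> algebras R" and h: "h \<in> algebra_homs R S T" and n: "n \<in> carrier (obj N T)"
    note wT = res_D[OF S T h w] and c = coefficient_mem[OF T n] and hs = algebra_homs_closed[OF h s]
    have "pairing T (arr B S T h (dual_extension S (s \<odot>\<^bsub>obj (function_functor R A) S\<^esub> w))) n =
        val T (h s \<odot>\<^bsub>obj (function_functor R A) T\<^esub> res S T h w) (coefficient T n)"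
      by (simp only: pairing_dual_extension[OF T D_closed(2)[OF T hs wT] n] res_ops(2)[OF S T h s]
          flip: dual_extension_natural[OF S T h D_closed(2)[OF S s w]])
    also have "\<dots> = h s \<otimes>\<^bsub>T\<^esub> pairing T (dual_extension T (res S T h w)) n"
      by (simp only: val_smult[OF T c D_extensional[OF T wT] hs] pairing_dual_extension[OF T wT n])
    also have "\<dots> = pairing T (arr B S T h (s \<odot>\<^bsub>obj B S\<^esub> dual_extension S w)) n"
      by (simp only: pairing_simps(3)[OF T dual_extension_closed[OF T wT] n hs]
          algebra_functorD(6)[OF B S T h s dual_extension_closed[OF S w]]
          flip: dual_extension_natural[OF S T h w])
    finally show "pairing T (arr B S T h (dual_extension S (s \<odot>\<^bsub>obj (function_functor R A) S\<^esub> w))) n =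
        pairing T (arr B S T h (s \<odot>\<^bsub>obj B S\<^esub> dual_extension S w)) n" .
  qed (simp_all add: S s w dual_extension_closed D_closed module_closed[OF B_module])
qed

lemma B_ring:
  assumes S: "S \<in> algebras R"
  shows "x \<in> carrier (obj B S) \<Longrightarrow> y \<in> carrier (obj B S) \<Longrightarrow> x \<otimes>\<^bsub>obj B S\<^esub> y \<in> carrier (obj B S)"
    "x \<in> carrier (obj B S) \<Longrightarrow> y \<in> carrier (obj B S) \<Longrightarrow> z \<in> carrier (obj B S) \<Longrightarrow>
       (x \<oplus>\<^bsub>obj B S\<^esub> y) \<otimes>\<^bsub>obj B S\<^esub> z = x \<otimes>\<^bsub>obj B S\<^esub> z \<oplus>\<^bsub>obj B S\<^esub> y \<otimes>\<^bsub>obj B S\<^esub> z"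
    "x \<in> carrier (obj B S) \<Longrightarrow> y \<in> carrier (obj B S) \<Longrightarrow> z \<in> carrier (obj B S) \<Longrightarrow>
       z \<otimes>\<^bsub>obj B S\<^esub> (x \<oplus>\<^bsub>obj B S\<^esub> y) = z \<otimes>\<^bsub>obj B S\<^esub> x \<oplus>\<^bsub>obj B S\<^esub> z \<otimes>\<^bsub>obj B S\<^esub> y"
proof -
  interpret ring "obj B S" by (rule algebra_functorD[OF B S])
  show "x \<in> carrier (obj B S) \<Longrightarrow> y \<in> carrier (obj B S) \<Longrightarrow> x \<otimes>\<^bsub>obj B S\<^esub> y \<in> carrier (obj B S)"
    "x \<in> carrier (obj B S) \<Longrightarrow> y \<in> carrier (obj B S) \<Longrightarrow> z \<in> carrier (obj B S) \<Longrightarrow>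
       (x \<oplus>\<^bsub>obj B S\<^esub> y) \<otimes>\<^bsub>obj B S\<^esub> z = x \<otimes>\<^bsub>obj B S\<^esub> z \<oplus>\<^bsub>obj B S\<^esub> y \<otimes>\<^bsub>obj B S\<^esub> z"
    "x \<in> carrier (obj B S) \<Longrightarrow> y \<in> carrier (obj B S) \<Longrightarrow> z \<in> carrier (obj B S) \<Longrightarrow>
       z \<otimes>\<^bsub>obj B S\<^esub> (x \<oplus>\<^bsub>obj B S\<^esub> y) = z \<otimes>\<^bsub>obj B S\<^esub> x \<oplus>\<^bsub>obj B S\<^esub> z \<otimes>\<^bsub>obj B S\<^esub> y"
    by (simp_all add: l_distr r_distr)
qed

text \<open>The ring and algebra laws of distributions, restated with the operations in which
  \<open>linear_families_eq\<close> expects them.\<close>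

lemma distribution_mult_linear:
  assumes S: "S \<in> algebras R" and w: "w \<in> carrier (obj D S)" "w' \<in> carrier (obj D S)"
  shows "v \<in> carrier (obj D S) \<Longrightarrow> dmult S (w \<oplus>\<^bsub>obj (function_functor R A) S\<^esub> w') v =
      dmult S w v \<oplus>\<^bsub>obj (function_functor R A) S\<^esub> dmult S w' v"
    "v \<in> carrier (obj D S) \<Longrightarrow> dmult S v (w \<oplus>\<^bsub>obj (function_functor R A) S\<^esub> w') =
      dmult S v w \<oplus>\<^bsub>obj (function_functor R A) S\<^esub> dmult S v w'"
    "s \<in> carrier S \<Longrightarrow> dmult S (s \<odot>\<^bsub>obj (function_functor R A) S\<^esub> w) w' = s \<odot>\<^bsub>obj (function_functor R A) S\<^esub> dmult S w w'"
    "s \<in> carrier S \<Longrightarrow> dmult S w (s \<odot>\<^bsub>obj (function_functor R A) S\<^esub> w') = s \<odot>\<^bsub>obj (function_functor R A) S\<^esub> dmult S w w'"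
proof -
  interpret ring "obj (distribution_functor R G) S"
    by (rule algebra_functorD(2)[OF distribution_algebra_functor S])
  note smult = algebra_functorD(3,4)[OF distribution_algebra_functor S, of s w w']
  show "dmult S (w \<oplus>\<^bsub>obj (function_functor R A) S\<^esub> w') v =
      dmult S w v \<oplus>\<^bsub>obj (function_functor R A) S\<^esub> dmult S w' v" if "v \<in> carrier (obj D S)"
    using l_distr[of w w' v] w that by simp
  show "dmult S v (w \<oplus>\<^bsub>obj (function_functor R A) S\<^esub> w') =
      dmult S v w \<oplus>\<^bsub>obj (function_functor R A) S\<^esub> dmult S v w'" if "v \<in> carrier (obj D S)"
    using r_distr[of w w' v] w that by simp
  show "dmult S (s \<odot>\<^bsub>obj (function_functor R A) S\<^esub> w) w' = s \<odot>\<^bsub>obj (function_functor R A) S\<^esub> dmult S w w'"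
    if "s \<in> carrier S"
    using smult(1) w that by simp
  show "dmult S w (s \<odot>\<^bsub>obj (function_functor R A) S\<^esub> w') = s \<odot>\<^bsub>obj (function_functor R A) S\<^esub> dmult S w w'"
    if "s \<in> carrier S"
    using smult(2) w that by simp
qed

lemma dual_extension_mult:
  assumes S: "S \<in> algebras R" and w: "w \<in> carrier (obj D S)" "w' \<in> carrier (obj D S)"
  shows "dual_extension S (dmult S w w') = dual_extension S w \<otimes>\<^bsub>obj B S\<^esub> dual_extension S w'"
proof -
  note simps = dual_extension_closed mult_mem B_ring dual_extension_linear distribution_mult_linear
    algebra_functorD(3,4)[OF B] ring_hom_mult[OF algebra_functorD(5)[OF B]]
  \<comment> \<open>A point on the left, any distribution on the right, and any base: the second use
    of uniqueness needs this for the points over all algebras under the original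
    \<open>S\<close>.\<close>
  have left: "dual_extension S (dmult S (to_distributions R G S g) v) = \<phi> S g \<otimes>\<^bsub>obj B S\<^esub> dual_extension S v"
    if S: "S \<in> algebras R" and g: "g \<in> carrier (obj G S)" and v: "v \<in> carrier (obj D S)" for S g v
  proof -
    \<comment> \<open>The point is moved along \<open>h\<close>, so that both maps are defined and
      linear over every \<open>T\<close> under \<open>S\<close>.\<close>
    let ?\<beta> = "\<lambda>T h v. dual_extension T (dmult T (to_distributions R G T (arr G S T h g)) v)"
    let ?\<gamma> = "\<lambda>T h v. \<phi> T (arr G S T h g) \<otimes>\<^bsub>obj B T\<^esub> dual_extension T v"
    have "?\<beta> S (\<lambda>s\<in>carrier S. s) v = ?\<gamma> S (\<lambda>s\<in>carrier S. s) v"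
    proof (rule linear_families_eq[where \<beta> = ?\<beta> and \<gamma> = ?\<gamma>, OF S _ _ _ _ _ S id_mem_algebra_homs[OF S] v])
      fix \<alpha> T U h k x assume "\<alpha> \<in> {?\<beta>, ?\<gamma>}" and T: "T \<in> algebras R" and U: "U \<in> algebras R"
        and h: "h \<in> algebra_homs R S T" and k: "k \<in> algebra_homs R T U" and x: "x \<in> carrier (obj D T)"
      have gT: "arr G S T h g \<in> carrier (obj G T)" by (rule G_simps(6)[OF S T h g])
      have gU: "arr G S U (compose (carrier S) k h) g = arr G T U k (arr G S T h g)"
        by (simp add: set_functorD(3)[OF G_set S T U h k g])
      have "?\<beta> U (compose (carrier S) k h) (res T U k x) = arr B T U k (?\<beta> T h x)"
        by (simp add: gU T U k x gT to_distributions_mem mult_mem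
           flip: res_to_distributions res_mult dual_extension_natural)
      moreover have "?\<gamma> U (compose (carrier S) k h) (res T U k x) = arr B T U k (?\<gamma> T h x)"
        by (simp add: gU T U k x gT dual_extension_natural phiD simps)
      ultimately show "\<alpha> U (compose (carrier S) k h) (res T U k x) = arr B T U k (\<alpha> T h x)"
        using \<open>\<alpha> \<in> {?\<beta>, ?\<gamma>}\<close> by auto
    next
      \<comment> \<open>Both sides are the value of \<phi> at the product of the two points, since
        point evaluations and \<phi> are multiplicative.\<close>
      fix T h g' assume T: "T \<in> algebras R" and h: "h \<in> algebra_homs R S T" and g': "g' \<in> carrier (obj G T)"
      have gT: "arr G S T h g \<in> carrier (obj G T)" by (rule G_simps(6)[OF S T h g])
      show "?\<beta> T h (to_distributions R G T g') = ?\<gamma> T h (to_distributions R G T g')"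
        by (simp add: T gT g' dual_extension_to_distributions phiD G_simps flip: to_distributions_mult)
    qed (auto simp: S g simps phiD(1) G_simps(6)[OF S] to_distributions_mem)
    then show ?thesis by (simp add: set_functorD(1)[OF G_set S g])
  qed
  \<comment> \<open>Now \<open>w'\<close> is fixed and moved along \<open>h\<close>; when the left
    factor is a point, the two maps agree by \<open>left\<close>.\<close>
  let ?\<beta> = "\<lambda>T h v. dual_extension T (dmult T v (res S T h w'))"
  let ?\<gamma> = "\<lambda>T h v. dual_extension T v \<otimes>\<^bsub>obj B T\<^esub> dual_extension T (res S T h w')"
  have "?\<beta> S (\<lambda>s\<in>carrier S. s) w = ?\<gamma> S (\<lambda>s\<in>carrier S. s) w"
  proof (rule linear_families_eq[where \<beta> = ?\<beta> and \<gamma> = ?\<gamma>, OF S _ _ _ _ _ S id_mem_algebra_homs[OF S] w(1)])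
    fix \<alpha> T U h k x assume "\<alpha> \<in> {?\<beta>, ?\<gamma>}" and T: "T \<in> algebras R" and U: "U \<in> algebras R"
      and h: "h \<in> algebra_homs R S T" and k: "k \<in> algebra_homs R T U" and x: "x \<in> carrier (obj D T)"
    have wT: "res S T h w' \<in> carrier (obj D T)" by (rule res_D[OF S T h w(2)])
    have wU: "res S U (compose (carrier S) k h) w' = res T U k (res S T h w')"
      by (simp add: res_res[OF S T U h k])
    have "?\<beta> U (compose (carrier S) k h) (res T U k x) = arr B T U k (?\<beta> T h x)"
      by (simp add: wU T U k x wT mult_mem flip: res_mult dual_extension_natural)
    moreover have "?\<gamma> U (compose (carrier S) k h) (res T U k x) = arr B T U k (?\<gamma> T h x)"
      by (simp add: wU T U k x wT dual_extension_natural simps)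
    ultimately show "\<alpha> U (compose (carrier S) k h) (res T U k x) = arr B T U k (\<alpha> T h x)"
      using \<open>\<alpha> \<in> {?\<beta>, ?\<gamma>}\<close> by auto
  qed (auto simp: S w simps res_D[OF S] left dual_extension_to_distributions)
  then show ?thesis by (simp add: res_id[OF S D_extensional[OF S w(2)]])
qed

lemma dual_extension_mem: "dual_extension \<in> algebra_morphisms R (distribution_functor R G) B"
proof -
  have "dual_extension S (to_distributions R G S \<one>\<^bsub>obj G S\<^esub>) = \<one>\<^bsub>obj B S\<^esub>" if "S \<in> algebras R" for S
    using that by (simp add: dual_extension_to_distributions G_simps phiD)
  then have "dual_extension S \<in> ring_hom (obj (distribution_functor R G) S) (obj B S)" if "S \<in> algebras R" for S
    using that
    by (intro ring_hom_memI) (simp_all add: dual_extension_closed dual_extension_linear dual_extension_mult)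
  moreover have "dual_extension \<in> (\<Pi>\<^sub>E S\<in>algebras R. carrier (obj D S) \<rightarrow>\<^sub>E carrier (obj B S))"
    using dual_extension_closed by (auto simp: dual_extension_def PiE_iff)
  ultimately show ?thesis
    unfolding algebra_morphisms_def module_morphisms_def nat_trans_def
    by (simp add: dual_extension_natural dual_extension_linear)
qed

end

lemma distributions_universal:
  "bij_betw (\<lambda>\<psi>. comp_trans R G \<psi> (to_distributions R G))
    (algebra_morphisms R (distribution_functor R G) B) (monoid_morphisms R G B)"
proof (rule bij_betw_byWitness[where f' = dual_extension])
  let ?c = "\<lambda>\<psi>. comp_trans R G \<psi> (to_distributions R G)"
  have mem: "?c \<psi> \<in> monoid_morphisms R G B" if "\<psi> \<in> algebra_morphisms R (distribution_functor R G) B" for \<psi>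
    by (rule comp_monoid_morphism[OF that])
      (simp_all add: to_distributions_mem to_distributions_mult res_to_distributions)
  then show "?c ` algebra_morphisms R (distribution_functor R G) B \<subseteq> monoid_morphisms R G B" by blast
  show "dual_extension ` monoid_morphisms R G B \<subseteq> algebra_morphisms R (distribution_functor R G) B"
    using dual_extension_mem by blast
  show "\<forall>\<psi>\<in>algebra_morphisms R (distribution_functor R G) B. dual_extension (?c \<psi>) = \<psi>"
  proof (intro ballI algebra_morphism_eqI[OF dual_extension_mem[OF mem]])
    fix \<psi> S w assume \<psi>: "\<psi> \<in> algebra_morphisms R (distribution_functor R G) B"
      and S: "S \<in> algebras R" and "w \<in> carrier (obj (distribution_functor R G) S)"
    then have w: "w \<in> carrier (obj D S)" by simp
    note D\<psi> = algebra_morphismD[OF \<psi>, unfolded distribution_simps]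
      and De = algebra_morphismD[OF dual_extension_mem[OF mem[OF \<psi>]], unfolded distribution_simps]
    show "dual_extension (?c \<psi>) S w = \<psi> S w"
    \<comment> \<open>Both morphisms are defined over \<open>R\<close>, so as families they do not
      depend on \<open>h\<close>.\<close>
    proof (rule linear_families_eq[where \<beta> = "\<lambda>T h. dual_extension (?c \<psi>) T" and \<gamma> = "\<lambda>T h. \<psi> T",
          OF S _ _ _ _ _ S id_mem_algebra_homs[OF S] w])
      fix T g assume T: "T \<in> algebras R" and g: "g \<in> carrier (obj G T)"
      show "dual_extension (?c \<psi>) T (to_distributions R G T g) = \<psi> T (to_distributions R G T g)"
        unfolding dual_extension_to_distributions[OF mem[OF \<psi>] T g] by (simp add: comp_trans_def T g)
    qed (auto simp: D\<psi>(1,2,4,6) De(1,2,4,6))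
  qed
  show "\<forall>\<phi>\<in>monoid_morphisms R G B. ?c (dual_extension \<phi>) = \<phi>"
  proof
    fix \<phi> assume \<phi>: "\<phi> \<in> monoid_morphisms R G B"
    then have e: "\<phi> \<in> extensional (algebras R)" "\<And>S. S \<in> algebras R \<Longrightarrow> \<phi> S \<in> extensional (carrier (obj G S))"
      by (auto simp: monoid_morphisms_def nat_trans_def PiE_iff)
    show "?c (dual_extension \<phi>) = \<phi>"
      by (rule extensionalityI[OF _ e(1)]; (rule extensionalityI[OF _ e(2)])?)
        (simp_all add: comp_trans_def dual_extension_to_distributions[OF \<phi>])
  qed
qed

end

section \<open>Passage through the monoid algebra\<close>

context monoid_functor_base
begin

lemma to_distributions_monoid_morphism: "to_distributions R G \<in> monoid_morphisms R G (distribution_functor R G)"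
proof -
  have "to_distributions R G \<in> (\<Pi>\<^sub>E S\<in>algebras R. carrier (obj G S) \<rightarrow>\<^sub>E carrier (obj D S))"
    using to_distributions_mem by (auto simp: to_distributions_def evaluation_def PiE_iff)
  then show ?thesis
    unfolding monoid_morphisms_def nat_trans_def
    by (simp add: hom_def to_distributions_mem to_distributions_mult res_to_distributions Pi_iff)
qed

text \<open>Through this the universal property of the monoid algebra shows that the natural map
  from \<open>RG\<close> to distributions is a morphism of algebras.\<close>

lemma monoid_algebra_to_distributions_eq:
  "monoid_algebra_to_distributions R G = linear_extension R G (distribution_functor R G) (to_distributions R G)"
  by (simp only: monoid_algebra_to_distributions_def linear_extension_def)

lemmas monoid_algebra_to_distributions_mem =
  linear_extension_mem[OF distribution_algebra_functor to_distributions_monoid_morphism,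
    folded monoid_algebra_to_distributions_eq]

lemma comp_algebra_morphism:
  assumes \<eta>: "\<eta> \<in> algebra_morphisms R RG F" and \<psi>: "\<psi> \<in> algebra_morphisms R F B"
  shows "comp_trans R RG \<psi> \<eta> \<in> algebra_morphisms R RG B"
proof -
  note D = algebra_morphismD[OF \<eta>, simplified] algebra_morphismD[OF \<psi>]
  note cl = monoid_algebra_closed
  have one: "(\<lambda>g. if g = \<one>\<^bsub>obj G S\<^esub> then \<one>\<^bsub>S\<^esub> else \<zero>\<^bsub>S\<^esub>) \<in> carrier (monoid_algebra S (obj G S))"
    if "S \<in> algebras R" for S
    using delta_mem[OF that G_simps(2)[OF that]] by (simp add: delta_eq[OF that G_simps(2)[OF that]])
  have "comp_trans R RG \<psi> \<eta> S \<in> ring_hom (obj RG S) (obj B S)" if S: "S \<in> algebras R" for S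
    by (rule ring_hom_memI) (simp_all add: comp_trans_def S D cl one)
  moreover have "comp_trans R RG \<psi> \<eta> \<in> (\<Pi>\<^sub>E S\<in>algebras R. carrier (obj RG S) \<rightarrow>\<^sub>E carrier (obj B S))"
    by (auto simp: comp_trans_def D)
  ultimately show ?thesis
    unfolding algebra_morphisms_def module_morphisms_def nat_trans_def
    by (simp add: comp_trans_def D cl)
qed

text \<open>Linear extension keeps the values on points, so the three natural morphisms form a
  commuting triangle.\<close>

lemma comp_to_distributions_eq:
  assumes "\<psi> \<in> algebra_morphisms R (distribution_functor R G) B"
  shows "comp_trans R G (comp_trans R RG \<psi> (monoid_algebra_to_distributions R G)) \<delta> =
    comp_trans R G \<psi> (to_distributions R G)"
  unfolding comp_trans_def
  by (intro restrict_ext)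
    (simp add: delta_mem monoid_algebra_to_distributions_eq
      linear_extension_delta[OF distribution_algebra_functor to_distributions_monoid_morphism])

text \<open>The functor of modules to be dualised is \<open>A\<close>, and the isomorphism is the
  identity: distributions and \<open>D\<close> share carrier, sums, multiples and arrows.\<close>

lemma distribution_dual_algebra: "dual_algebra_functor R A (distribution_functor R G)"
proof -
  \<comment> \<open>Source and target are left open so that the same fact provides the isomorphism
    and its inverse.\<close>
  have id: "(\<lambda>S\<in>algebras R. \<lambda>w\<in>carrier (obj D S). w) \<in> module_morphisms R F H"
    if "F \<in> {D, distribution_functor R G}" "H \<in> {D, distribution_functor R G}" for F H
    using that D_closed res_D by (auto simp: module_morphisms_def nat_trans_def)
  have "module_isomorphism R (distribution_functor R G) D (\<lambda>S\<in>algebras R. \<lambda>w\<in>carrier (obj D S). w)"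
    unfolding module_isomorphism_def
    by (intro conjI bexI[of _ "\<lambda>S\<in>algebras R. \<lambda>w\<in>carrier (obj D S). w"] id) auto
  then show ?thesis
    unfolding dual_algebra_functor_def using distribution_algebra_functor A_module by blast
qed

end

text \<open>Two out of three: \<open>q\<close> has to be \<open>p\<close> followed by the inverse of
  \<open>r\<close>.\<close>

lemma bij_betw_factor:
  assumes "bij_betw r Y Z" "bij_betw p X Z" "\<And>x. x \<in> X \<Longrightarrow> q x \<in> Y" "\<And>x. x \<in> X \<Longrightarrow> r (q x) = p x"
  shows "bij_betw q X Y"
proof (rule bij_betwI')
  fix x x' assume "x \<in> X" "x' \<in> X"
  then show "q x = q x' \<longleftrightarrow> x = x'"
    using assms(2,4) by (metis bij_betw_inv_into_left)
next
  fix y assume y: "y \<in> Y"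
  then obtain x where "x \<in> X" "p x = r y" using assms(1,2) by (metis bij_betwE bij_betw_iff_bijections)
  then show "\<exists>x\<in>X. y = q x" using assms(1,3,4) y by (metis bij_betw_inv_into_left)
qed (rule assms(3))

theorem theorem6p1:
  fixes R :: "'u ring"
    and G :: "('u, 'g, 'g monoid) alg_functor"
    and N :: "('u, 'n, ('u, 'n) module) alg_functor"
    and B :: "('u, 'b, ('u, 'b) module) alg_functor"
  assumes "cring R"
    and "monoid_functor R G"
    and "reflexive R (function_functor R G)"
    and "dual_algebra_functor R N B"
  shows "dual_algebra_functor R (function_functor R G) (distribution_functor R G) \<and>
         bij_betw (\<lambda>\<phi>. comp_trans R G \<phi> (to_monoid_algebra R G))
           (algebra_morphisms R (monoid_algebra_functor G) B)
           (monoid_morphisms R G B) \<and>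
         bij_betw (\<lambda>\<phi>. comp_trans R (monoid_algebra_functor G) \<phi> (monoid_algebra_to_distributions R G))
           (algebra_morphisms R (distribution_functor R G) B)
           (algebra_morphisms R (monoid_algebra_functor G) B) \<and>
         bij_betw (\<lambda>\<phi>. comp_trans R G \<phi> (to_distributions R G))
           (algebra_morphisms R (distribution_functor R G) B)
           (monoid_morphisms R G B)"
proof -
  from assms(4) obtain \<tau> \<sigma> where B: "algebra_functor R B" and N: "module_functor R N"
    and \<tau>: "\<tau> \<in> module_morphisms R B (dual R N)" and \<sigma>: "\<sigma> \<in> module_morphisms R (dual R N) B"
    and inv: "\<forall>S\<in>algebras R. (\<forall>x\<in>carrier (obj B S). \<sigma> S (\<tau> S x) = x) \<and>
      (\<forall>y\<in>carrier (obj (dual R N) S). \<tau> S (\<sigma> S y) = y)"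
    unfolding dual_algebra_functor_def module_isomorphism_def by blast
  interpret dual_algebra_setting R G N B \<tau> \<sigma>
    by (intro dual_algebra_setting.intro monoid_functor_base.intro base_ring.intro
        monoid_functor_base_axioms.intro dual_algebra_setting_axioms.intro) (use assms B N \<tau> \<sigma> inv in blast)+
  note RG = monoid_algebra_universal[OF B] and D = distributions_universal
  \<comment> \<open>Restriction to points is bijective from \<open>RG\<close> and from
    distributions; the map between the two sets of morphisms commutes with it and is therefore
    bijective as well.\<close>
  have "bij_betw (\<lambda>\<phi>. comp_trans R RG \<phi> (monoid_algebra_to_distributions R G))
      (algebra_morphisms R (distribution_functor R G) B) (algebra_morphisms R RG B)"
    by (rule bij_betw_factor[OF RG D])
      (simp_all only: comp_algebra_morphism[OF monoid_algebra_to_distributions_mem] comp_to_distributions_eq)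
  then show ?thesis using distribution_dual_algebra RG D by blast
qed

end
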